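(* For every $n\in\mathbb{N}$ there exists a unique number $m_0(n)\in\mathbb{N}$ (depending only on $n$, not on $\mu$) such that for every real $\mu>0$ and every $m\in\mathbb{N}$, the domain $$D_{n,m}=\{(z,\zeta)\in\mathbb{C}^n\times\mathbb{C}^m : \|\zeta\|^2<e^{-\mu\|z\|^2}\}$$ is a Lu Qi-Keng domain if and only if $m\geq m_0(n)$.
   Context: $\mathbb{N}=\{1,2,3,\dots\}$ and $\|\cdot\|$ is the standard Euclidean (Hermitian) norm. For a domain $\Omega\subset\mathbb{C}^N$, the Bergman kernel $K_\Omega(z,w)$, $z,w\in\Omega$, is the reproducing kernel of the Hilbert space of holomorphic functions on $\Omega$ that are square integrable with respect to Lebesgue measure. $\Omega$ is called a Lu Qi-Keng domain if $K_\Omega$ has no zeros on $\Omega\times\Omega$. *)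

theory Defs
  imports "HOL-Analysis.Analysis"
begin

text \<open>
  The dimension is quantified inside formulas, so complex N-space is the set of extensional
  functions on \<open>{..<N}\<close> rather than a type. All its members agree (with value \<open>undefined\<close>) from
  index N on; hence the subspace topology inherited from the product topology on
  \<^typ>\<open>nat \<Rightarrow> complex\<close> is the Euclidean one, and the set is also the space of the finite product
  measure \<open>lebesgue_C N\<close> below.
\<close>

definition cspace :: "nat \<Rightarrow> (nat \<Rightarrow> complex) set" where
  "cspace N = (\<Pi>\<^sub>E i\<in>{..<N}. UNIV)"

definition cdist :: "nat \<Rightarrow> (nat \<Rightarrow> complex) \<Rightarrow> (nat \<Rightarrow> complex) \<Rightarrow> real" where
  "cdist N z w = L2_set (\<lambda>i. cmod (z i - w i)) {..<N}"

definition lebesgue_C :: "nat \<Rightarrow> (nat \<Rightarrow> complex) measure" where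
  "lebesgue_C N = (\<Pi>\<^sub>M i\<in>{..<N}. lborel)"

definition cdomain :: "nat \<Rightarrow> (nat \<Rightarrow> complex) set \<Rightarrow> bool" where
  "cdomain N \<Omega> \<longleftrightarrow> openin (top_of_set (cspace N)) \<Omega> \<and> connected \<Omega> \<and> \<Omega> \<noteq> {}"

text \<open>
  Holomorphy on an open subset of complex N-space: complex Frechet differentiability at every
  point, the complex-linear derivative at z being \<open>v \<mapsto> (\<Sum>i<N. a i * v i)\<close>.
\<close>

definition cholomorphic_on :: "nat \<Rightarrow> ((nat \<Rightarrow> complex) \<Rightarrow> complex) \<Rightarrow> (nat \<Rightarrow> complex) set \<Rightarrow> bool" where
  "cholomorphic_on N f \<Omega> \<longleftrightarrow>
     (\<forall>z\<in>\<Omega>. \<exists>a :: nat \<Rightarrow> complex.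
        ((\<lambda>w. (f w - f z - (\<Sum>i<N. a i * (w i - z i))) / of_real (cdist N w z)) \<longlongrightarrow> 0)
          (at z within \<Omega>))"

text \<open>Values outside \<open>\<Omega>\<close> are irrelevant: members represent functions on \<open>\<Omega>\<close>.\<close>

definition bergman_space :: "nat \<Rightarrow> (nat \<Rightarrow> complex) set \<Rightarrow> ((nat \<Rightarrow> complex) \<Rightarrow> complex) set" where
  "bergman_space N \<Omega> =
     {f. cholomorphic_on N f \<Omega> \<and> set_integrable (lebesgue_C N) \<Omega> (\<lambda>z. (cmod (f z))\<^sup>2)}"

text \<open>
  The reproducing property determines a kernel on \<open>\<Omega> \<times> \<Omega>\<close> only; the value 0 elsewhere is a
  convention that makes the definite description unique.
\<close>

definition is_bergman_kernel ::
    "nat \<Rightarrow> (nat \<Rightarrow> complex) set \<Rightarrow> ((nat \<Rightarrow> complex) \<Rightarrow> (nat \<Rightarrow> complex) \<Rightarrow> complex) \<Rightarrow> bool" where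
  "is_bergman_kernel N \<Omega> K \<longleftrightarrow>
     (\<forall>w\<in>\<Omega>. (\<lambda>z. K z w) \<in> bergman_space N \<Omega> \<and>
        (\<forall>f\<in>bergman_space N \<Omega>.
           f w = set_lebesgue_integral (lebesgue_C N) \<Omega> (\<lambda>z. f z * cnj (K z w)))) \<and>
     (\<forall>z w. z \<notin> \<Omega> \<or> w \<notin> \<Omega> \<longrightarrow> K z w = 0)"

definition bergman_kernel ::
    "nat \<Rightarrow> (nat \<Rightarrow> complex) set \<Rightarrow> (nat \<Rightarrow> complex) \<Rightarrow> (nat \<Rightarrow> complex) \<Rightarrow> complex" where
  "bergman_kernel N \<Omega> = (THE K. is_bergman_kernel N \<Omega> K)"

definition lu_qi_keng_domain :: "nat \<Rightarrow> (nat \<Rightarrow> complex) set \<Rightarrow> bool" where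
  "lu_qi_keng_domain N \<Omega> \<longleftrightarrow>
     cdomain N \<Omega> \<and> (\<forall>z\<in>\<Omega>. \<forall>w\<in>\<Omega>. bergman_kernel N \<Omega> z w \<noteq> 0)"

text \<open>
  A pair \<open>(z, \<zeta>)\<close> with n and m coordinates is stored as one vector x with \<open>n + m\<close> coordinates:
  \<open>z\<close> is \<open>x 0, \<dots>, x (n - 1)\<close> and \<open>\<zeta>\<close> is \<open>x n, \<dots>, x (n + m - 1)\<close>.
\<close>

definition D_dom :: "real \<Rightarrow> nat \<Rightarrow> nat \<Rightarrow> (nat \<Rightarrow> complex) set" where
  "D_dom \<mu> n m =
     {x \<in> cspace (n + m).
        (L2_set (\<lambda>j. cmod (x (n + j))) {..<m})\<^sup>2 < exp (- \<mu> * (L2_set (\<lambda>i. cmod (x i)) {..<n})\<^sup>2)}"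

end

theory Submission
  imports Defs
    "HOL-Complex_Analysis.Cauchy_Integral_Formula"
    "HOL-Computational_Algebra.Fundamental_Theorem_Algebra"
    "HOL-Probability.Distributions"
begin

text \<open>
  Write a point of the domain \<open>D\<close> as \<open>(z, \<zeta>)\<close>. Over each \<open>z\<close> the fibre is a ball around 0, so a
  holomorphic function \<open>f\<close> on \<open>D\<close> is the sum of its parts \<open>f\<^sub>k\<close> that are homogeneous of degree k in
  \<open>\<zeta>\<close>; by homogeneity \<open>f\<^sub>k\<close> makes sense on all of complex \<open>(n + m)\<close>-space (\<open>hom_part\<close>).

  The reproducing kernel of \<open>D\<close> is found degree by degree. A Gaussian \<open>exp (- |\<zeta>|\<^sup>2)\<close> is a
  superposition of indicator functions of balls, and balls are dilates of each other; so for a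
  function that is homogeneous in \<open>\<zeta>\<close> the integral over \<open>D\<close> equals, up to a factorial, the integral
  over the whole space against \<open>exp (- |\<zeta>|\<^sup>2 - \<mu> (k + m) |z|\<^sup>2)\<close> (\<open>gaussian_transfer\<close>). For such a
  weight the reproducing kernel is an exponential: completing the square moves the point of
  evaluation to the origin, where the mean value property on circles applies
  (\<open>fock_reproducing\<close>). Only translations, dilations and circle rotations of Lebesgue measure enter,
  no monomial norms. The result is that integrating \<open>f\<close> against the conjugate of
  \<open>\<langle>\<zeta>, \<zeta>'\<rangle>\<^sup>k exp (\<mu> (k + m) \<langle>z, z'\<rangle>)\<close> gives a known multiple of \<open>f\<^sub>k (z', \<zeta>')\<close>
  (\<open>coefficient_integral\<close>). Summing over k shows that the Bergman kernel is a zero-free factor times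
  \<open>\<Phi> n m t = (\<Sum>k. (k + m)! / k! * (k + m) ^ n * t ^ k)\<close> at \<open>t = exp (\<mu> \<langle>z, z'\<rangle>) * \<langle>\<zeta>, \<zeta>'\<rangle>\<close>
  (\<open>kernel_series\<close>, \<open>bergman_kernel_D\<close>). The argument t runs exactly through the open unit disc, so
  \<open>D\<close> is a Lu Qi-Keng domain iff \<open>\<Phi> n m\<close> has no zero there (\<open>lu_qi_keng_iff\<close>); \<open>\<mu>\<close> has disappeared.

  The substitution \<open>u = 1 / (1 - t)\<close> turns the disc into the half plane \<open>Re u > 1/2\<close> and \<open>\<Phi> n m\<close>
  into a polynomial in u. Passing from m to \<open>m + 1\<close> is differentiation in t, that is \<open>u\<^sup>2\<close> times
  differentiation in u, so by the half-plane form of the Gauss-Lucas theorem zero-freeness is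
  inherited by \<open>m + 1\<close> (\<open>kernel_poly_zero_free_Suc\<close>). For large m the leading term of the polynomial
  dominates on the half plane (\<open>kernel_poly_zero_free_eventually\<close>). Hence the good m form a nonempty
  up-set, and its least element is the threshold.
\<close>

section \<open>Affine substitutions in complex coordinate space\<close>

text \<open>
  Uniqueness of Haar measure up to a factor. Both sides are the double integral of
  \<open>indicator A y * indicator B (x - y)\<close>: the left one is obtained by integrating over x first, the
  right one by substituting \<open>y + x\<close> for y and then integrating over x.
\<close>

lemma translation_invariant_measure_unique:
  fixes \<nu> :: "'a::euclidean_space measure"
  assumes sets: "sets \<nu> = sets borel" and sf: "sigma_finite_measure \<nu>"
    and inv: "\<And>c. distr \<nu> borel (\<lambda>x. x + c) = \<nu>"
    and A: "A \<in> sets borel" and B: "B \<in> sets borel"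
  shows "emeasure \<nu> A * emeasure lborel B = emeasure lborel A * emeasure \<nu> (uminus -` B)"
proof -
  interpret \<nu>: sigma_finite_measure \<nu> by fact
  interpret P: pair_sigma_finite lborel \<nu> by standard
  note [measurable] = A B
  have [measurable_cong]: "sets \<nu> = sets borel" by fact
  have trN: "(\<integral>\<^sup>+y. f y \<partial>\<nu>) = (\<integral>\<^sup>+y. f (y + c) \<partial>\<nu>)" if [measurable]: "f \<in> borel_measurable borel" for f c
    by (subst inv[symmetric, of c], subst nn_integral_distr) simp_all
  have trL: "(\<integral>\<^sup>+y. f y \<partial>lborel) = (\<integral>\<^sup>+y. f (c + y) \<partial>lborel)"
    if [measurable]: "f \<in> borel_measurable borel" for f and c :: 'a
  proof -
    have "lborel = distr lborel borel (\<lambda>x::'a. c + x)"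
      using lborel_affine[of 1 c] by (simp add: density_1)
    then have "(\<integral>\<^sup>+y. f y \<partial>lborel) = (\<integral>\<^sup>+y. f y \<partial>distr lborel borel (\<lambda>x::'a. c + x))" by simp
    then show ?thesis by (subst (asm) nn_integral_distr) simp_all
  qed
  have "emeasure \<nu> A * emeasure lborel B = (\<integral>\<^sup>+y. indicator A y * emeasure lborel B \<partial>\<nu>)"
    by (subst nn_integral_multc) (auto simp: sets)
  also have "\<dots> = (\<integral>\<^sup>+y. (\<integral>\<^sup>+x. indicator A y * indicator B (x - y) \<partial>lborel) \<partial>\<nu>)"
  proof (rule nn_integral_cong)
    fix y
    have "emeasure lborel B = (\<integral>\<^sup>+x. indicator B (- y + x) \<partial>lborel)"
      by (subst trL[symmetric]) auto
    then show "indicator A y * emeasure lborel B = (\<integral>\<^sup>+x. indicator A y * indicator B (x - y) \<partial>lborel)"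
      by (subst nn_integral_cmult) (auto simp: algebra_simps)
  qed
  also have "\<dots> = (\<integral>\<^sup>+x. (\<integral>\<^sup>+y. indicator A y * indicator B (x - y) \<partial>\<nu>) \<partial>lborel)"
    by (rule P.Fubini'[where f="\<lambda>x y. indicator A y * indicator B (x - y)"]) simp
  also have "\<dots> = (\<integral>\<^sup>+x. (\<integral>\<^sup>+y. indicator A (y + x) * indicator B (- y) \<partial>\<nu>) \<partial>lborel)"
  proof (rule nn_integral_cong)
    fix x
    show "(\<integral>\<^sup>+y. indicator A y * indicator B (x - y) \<partial>\<nu>) = (\<integral>\<^sup>+y. indicator A (y + x) * indicator B (- y) \<partial>\<nu>)"
      by (subst trN[of "\<lambda>y. indicator A y * indicator B (x - y)" x]) simp_all
  qed
  also have "\<dots> = (\<integral>\<^sup>+y. (\<integral>\<^sup>+x. indicator A (y + x) * indicator B (- y) \<partial>lborel) \<partial>\<nu>)"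
    by (rule P.Fubini'[where f="\<lambda>x y. indicator A (y + x) * indicator B (- y)", symmetric]) simp
  also have "\<dots> = (\<integral>\<^sup>+y. emeasure lborel A * indicator (uminus -` B) y \<partial>\<nu>)"
  proof (rule nn_integral_cong)
    fix y
    have "emeasure lborel A = (\<integral>\<^sup>+x. indicator A (y + x) \<partial>lborel)"
      by (subst trL[symmetric]) auto
    then show "(\<integral>\<^sup>+x. indicator A (y + x) * indicator B (- y) \<partial>lborel)
       = emeasure lborel A * indicator (uminus -` B) y"
      by (subst nn_integral_multc) (auto simp: indicator_def)
  qed
  also have "\<dots> = emeasure lborel A * emeasure \<nu> (uminus -` B)"
  proof -
    have "uminus -` B \<inter> space borel \<in> sets (borel :: 'a measure)" by (rule measurable_sets[OF _ B]) simp
    then show ?thesis by (subst nn_integral_cmult) (auto simp: sets)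
  qed
  finally show ?thesis .
qed

lemma complex_mult_vimage_ball:
  fixes a :: complex assumes "a \<noteq> 0"
  shows "(\<lambda>x. a * x) -` ball 0 r = ball 0 (r / cmod a)"
  using assms by (auto simp: norm_mult field_simps)

text \<open>
  Multiplication by \<open>a\<close> carries Lebesgue measure to a translation invariant measure, so it only
  rescales it; the area of the unit disc fixes the factor. This covers rotations and dilations at
  once.
\<close>

lemma emeasure_lborel_complex_affine_vimage:
  fixes a b :: complex
  assumes a: "a \<noteq> 0" and A: "A \<in> sets borel"
  shows "emeasure lborel ((\<lambda>x. a * x + b) -` A) = ennreal (1 / (cmod a)\<^sup>2) * emeasure lborel A"
proof -
  define \<nu> where "\<nu> = distr lborel borel (\<lambda>x. a * x)"
  have sets: "sets \<nu> = sets borel" by (simp add: \<nu>_def)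
  have shift: "distr lborel borel (\<lambda>x::complex. x + c) = lborel" for c
    using lborel_affine[of 1 c] by (simp add: density_1 add.commute)
  have ball: "emeasure \<nu> (ball 0 r) = ennreal (pi * (r / cmod a)\<^sup>2)" if "r \<ge> 0" for r
  proof -
    have "emeasure \<nu> (ball 0 r) = emeasure lborel (ball (0::complex) (r / cmod a))"
      unfolding \<nu>_def by (subst emeasure_distr) (simp_all add: complex_mult_vimage_ball[OF a])
    also have "\<dots> = ennreal (pi * (r / cmod a)\<^sup>2)"
      using that by (subst emeasure_ball) (simp_all add: unit_ball_vol_2)
    finally show ?thesis .
  qed
  have sf: "sigma_finite_measure \<nu>"
  proof
    have fin: "emeasure \<nu> (ball 0 (real n)) \<noteq> top" for n by (simp add: ball)
    have sp: "space \<nu> = UNIV" by (simp add: \<nu>_def)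
    have "(\<Union>n::nat. ball (0::complex) (real n)) = UNIV"
      by (auto simp: reals_Archimedean2)
    then show "\<exists>A. countable A \<and> A \<subseteq> sets \<nu> \<and> \<Union> A = space \<nu> \<and> (\<forall>a\<in>A. emeasure \<nu> a \<noteq> \<infinity>)"
      by (intro exI[of _ "range (\<lambda>n::nat. ball 0 (real n))"]) (auto simp: fin sets sp)
  qed
  have inv: "distr \<nu> borel (\<lambda>x. x + c) = \<nu>" for c
  proof -
    have "distr \<nu> borel (\<lambda>x. x + c) = distr lborel borel (\<lambda>x. a * x + c)"
      unfolding \<nu>_def by (subst distr_distr) (auto simp: comp_def)
    also have "\<dots> = distr (distr lborel borel (\<lambda>x. x + c / a)) borel (\<lambda>x. a * x)"
      using a by (subst distr_distr) (auto simp: comp_def distrib_left)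
    finally show ?thesis by (simp add: shift \<nu>_def)
  qed
  have key: "emeasure \<nu> A = ennreal (1 / (cmod a)\<^sup>2) * emeasure lborel A" if A: "A \<in> sets borel" for A
  proof -
    have un: "uminus -` ball (0::complex) 1 = ball 0 1" by auto
    have "emeasure \<nu> A * ennreal pi = emeasure lborel A * ennreal (pi * (1 / cmod a)\<^sup>2)"
      using translation_invariant_measure_unique[OF sets sf inv A, of "ball 0 1"] ball[of 1]
      by (simp add: un emeasure_ball unit_ball_vol_2)
    also have "\<dots> = (ennreal (1 / (cmod a)\<^sup>2) * emeasure lborel A) * ennreal pi"
      by (subst ennreal_mult) (auto simp: power_divide mult_ac)
    finally show ?thesis
      by (metis ennreal_eq_0_iff ennreal_mult_cancel_left ennreal_neq_top mult.commute not_le pi_gt_zero)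
  qed
  have "emeasure lborel ((\<lambda>x. a * x + b) -` A) = emeasure (distr lborel borel (\<lambda>x. a * x + b)) A"
    using A by (subst emeasure_distr) auto
  also have "distr lborel borel (\<lambda>x. a * x + b) = distr \<nu> borel (\<lambda>x. x + b)"
    unfolding \<nu>_def by (subst distr_distr) (auto simp: comp_def)
  also have "\<dots> = \<nu>" by (rule inv)
  finally show ?thesis using key[OF A] by simp
qed

text \<open>
  A diagonal affine map; it specialises to translations, to rotations of all coordinates or of a
  block of them, and to dilations.
\<close>

definition affine_map :: "nat set \<Rightarrow> (nat \<Rightarrow> complex) \<Rightarrow> (nat \<Rightarrow> complex) \<Rightarrow> (nat \<Rightarrow> complex) \<Rightarrow> nat \<Rightarrow> complex" where
  "affine_map J a b x = (\<lambda>i\<in>J. a i * x i + b i)"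

abbreviation lebesgue_PiM :: "nat set \<Rightarrow> (nat \<Rightarrow> complex) measure" where
  "lebesgue_PiM J \<equiv> (\<Pi>\<^sub>M i\<in>J. lborel)"

lemma measurable_affine_map [measurable]: "affine_map J a b \<in> measurable (lebesgue_PiM J) (lebesgue_PiM J)"
  unfolding affine_map_def by measurable

interpretation cpl: product_sigma_finite "\<lambda>i::nat. lborel :: complex measure"
  by standard

text \<open>
  A product measure is determined by its values on boxes, and on boxes the substitution acts
  coordinatewise.
\<close>

lemma nn_integral_affine_map:
  assumes J: "finite J" and a: "\<And>i. i \<in> J \<Longrightarrow> a i \<noteq> 0"
    and g[measurable]: "g \<in> borel_measurable (lebesgue_PiM J)"
  shows "(\<integral>\<^sup>+x. g x \<partial>lebesgue_PiM J) = ennreal (\<Prod>i\<in>J. (cmod (a i))\<^sup>2) * (\<integral>\<^sup>+x. g (affine_map J a b x) \<partial>lebesgue_PiM J)"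
proof -
  let ?c = "\<Prod>i\<in>J. (cmod (a i))\<^sup>2"
  have "density (distr (lebesgue_PiM J) (lebesgue_PiM J) (affine_map J a b)) (\<lambda>_. ennreal ?c) = lebesgue_PiM J"
  proof (rule cpl.PiM_eqI[OF J])
    fix A :: "nat \<Rightarrow> complex set" assume A: "\<And>i. i \<in> J \<Longrightarrow> A i \<in> sets lborel"
    have m: "Pi\<^sub>E J A \<in> sets (lebesgue_PiM J)" using J A by (intro sets_PiM_I_finite) auto
    have A': "(\<lambda>x. a i * x + b i) -` A i \<in> sets borel" if "i \<in> J" for i
      using measurable_sets[of "\<lambda>x. a i * x + b i" borel borel "A i"] A[OF that] by simp
    have "emeasure (density (distr (lebesgue_PiM J) (lebesgue_PiM J) (affine_map J a b)) (\<lambda>_. ennreal ?c)) (Pi\<^sub>E J A)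
      = ennreal ?c * emeasure (distr (lebesgue_PiM J) (lebesgue_PiM J) (affine_map J a b)) (Pi\<^sub>E J A)"
      by (subst emeasure_density) (use m in \<open>auto simp: nn_integral_cmult_indicator\<close>)
    also have "emeasure (distr (lebesgue_PiM J) (lebesgue_PiM J) (affine_map J a b)) (Pi\<^sub>E J A)
      = emeasure (lebesgue_PiM J) (\<Pi>\<^sub>E i\<in>J. (\<lambda>x. a i * x + b i) -` A i)"
      using m by (subst emeasure_distr) (auto simp: affine_map_def space_PiM PiE_iff intro!: arg_cong[where f="emeasure (lebesgue_PiM J)"])
    also have "\<dots> = (\<Prod>i\<in>J. emeasure lborel ((\<lambda>x. a i * x + b i) -` A i))"
      using J A' by (subst cpl.emeasure_PiM) auto
    also have "\<dots> = (\<Prod>i\<in>J. ennreal (1 / (cmod (a i))\<^sup>2) * emeasure lborel (A i))"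
      using A a by (intro prod.cong refl emeasure_lborel_complex_affine_vimage) auto
    also have "\<dots> = ennreal (\<Prod>i\<in>J. 1 / (cmod (a i))\<^sup>2) * (\<Prod>i\<in>J. emeasure lborel (A i))"
      by (simp add: prod.distrib prod_ennreal)
    finally have "emeasure (density (distr (lebesgue_PiM J) (lebesgue_PiM J) (affine_map J a b)) (\<lambda>_. ennreal ?c)) (Pi\<^sub>E J A)
      = ennreal (?c * (\<Prod>i\<in>J. 1 / (cmod (a i))\<^sup>2)) * (\<Prod>i\<in>J. emeasure lborel (A i))"
      by (simp add: ennreal_mult prod_nonneg mult.assoc)
    also have "?c * (\<Prod>i\<in>J. 1 / (cmod (a i))\<^sup>2) = 1"
      using a by (simp add: prod.distrib[symmetric])
    finally show "emeasure (density (distr (lebesgue_PiM J) (lebesgue_PiM J) (affine_map J a b)) (\<lambda>_. ennreal ?c)) (Pi\<^sub>E J A)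
      = (\<Prod>i\<in>J. emeasure lborel (A i))" by simp
  qed simp
  then have "(\<integral>\<^sup>+x. g x \<partial>lebesgue_PiM J) = (\<integral>\<^sup>+x. g x \<partial>density (distr (lebesgue_PiM J) (lebesgue_PiM J) (affine_map J a b)) (\<lambda>_. ennreal ?c))"
    by simp
  also have "\<dots> = (\<integral>\<^sup>+x. ennreal ?c * g x \<partial>distr (lebesgue_PiM J) (lebesgue_PiM J) (affine_map J a b))"
    by (subst nn_integral_density) simp_all
  also have "\<dots> = (\<integral>\<^sup>+x. ennreal ?c * g (affine_map J a b x) \<partial>lebesgue_PiM J)"
    by (subst nn_integral_distr) simp_all
  finally show ?thesis by (simp add: nn_integral_cmult)
qed

lemma distr_affine_map_unimodular:
  assumes J: "finite J" and a: "\<And>i. i \<in> J \<Longrightarrow> cmod (a i) = 1"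
  shows "distr (lebesgue_PiM J) (lebesgue_PiM J) (affine_map J a b) = lebesgue_PiM J"
proof (rule measure_eqI)
  fix A assume "A \<in> sets (distr (lebesgue_PiM J) (lebesgue_PiM J) (affine_map J a b))"
  then have A[measurable]: "A \<in> sets (lebesgue_PiM J)" by simp
  have "a i \<noteq> 0" if "i \<in> J" for i using a[OF that] by auto
  then have "(\<integral>\<^sup>+x. indicator A x \<partial>lebesgue_PiM J) = ennreal (\<Prod>i\<in>J. (cmod (a i))\<^sup>2) * (\<integral>\<^sup>+x. indicator A (affine_map J a b x) \<partial>lebesgue_PiM J)"
    by (intro nn_integral_affine_map J) auto
  also have "(\<Prod>i\<in>J. (cmod (a i))\<^sup>2) = 1" by (intro prod.neutral) (simp add: a)
  also have "(\<integral>\<^sup>+x. indicator A (affine_map J a b x) \<partial>lebesgue_PiM J) = (\<integral>\<^sup>+x. indicator A x \<partial>distr (lebesgue_PiM J) (lebesgue_PiM J) (affine_map J a b))"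
    by (subst nn_integral_distr) simp_all
  finally show "emeasure (distr (lebesgue_PiM J) (lebesgue_PiM J) (affine_map J a b)) A = emeasure (lebesgue_PiM J) A" by simp
qed simp

section \<open>Averaging over the unit circle\<close>

definition circle_pt :: "real \<Rightarrow> complex" where "circle_pt t = exp (2 * of_real pi * \<i> * of_real t)"

text \<open>
  Normalised arc length on the unit circle, carried by the parameter interval of \<open>circle_pt\<close>.
\<close>

definition circ :: "real measure" where "circ = restrict_space lborel {0..1}"

lemma space_circ [simp]: "space circ = {0..1}"
  by (simp add: circ_def space_restrict_space)

interpretation circ: prob_space circ
proof
  show "emeasure circ (space circ) = 1"
    by (simp add: circ_def emeasure_restrict_space space_restrict_space)
qed

lemma measurable_circ: "f \<in> measurable borel N \<Longrightarrow> f \<in> measurable circ N"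
  unfolding circ_def by (intro measurable_restrict_space1) simp

lemma cmod_circle_pt [simp]: "cmod (circle_pt t) = 1"
  by (simp add: circle_pt_def)

lemma circle_pt_nz [simp]: "circle_pt t \<noteq> 0"
  by (simp add: circle_pt_def)

lemma continuous_on_circle_pt [continuous_intros]: "continuous_on S circle_pt"
  unfolding circle_pt_def by (intro continuous_intros)

lemma circle_pt_measurable [measurable]: "circle_pt \<in> borel_measurable circ"
  by (intro measurable_circ borel_measurable_continuous_onI continuous_intros)

lemma cnj_borel_measurable [measurable]: "cnj \<in> borel_measurable borel"
  by (intro borel_measurable_continuous_onI continuous_intros)

lemma integral_circ_eq:
  fixes f :: "real \<Rightarrow> complex"
  assumes "continuous_on {0..1} f"
  shows "integrable circ f" "(f has_integral (\<integral>t. f t \<partial>circ)) {0..1}"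
proof -
  have si: "set_integrable lborel {0..1} f"
    unfolding set_integrable_def using assms by (intro borel_integrable_compact) auto
  then show "integrable circ f"
    unfolding circ_def by (subst integrable_restrict_space) (auto simp: set_integrable_def)
  have "(\<integral>t. f t \<partial>circ) = (LINT t:{0..1}|lborel. f t)"
    unfolding circ_def by (subst integral_restrict_space) (auto simp: set_lebesgue_integral_def)
  then show "(f has_integral (\<integral>t. f t \<partial>circ)) {0..1}"
    using set_borel_integral_eq_integral[OF si] by (simp add: has_integral_iff)
qed

text \<open>
  Cauchy's formula for Taylor coefficients, with the contour integral written as an average.
\<close>

lemma higher_deriv_circle_mean:
  assumes hol: "g holomorphic_on ball 0 R" and r: "0 < r" "r < R"
  shows "(\<integral>t. g (of_real r * circle_pt t) * cnj (circle_pt t) ^ k \<partial>circ) = of_real r ^ k * ((deriv ^^ k) g 0 / fact k)"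
proof -
  let ?h = "\<lambda>t. g (of_real r * circle_pt t) * cnj (circle_pt t) ^ k"
  have sub: "cball 0 r \<subseteq> ball (0::complex) R" using r by auto
  have cont: "continuous_on (cball 0 r) g"
    using hol sub holomorphic_on_imp_continuous_on continuous_on_subset by blast
  have "continuous_on {0..1} (\<lambda>t. g (of_real r * circle_pt t))"
    by (rule continuous_on_compose2[OF cont]) (use r in \<open>auto intro!: continuous_intros simp: norm_mult\<close>)
  then have conth: "continuous_on {0..1} ?h" by (intro continuous_intros)
  have "((\<lambda>u. g u / (u - 0) ^ Suc k) has_contour_integral
     (2 * pi * \<i> / fact k * (deriv ^^ k) g 0)) (circlepath 0 r)"
    using r hol sub by (intro Cauchy_has_contour_integral_higher_derivative_circlepath cont)
      (auto intro: holomorphic_on_subset)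
  then have hi: "((\<lambda>t. g (of_real r * circle_pt t) / (of_real r * circle_pt t) ^ Suc k *
      (2 * of_real pi * \<i> * of_real r * circle_pt t)) has_integral (2 * pi * \<i> / fact k * (deriv ^^ k) g 0)) {0..1}"
    unfolding has_contour_integral_def
    by (rule has_integral_cong[THEN iffD1, rotated])
       (simp add: vector_derivative_circlepath01, simp add: circlepath circle_pt_def)
  have "((\<lambda>t. ?h t * (2 * of_real pi * \<i> / of_real r ^ k)) has_integral (2 * pi * \<i> / fact k * (deriv ^^ k) g 0)) {0..1}"
  proof (rule has_integral_cong[THEN iffD1, OF _ hi])
    fix t :: real
    have "circle_pt t * cnj (circle_pt t) = 1"
      using complex_norm_square[of "circle_pt t"] by simp
    then have "cnj (circle_pt t) = 1 / circle_pt t" by (simp add: field_simps)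
    then have "cnj (circle_pt t) ^ k = 1 / circle_pt t ^ k" by (simp add: power_one_over)
    then show "g (of_real r * circle_pt t) / (of_real r * circle_pt t) ^ Suc k *
      (2 * of_real pi * \<i> * of_real r * circle_pt t) = ?h t * (2 * of_real pi * \<i> / of_real r ^ k)"
      using r by (simp add: field_simps power_mult_distrib)
  qed
  moreover have "((\<lambda>t. ?h t * (2 * of_real pi * \<i> / of_real r ^ k)) has_integral
     ((\<integral>t. ?h t \<partial>circ) * (2 * of_real pi * \<i> / of_real r ^ k))) {0..1}"
    by (intro has_integral_mult_left integral_circ_eq(2) conth)
  ultimately have "(\<integral>t. ?h t \<partial>circ) * (2 * of_real pi * \<i> / of_real r ^ k) = 2 * pi * \<i> / fact k * (deriv ^^ k) g 0"
    using has_integral_unique by blast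
  then show ?thesis using r by (simp add: field_simps)
qed

text \<open>
  An integral is unchanged if the integrand is first averaged over a circle group of measure
  preserving maps. Integrability of the joint integrand is automatic, because every rotated copy has
  the same norm.
\<close>

lemma integral_circle_average:
  fixes g :: "'a \<Rightarrow> 'b::{banach, second_countable_topology}"
  assumes "sigma_finite_measure M"
    and R[measurable]: "(\<lambda>(t, x). R t x) \<in> measurable (circ \<Otimes>\<^sub>M M) M"
    and inv: "\<And>t. t \<in> {0..1} \<Longrightarrow> distr M M (R t) = M"
    and g: "integrable M g"
  shows "integrable (circ \<Otimes>\<^sub>M M) (\<lambda>(t, x). g (R t x))"
    and "integrable M (\<lambda>x. \<integral>t. g (R t x) \<partial>circ)"
    and "(\<integral>x. (\<integral>t. g (R t x) \<partial>circ) \<partial>M) = (\<integral>x. g x \<partial>M)"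
proof -
  interpret M: sigma_finite_measure M by fact
  interpret P: pair_sigma_finite circ M by standard
  note [measurable] = borel_measurable_integrable[OF g]
  have Rt[measurable]: "R t \<in> measurable M M" if "t \<in> {0..1}" for t
    using measurable_Pair2[OF R, of t] that by simp
  have int: "integrable M (\<lambda>x. g (R t x))" if "t \<in> {0..1}" for t
  proof -
    have "integrable (distr M M (R t)) g" using g inv[OF that] by simp
    then show ?thesis using Rt[OF that] by (subst (asm) integrable_distr_eq) auto
  qed
  have eq: "(\<integral>x. h (R t x) \<partial>M) = (\<integral>x. h x \<partial>M)" if "t \<in> {0..1}" "h \<in> borel_measurable M"
    for t and h :: "'a \<Rightarrow> 'c::{banach, second_countable_topology}"
    using Rt[OF that(1)] that(2) by (subst (2) inv[OF that(1), symmetric], subst integral_distr) auto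
  show I: "integrable (circ \<Otimes>\<^sub>M M) (\<lambda>(t, x). g (R t x))"
  proof (rule P.Fubini_integrable)
    show "(\<lambda>(t, x). g (R t x)) \<in> borel_measurable (circ \<Otimes>\<^sub>M M)" by measurable
    have "integrable circ (\<lambda>t. \<integral>x. norm (g x) \<partial>M)" by simp
    then show "integrable circ (\<lambda>t. \<integral>x. norm (case (t, x) of (t, x) \<Rightarrow> g (R t x)) \<partial>M)"
      by (rule Bochner_Integration.integrable_cong[THEN iffD1, rotated -1]) (auto simp: eq[of _ "\<lambda>x. norm (g x)"])
    show "AE t in circ. integrable M (\<lambda>x. case (t, x) of (t, x) \<Rightarrow> g (R t x))"
      by (rule AE_I2) (simp add: int)
  qed
  show "integrable M (\<lambda>x. \<integral>t. g (R t x) \<partial>circ)"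
    using P.integrable_snd[OF I] by simp
  have "(\<integral>x. (\<integral>t. g (R t x) \<partial>circ) \<partial>M) = (\<integral>t. (\<integral>x. g (R t x) \<partial>M) \<partial>circ)"
    by (rule P.Fubini_integral[OF I])
  also have "\<dots> = (\<integral>t. (\<integral>x. g x \<partial>M) \<partial>circ)"
    by (rule Bochner_Integration.integral_cong) (auto simp: eq)
  also have "\<dots> = (\<integral>x. g x \<partial>M)" using circ.prob_space by simp
  finally show "(\<integral>x. (\<integral>t. g (R t x) \<partial>circ) \<partial>M) = (\<integral>x. g x \<partial>M)" .
qed

section \<open>Holomorphic functions of several variables\<close>

text \<open>
  The differentiability condition of \<^const>\<open>cholomorphic_on\<close> with the derivative named, so that the
  chain and product rules can be stated for it.
\<close>

definition has_cderiv_at :: "nat \<Rightarrow> (nat \<Rightarrow> complex) set \<Rightarrow> ((nat \<Rightarrow> complex) \<Rightarrow> complex) \<Rightarrow> (nat \<Rightarrow> complex) \<Rightarrow> (nat \<Rightarrow> complex) \<Rightarrow> bool" where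
  "has_cderiv_at N \<Omega> f a z \<longleftrightarrow>
     ((\<lambda>w. (f w - f z - (\<Sum>i<N. a i * (w i - z i))) / of_real (cdist N w z)) \<longlongrightarrow> 0) (at z within \<Omega>)"

lemma cholomorphic_on_iff: "cholomorphic_on N f \<Omega> \<longleftrightarrow> (\<forall>z\<in>\<Omega>. \<exists>a. has_cderiv_at N \<Omega> f a z)"
  by (simp add: cholomorphic_on_def has_cderiv_at_def)

lemma tendsto_coordinate: "((\<lambda>w. w i) \<longlongrightarrow> z i) (at z within \<Omega>)" for z :: "nat \<Rightarrow> complex"
proof -
  have "continuous_on UNIV (\<lambda>w::nat \<Rightarrow> complex. w i)" by (rule continuous_on_product_coordinates)
  then have "((\<lambda>w. w i) \<longlongrightarrow> z i) (at z)" by (simp add: continuous_on_def)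
  then show ?thesis by (rule tendsto_within_subset) simp
qed

lemma cdist_tendsto_0: "((\<lambda>w. cdist N w z) \<longlongrightarrow> 0) (at z within \<Omega>)"
proof -
  have "((\<lambda>w. sqrt (\<Sum>i<N. (cmod (w i - z i))\<^sup>2)) \<longlongrightarrow> sqrt (\<Sum>i<N. (cmod (z i - z i))\<^sup>2)) (at z within \<Omega>)"
    by (intro tendsto_intros tendsto_coordinate)
  then show ?thesis by (simp add: cdist_def L2_set_def)
qed

lemma cdist_eq_0:
  assumes "w \<in> cspace N" "z \<in> cspace N" "cdist N w z = 0"
  shows "w = z"
proof
  fix i
  show "w i = z i"
  proof (cases "i < N")
    case True
    then show ?thesis using assms(3) by (simp add: cdist_def L2_set_eq_0_iff)
  next
    case False
    then show ?thesis using assms(1,2) by (simp add: cspace_def PiE_def extensional_def)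
  qed
qed

lemma cmod_coordinate_le_cdist: "i < N \<Longrightarrow> cmod (w i - z i) \<le> cdist N w z"
  unfolding cdist_def by (rule member_le_L2_set) auto

lemma cmod_linear_form_le: "cmod (\<Sum>i<N. a i * (w i - z i)) \<le> (\<Sum>i<N. cmod (a i)) * cdist N w z"
proof -
  have "cmod (\<Sum>i<N. a i * (w i - z i)) \<le> (\<Sum>i<N. cmod (a i) * cdist N w z)"
    by (rule sum_norm_le) (auto simp: norm_mult intro!: mult_left_mono cmod_coordinate_le_cdist)
  then show ?thesis by (simp add: sum_distrib_right)
qed

lemma cdist_nonneg: "cdist N w z \<ge> 0"
  by (simp add: cdist_def)

lemma eventually_cdist_pos:
  assumes "\<Omega> \<subseteq> cspace N" "z \<in> \<Omega>"
  shows "eventually (\<lambda>w. cdist N w z > 0) (at z within \<Omega>)"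
  using assms cdist_eq_0 cdist_nonneg[of N] unfolding eventually_at_filter
  by (intro always_eventually) (metis order_le_less subsetD)

lemma has_cderiv_at_quotient_bounded:
  assumes "has_cderiv_at N \<Omega> f a z"
  shows "eventually (\<lambda>w. cmod ((f w - f z) / of_real (cdist N w z)) \<le> 1 + (\<Sum>i<N. cmod (a i))) (at z within \<Omega>)"
proof -
  have "eventually (\<lambda>w. cmod ((f w - f z - (\<Sum>i<N. a i * (w i - z i))) / of_real (cdist N w z)) < 1) (at z within \<Omega>)"
    using assms[unfolded has_cderiv_at_def] unfolding tendsto_iff by (auto simp: dist_norm dest: spec[of _ 1])
  then show ?thesis
  proof eventually_elim
    case (elim w)
    let ?l = "\<Sum>i<N. a i * (w i - z i)"
    have "cmod (?l / of_real (cdist N w z)) \<le> (\<Sum>i<N. cmod (a i))"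
      using cmod_linear_form_le[of a w z N] cdist_nonneg[of N w z]
      by (cases "cdist N w z = 0") (auto simp: norm_divide divide_simps sum_nonneg)
    moreover have "(f w - f z) / of_real (cdist N w z) = (f w - f z - ?l) / of_real (cdist N w z) + ?l / of_real (cdist N w z)"
      by (simp add: diff_divide_distrib)
    moreover from this have "cmod ((f w - f z) / of_real (cdist N w z))
        \<le> cmod ((f w - f z - ?l) / of_real (cdist N w z)) + cmod (?l / of_real (cdist N w z))"
      by (simp only: norm_triangle_ineq)
    ultimately show ?case using elim by linarith
  qed
qed

lemma has_cderiv_at_imp_tendsto:
  assumes "\<Omega> \<subseteq> cspace N" "z \<in> \<Omega>" "has_cderiv_at N \<Omega> f a z"
  shows "(f \<longlongrightarrow> f z) (at z within \<Omega>)"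
proof -
  have "((\<lambda>w. (f w - f z - (\<Sum>i<N. a i * (w i - z i))) / of_real (cdist N w z) * of_real (cdist N w z)
      + f z + (\<Sum>i<N. a i * (w i - z i))) \<longlongrightarrow> 0 * of_real 0 + f z + (\<Sum>i<N. a i * (z i - z i))) (at z within \<Omega>)"
    using assms(3) unfolding has_cderiv_at_def
    by (intro tendsto_intros tendsto_coordinate cdist_tendsto_0)
  moreover have "eventually (\<lambda>w. (f w - f z - (\<Sum>i<N. a i * (w i - z i))) / of_real (cdist N w z) * of_real (cdist N w z)
      + f z + (\<Sum>i<N. a i * (w i - z i)) = f w) (at z within \<Omega>)"
    using eventually_cdist_pos[OF assms(1,2)] by eventually_elim auto
  ultimately show ?thesis by (simp add: tendsto_cong)
qed

lemma cholomorphic_imp_continuous_on: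
  assumes "\<Omega> \<subseteq> cspace N" "cholomorphic_on N f \<Omega>"
  shows "continuous_on \<Omega> f"
  using assms has_cderiv_at_imp_tendsto unfolding continuous_on_def cholomorphic_on_iff by blast

lemma cholomorphic_on_linear_form: "cholomorphic_on N (\<lambda>x. \<Sum>i<N. b i * x i) \<Omega>"
  unfolding cholomorphic_on_def
  by (auto intro!: exI[of _ b] simp: sum_subtractf[symmetric] right_diff_distrib)

lemma cholomorphic_on_mult:
  assumes \<Omega>: "\<Omega> \<subseteq> cspace N" and f: "cholomorphic_on N f \<Omega>" and g: "cholomorphic_on N g \<Omega>"
  shows "cholomorphic_on N (\<lambda>x. f x * g x) \<Omega>"
  unfolding cholomorphic_on_iff
proof
  fix z assume z: "z \<in> \<Omega>"
  obtain a where a: "has_cderiv_at N \<Omega> f a z" using f z by (auto simp: cholomorphic_on_iff)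
  obtain b where b: "has_cderiv_at N \<Omega> g b z" using g z by (auto simp: cholomorphic_on_iff)
  let ?d = "\<lambda>w. complex_of_real (cdist N w z)"
  let ?A = "\<lambda>w. (f w - f z - (\<Sum>i<N. a i * (w i - z i)))"
  let ?B = "\<lambda>w. (g w - g z - (\<Sum>i<N. b i * (w i - z i)))"
  have fz: "(f \<longlongrightarrow> f z) (at z within \<Omega>)" by (rule has_cderiv_at_imp_tendsto[OF \<Omega> z a])
  have "((\<lambda>w. (f w - f z) * ((g w - g z) / ?d w)) \<longlongrightarrow> 0) (at z within \<Omega>)"
  proof (rule Lim_null_comparison)
    show "eventually (\<lambda>w. norm ((f w - f z) * ((g w - g z) / ?d w)) \<le> cmod (f w - f z) * (1 + (\<Sum>i<N. cmod (b i)))) (at z within \<Omega>)"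
      using has_cderiv_at_quotient_bounded[OF b] by eventually_elim (subst norm_mult, intro mult_left_mono, auto)
    have "((\<lambda>w. cmod (f w - f z) * (1 + (\<Sum>i<N. cmod (b i)))) \<longlongrightarrow> cmod (f z - f z) * (1 + (\<Sum>i<N. cmod (b i)))) (at z within \<Omega>)"
      by (intro tendsto_intros fz)
    then show "((\<lambda>w. cmod (f w - f z) * (1 + (\<Sum>i<N. cmod (b i)))) \<longlongrightarrow> 0) (at z within \<Omega>)" by simp
  qed
  then have "((\<lambda>w. (f w - f z) * ((g w - g z) / ?d w) + f z * (?B w / ?d w) + g z * (?A w / ?d w)) \<longlongrightarrow> 0 + f z * 0 + g z * 0) (at z within \<Omega>)"
    using a b unfolding has_cderiv_at_def by (intro tendsto_intros)
  moreover have "(f w - f z) * ((g w - g z) / ?d w) + f z * (?B w / ?d w) + g z * (?A w / ?d w)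
     = (f w * g w - f z * g z - (\<Sum>i<N. (f z * b i + g z * a i) * (w i - z i))) / ?d w" for w
  proof -
    have "(\<Sum>i<N. (f z * b i + g z * a i) * (w i - z i)) = f z * (\<Sum>i<N. b i * (w i - z i)) + g z * (\<Sum>i<N. a i * (w i - z i))"
      by (simp add: sum_distrib_left sum.distrib[symmetric] algebra_simps)
    then show ?thesis by (simp add: add_divide_distrib[symmetric]) (simp add: algebra_simps)
  qed
  ultimately have "has_cderiv_at N \<Omega> (\<lambda>x. f x * g x) (\<lambda>i. f z * b i + g z * a i) z"
    by (simp add: has_cderiv_at_def)
  then show "\<exists>a. has_cderiv_at N \<Omega> (\<lambda>x. f x * g x) a z" by blast
qed

text \<open>
  Caratheodory's form of the derivative of \<open>h\<close> avoids division by \<open>f w - f z\<close>, which may vanish.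
\<close>

lemma cholomorphic_on_compose:
  assumes \<Omega>: "\<Omega> \<subseteq> cspace N" and f: "cholomorphic_on N f \<Omega>"
    and h: "\<And>z. z \<in> \<Omega> \<Longrightarrow> h field_differentiable at (f z)"
  shows "cholomorphic_on N (\<lambda>x. h (f x)) \<Omega>"
  unfolding cholomorphic_on_iff
proof
  fix z assume z: "z \<in> \<Omega>"
  obtain a where a: "has_cderiv_at N \<Omega> f a z" using f z by (auto simp: cholomorphic_on_iff)
  obtain d where d: "(h has_field_derivative d) (at (f z))" using h[OF z] by (auto simp: field_differentiable_def)
  let ?d = "\<lambda>w. complex_of_real (cdist N w z)"
  let ?A = "\<lambda>w. (f w - f z - (\<Sum>i<N. a i * (w i - z i)))"
  have fz: "(f \<longlongrightarrow> f z) (at z within \<Omega>)" by (rule has_cderiv_at_imp_tendsto[OF \<Omega> z a])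
  obtain s where s: "\<And>y. h y - h (f z) = s y * (y - f z)" "isCont s (f z)" "s (f z) = d"
    using d unfolding CARAT_DERIV by blast
  have "((\<lambda>w. s (f w)) \<longlongrightarrow> s (f z)) (at z within \<Omega>)"
    by (rule isCont_tendsto_compose[OF s(2) fz])
  then have sz: "((\<lambda>w. s (f w) - d) \<longlongrightarrow> 0) (at z within \<Omega>)"
    using s(3) by (simp add: LIM_zero_iff)
  have "((\<lambda>w. (s (f w) - d) * ((f w - f z) / ?d w)) \<longlongrightarrow> 0) (at z within \<Omega>)"
  proof (rule Lim_null_comparison)
    show "eventually (\<lambda>w. norm ((s (f w) - d) * ((f w - f z) / ?d w)) \<le> cmod (s (f w) - d) * (1 + (\<Sum>i<N. cmod (a i)))) (at z within \<Omega>)"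
      using has_cderiv_at_quotient_bounded[OF a] by eventually_elim (subst norm_mult, intro mult_left_mono, auto)
    show "((\<lambda>w. cmod (s (f w) - d) * (1 + (\<Sum>i<N. cmod (a i)))) \<longlongrightarrow> 0) (at z within \<Omega>)"
      by (intro tendsto_mult_left_zero tendsto_norm_zero sz)
  qed
  then have "((\<lambda>w. (s (f w) - d) * ((f w - f z) / ?d w) + d * (?A w / ?d w)) \<longlongrightarrow> 0 + d * 0) (at z within \<Omega>)"
    using a unfolding has_cderiv_at_def by (intro tendsto_intros)
  moreover have "(s (f w) - d) * ((f w - f z) / ?d w) + d * (?A w / ?d w)
     = (h (f w) - h (f z) - (\<Sum>i<N. (d * a i) * (w i - z i))) / ?d w" for w
  proof -
    have "(\<Sum>i<N. (d * a i) * (w i - z i)) = d * (\<Sum>i<N. a i * (w i - z i))"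
      by (simp add: sum_distrib_left mult.assoc)
    then show ?thesis by (simp add: s(1) add_divide_distrib[symmetric]) (simp add: algebra_simps)
  qed
  ultimately have "has_cderiv_at N \<Omega> (\<lambda>x. h (f x)) (\<lambda>i. d * a i) z"
    by (simp add: has_cderiv_at_def)
  then show "\<exists>a. has_cderiv_at N \<Omega> (\<lambda>x. h (f x)) a z" by blast
qed

definition cline :: "nat \<Rightarrow> (nat \<Rightarrow> complex) \<Rightarrow> (nat \<Rightarrow> complex) \<Rightarrow> complex \<Rightarrow> nat \<Rightarrow> complex" where
  "cline N p v l = (\<lambda>i\<in>{..<N}. p i + l * v i)"

lemma cline_in_cspace [simp]: "cline N p v l \<in> cspace N"
  by (simp add: cline_def cspace_def)

lemma continuous_on_cline: "continuous_on S (cline N p v)"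
proof (rule continuous_on_coordinatewise_then_product)
  show "continuous_on S (\<lambda>l. cline N p v l i)" for i
    by (cases "i < N") (auto simp: cline_def intro!: continuous_intros)
qed

text \<open>
  Restriction to complex lines reduces everything below to functions of one complex variable.
\<close>

lemma holomorphic_on_cline:
  assumes \<Omega>: "\<Omega> \<subseteq> cspace N" and f: "cholomorphic_on N f \<Omega>"
  shows "(\<lambda>l. f (cline N p v l)) holomorphic_on {l. cline N p v l \<in> \<Omega>}"
proof (cases "\<forall>i<N. v i = 0")
  case True
  then have "cline N p v l = cline N p v 0" for l by (auto simp: cline_def restrict_def)
  then have "(\<lambda>l. f (cline N p v l)) = (\<lambda>l. f (cline N p v 0))" by metis
  then show ?thesis by simp
next
  case False
  then obtain i where i: "i < N" "v i \<noteq> 0" by blast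
  define V where "V = L2_set (\<lambda>i. cmod (v i)) {..<N}"
  have V: "V > 0"
    using i member_le_L2_set[of "{..<N}" i "\<lambda>i. cmod (v i)"] unfolding V_def by (smt (verit) finite_lessThan lessThan_iff zero_less_norm_iff norm_ge_zero)
  have inj: "cline N p v l \<noteq> cline N p v l0" if "l \<noteq> l0" for l l0
  proof
    assume "cline N p v l = cline N p v l0"
    then have "cline N p v l i = cline N p v l0 i" by simp
    then show False using i that by (simp add: cline_def)
  qed
  have cd: "cdist N (cline N p v l) (cline N p v l0) = cmod (l - l0) * V" for l l0
  proof -
    have "cdist N (cline N p v l) (cline N p v l0) = L2_set (\<lambda>i. cmod (l - l0) * cmod (v i)) {..<N}"
      unfolding cdist_def by (rule L2_set_cong) (simp_all add: cline_def left_diff_distrib[symmetric] norm_mult[symmetric])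
    then show ?thesis by (simp add: V_def L2_set_right_distrib)
  qed
  show ?thesis
    unfolding holomorphic_on_def
  proof
    fix l0 assume "l0 \<in> {l. cline N p v l \<in> \<Omega>}"
    then have z: "cline N p v l0 \<in> \<Omega>" by simp
    define z where "z = cline N p v l0"
    obtain a where a: "has_cderiv_at N \<Omega> f a z" using f z by (auto simp: z_def cholomorphic_on_iff)
    let ?F = "at l0 within {l. cline N p v l \<in> \<Omega>}"
    define D where "D = (\<Sum>i<N. a i * v i)"
    have fl: "filterlim (cline N p v) (at z within \<Omega>) ?F"
      unfolding filterlim_at
    proof
      show "(cline N p v \<longlongrightarrow> z) ?F"
        using continuous_on_cline[of UNIV N p v] unfolding z_def continuous_on_def
        by (metis UNIV_I tendsto_within_subset top_greatest)
      show "eventually (\<lambda>x. cline N p v x \<in> \<Omega> \<and> cline N p v x \<noteq> z) ?F"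
        unfolding eventually_at_filter z_def by (intro always_eventually) (auto simp: inj)
    qed
    let ?Q = "\<lambda>w. (f w - f z - (\<Sum>i<N. a i * (w i - z i))) / of_real (cdist N w z)"
    have "((\<lambda>l. ?Q (cline N p v l)) \<longlongrightarrow> 0) ?F"
      using a fl unfolding has_cderiv_at_def by (rule filterlim_compose)
    then have "((\<lambda>l. cmod (?Q (cline N p v l)) * V) \<longlongrightarrow> 0) ?F"
      by (intro tendsto_mult_left_zero tendsto_norm_zero)
    moreover have "cmod (?Q (cline N p v l)) * V = cmod ((f (cline N p v l) - f z) / (l - l0) - D)" if "l \<noteq> l0" for l
    proof -
      have "(\<Sum>i<N. a i * (cline N p v l i - z i)) = (l - l0) * D"
        by (simp add: z_def cline_def D_def sum_distrib_left algebra_simps sum_subtractf)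
      then have "cmod (?Q (cline N p v l)) * V = cmod ((f (cline N p v l) - f z - (l - l0) * D)) / cmod (l - l0)"
        using V by (simp add: z_def cd norm_divide norm_mult)
      also have "\<dots> = cmod ((f (cline N p v l) - f z - (l - l0) * D) / (l - l0))" by (simp add: norm_divide)
      also have "(f (cline N p v l) - f z - (l - l0) * D) / (l - l0) = (f (cline N p v l) - f z) / (l - l0) - D"
        using that by (simp add: diff_divide_distrib)
      finally show ?thesis .
    qed
    then have "eventually (\<lambda>l. cmod (?Q (cline N p v l)) * V = cmod ((f (cline N p v l) - f z) / (l - l0) - D)) ?F"
      unfolding eventually_at_filter by (intro always_eventually) auto
    ultimately have "((\<lambda>l. cmod ((f (cline N p v l) - f z) / (l - l0) - D)) \<longlongrightarrow> 0) ?F"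
      by (simp add: tendsto_cong)
    then have "((\<lambda>l. (f (cline N p v l) - f z) / (l - l0) - D) \<longlongrightarrow> 0) ?F"
      by (simp add: tendsto_norm_zero_iff)
    then have "((\<lambda>l. (f (cline N p v l) - f z) / (l - l0)) \<longlongrightarrow> D) ?F"
      by (simp add: LIM_zero_iff)
    then show "(\<lambda>l. f (cline N p v l)) field_differentiable ?F"
      unfolding field_differentiable_def has_field_derivative_iff z_def by blast
  qed
qed

section \<open>Measurability of holomorphic functions\<close>

text \<open>
  The product \<open>\<sigma>\<close>-algebra lives on finitely many coordinates, continuity refers to the Borel sets of
  the space of all sequences. The inclusion between them is measurable because the remaining
  coordinates are constant.
\<close>

lemma id_measurable_lebesgue_C: "(\<lambda>x. x) \<in> measurable (lebesgue_C N) borel"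
proof -
  have "(\<lambda>x. x) \<in> measurable (lebesgue_C N) (Pi\<^sub>M UNIV (\<lambda>_. borel))"
  proof (rule measurable_PiM_single')
    fix i :: nat
    show "(\<lambda>x. x i) \<in> borel_measurable (lebesgue_C N)"
    proof (cases "i < N")
      case True
      then show ?thesis unfolding lebesgue_C_def by simp
    next
      case False
      have "(\<lambda>x. undefined :: complex) \<in> borel_measurable (lebesgue_C N)" by simp
      then show ?thesis
        by (rule measurable_cong[THEN iffD1, rotated])
          (use False in \<open>auto simp: lebesgue_C_def space_PiM PiE_def extensional_def\<close>)
    qed
  qed auto
  then show ?thesis by (simp cong: measurable_cong_sets add: sets_PiM_equal_borel)
qed

lemma space_lebesgue_C: "space (lebesgue_C N) = cspace N"
  by (simp add: lebesgue_C_def cspace_def space_PiM)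

lemma closed_cspace: "closed (cspace N)"
proof -
  have "cspace N = (\<Inter>i\<in>{N..}. {x. x i = undefined})"
    by (auto simp: cspace_def PiE_def extensional_def)
  moreover have "closed {x::nat \<Rightarrow> complex. x i = undefined}" for i
    by (intro closed_Collect_eq continuous_on_product_coordinates continuous_on_const)
  ultimately show ?thesis by auto
qed

lemma open_cspace_borel:
  assumes "openin (top_of_set (cspace N)) \<Omega>"
  shows "\<Omega> \<in> sets borel" "\<Omega> \<in> sets (lebesgue_C N)"
proof -
  obtain U where U: "open U" "\<Omega> = cspace N \<inter> U" using assms by (auto simp: openin_open)
  show b: "\<Omega> \<in> sets borel" using U closed_cspace by auto
  have "(\<lambda>x. x) -` \<Omega> \<inter> space (lebesgue_C N) \<in> sets (lebesgue_C N)"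
    using id_measurable_lebesgue_C b by (rule measurable_sets)
  moreover have "(\<lambda>x. x) -` \<Omega> \<inter> space (lebesgue_C N) = \<Omega>"
    using U by (auto simp: space_lebesgue_C)
  ultimately show "\<Omega> \<in> sets (lebesgue_C N)" by simp
qed

lemma cholomorphic_measurable:
  assumes "openin (top_of_set (cspace N)) \<Omega>" "cholomorphic_on N f \<Omega>"
  shows "(\<lambda>x. indicator \<Omega> x *\<^sub>R f x) \<in> borel_measurable (lebesgue_C N)"
proof -
  have "\<Omega> \<subseteq> cspace N" using assms(1) openin_imp_subset by blast
  then have "continuous_on \<Omega> f" using assms(2) by (rule cholomorphic_imp_continuous_on)
  then have "(\<lambda>x. indicator \<Omega> x *\<^sub>R f x) \<in> borel_measurable borel"
    using open_cspace_borel[OF assms(1)] by (intro borel_measurable_continuous_on_indicator) auto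
  from measurable_compose[OF id_measurable_lebesgue_C this] show ?thesis .
qed

section \<open>The Hartogs domain\<close>

lemma cspace_undefined: "x \<in> cspace N \<Longrightarrow> \<not> i < N \<Longrightarrow> x i = undefined"
  by (auto simp: cspace_def PiE_def extensional_def)

text \<open>
  In the names below, "base" refers to the first \<open>n\<close>
  coordinates \<open>z\<close> and "fibre" to the last \<open>m\<close> coordinates \<open>\<zeta>\<close>.
\<close>

locale fock_bargmann_hartogs =
  fixes n m :: nat and \<mu> :: real
  assumes m_pos: "1 \<le> m" and mu_pos: "0 < \<mu>"
begin

abbreviation "N \<equiv> n + m"
abbreviation "L \<equiv> lebesgue_PiM {..<n + m}"

definition base_sq :: "(nat \<Rightarrow> complex) \<Rightarrow> real" where "base_sq x = (\<Sum>i<n. (cmod (x i))\<^sup>2)"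
definition fibre_sq :: "(nat \<Rightarrow> complex) \<Rightarrow> real" where "fibre_sq x = (\<Sum>i\<in>{n..<n + m}. (cmod (x i))\<^sup>2)"

definition D :: "(nat \<Rightarrow> complex) set" where "D = D_dom \<mu> n m"

lemma in_D: "x \<in> D \<longleftrightarrow> x \<in> cspace N \<and> fibre_sq x < exp (- \<mu> * base_sq x)"
proof -
  have "(\<Sum>j<m. (cmod (x (n + j)))\<^sup>2) = fibre_sq x"
    unfolding fibre_sq_def by (rule sum.reindex_bij_witness[of _ "\<lambda>i. i - n" "\<lambda>j. n + j"]) auto
  then show ?thesis by (simp add: D_def D_dom_def L2_set_def sum_nonneg base_sq_def)
qed

lemma D_subset: "D \<subseteq> cspace N" by (auto simp: in_D)

lemma base_sq_nonneg [simp]: "0 \<le> base_sq x" by (simp add: base_sq_def sum_nonneg)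
lemma fibre_sq_nonneg [simp]: "0 \<le> fibre_sq x" by (simp add: fibre_sq_def sum_nonneg)

lemma continuous_on_base_sq [continuous_intros]: "continuous_on S base_sq"
  unfolding base_sq_def by (intro continuous_intros continuous_on_product_coordinates[THEN continuous_on_subset]) auto

lemma continuous_on_fibre_sq [continuous_intros]: "continuous_on S fibre_sq"
  unfolding fibre_sq_def by (intro continuous_intros continuous_on_product_coordinates[THEN continuous_on_subset]) auto

lemma D_open: "openin (top_of_set (cspace N)) D"
proof -
  have "D = cspace N \<inter> {x. fibre_sq x < exp (- \<mu> * base_sq x)}" by (auto simp: in_D)
  moreover have "open {x. fibre_sq x < exp (- \<mu> * base_sq x)}"
    by (intro open_Collect_less continuous_intros)
  ultimately show ?thesis by (auto simp: openin_open)
qed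

lemma space_L: "space L = cspace N"
  using space_lebesgue_C[of N] by (simp add: lebesgue_C_def)

lemma D_sets [measurable]: "D \<in> sets L"
  using open_cspace_borel(2)[OF D_open] by (simp add: lebesgue_C_def)

definition fibre_scale :: "complex \<Rightarrow> (nat \<Rightarrow> complex) \<Rightarrow> nat \<Rightarrow> complex" where
  "fibre_scale l = affine_map {..<N} (\<lambda>i. if i < n then 1 else l) (\<lambda>_. 0)"

lemma fibre_scale_in_cspace [simp]: "fibre_scale l x \<in> cspace N"
  by (simp add: fibre_scale_def affine_map_def cspace_def)

lemma fibre_scale_nth: "i < N \<Longrightarrow> fibre_scale l x i = (if i < n then x i else l * x i)"
  by (simp add: fibre_scale_def affine_map_def)

lemma base_sq_fibre_scale [simp]: "base_sq (fibre_scale l x) = base_sq x"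
  unfolding base_sq_def by (intro sum.cong) (auto simp: fibre_scale_nth)

lemma fibre_sq_fibre_scale [simp]: "fibre_sq (fibre_scale l x) = (cmod l)\<^sup>2 * fibre_sq x"
  unfolding fibre_sq_def sum_distrib_left by (intro sum.cong) (auto simp: fibre_scale_nth norm_mult power_mult_distrib)

lemma fibre_scale_fibre_scale: "fibre_scale a (fibre_scale b x) = fibre_scale (a * b) x"
  by (auto simp: fibre_scale_def affine_map_def restrict_def)

lemma fibre_scale_1: "x \<in> cspace N \<Longrightarrow> fibre_scale 1 x = x"
  by (auto simp: fibre_scale_def affine_map_def restrict_def cspace_undefined)

lemma fibre_scale_cline: "fibre_scale l x = cline N (\<lambda>i. if i < n then x i else 0) (\<lambda>i. if i < n then 0 else x i) l"
  by (auto simp: fibre_scale_def affine_map_def cline_def restrict_def)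

lemma fibre_scale_of_cline: "fibre_scale a (cline N w v l) = cline N (fibre_scale a w) (fibre_scale a v) l"
  by (auto simp: fibre_scale_def affine_map_def cline_def restrict_def algebra_simps)

lemma base_sq_measurable [measurable]: "base_sq \<in> borel_measurable L"
  unfolding base_sq_def by (intro borel_measurable_sum) auto

lemma fibre_sq_measurable [measurable]: "fibre_sq \<in> borel_measurable L"
  unfolding fibre_sq_def by (intro borel_measurable_sum) auto

lemma measurable_fibre_scale [measurable]:
  assumes [measurable]: "g \<in> borel_measurable M" "h \<in> measurable M L"
  shows "(\<lambda>y. fibre_scale (g y) (h y)) \<in> measurable M L"
proof -
  have "(\<lambda>y. h y i) \<in> borel_measurable M" if "i < N" for i
    using measurable_compose[OF assms(2) measurable_component_singleton[of i "{..<N}" "\<lambda>_. lborel"]] that by simp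
  then show ?thesis unfolding fibre_scale_def affine_map_def
    by (intro measurable_restrict) auto
qed

lemma measurable_cline [measurable]:
  assumes [measurable]: "g \<in> borel_measurable M" "h \<in> measurable M L"
  shows "(\<lambda>y. cline N w (h y) (g y)) \<in> measurable M L"
proof -
  have "(\<lambda>y. h y i) \<in> borel_measurable M" if "i < N" for i
    using measurable_compose[OF assms(2) measurable_component_singleton[of i "{..<N}" "\<lambda>_. lborel"]] that by simp
  then show ?thesis unfolding cline_def
    by (intro measurable_restrict) auto
qed

text \<open>
  The domain is star-shaped with respect to 0: shrinking a point decreases \<open>|\<zeta>|\<^sup>2\<close> and increases
  \<open>exp (- \<mu> |z|\<^sup>2)\<close>.
\<close>

lemma D_connected: "connected D"
proof -
  define o' where "o' = cline N (\<lambda>_. 0) (\<lambda>_. 0) 0"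
  define S where "S = (\<lambda>x. (\<lambda>t::real. cline N (\<lambda>_. 0) x (of_real t)) ` {0..1}) ` D"
  have conn: "connected ((\<lambda>t::real. cline N (\<lambda>_. 0) x (of_real t)) ` {0..1})" for x
    by (intro connected_continuous_image continuous_on_compose2[OF continuous_on_cline[of UNIV]] continuous_intros) auto
  have hsl: "base_sq (cline N (\<lambda>_. 0) x (of_real t)) = t\<^sup>2 * base_sq x" for x t
    unfolding base_sq_def sum_distrib_left by (intro sum.cong) (auto simp: cline_def norm_mult power_mult_distrib)
  have fsl: "fibre_sq (cline N (\<lambda>_. 0) x (of_real t)) = t\<^sup>2 * fibre_sq x" for x t
    unfolding fibre_sq_def sum_distrib_left by (intro sum.cong) (auto simp: cline_def norm_mult power_mult_distrib)
  have inD: "cline N (\<lambda>_. 0) x (of_real t) \<in> D" if "x \<in> D" "0 \<le> t" "t \<le> 1" for x t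
  proof -
    have t2: "t\<^sup>2 \<le> 1" using that by (simp add: power_le_one)
    have "t\<^sup>2 * fibre_sq x \<le> 1 * fibre_sq x" using t2 by (intro mult_right_mono) auto
    also have "\<dots> < exp (- \<mu> * base_sq x)" using that by (simp add: in_D)
    also have "\<dots> \<le> exp (- \<mu> * (t\<^sup>2 * base_sq x))"
      using t2 mu_pos mult_right_mono[OF t2, of "base_sq x"] by simp
    finally show ?thesis by (simp add: in_D hsl fsl)
  qed
  have D: "\<Union> S = D"
  proof
    show "\<Union> S \<subseteq> D" using inD by (auto simp: S_def)
    show "D \<subseteq> \<Union> S"
    proof
      fix x assume x: "x \<in> D"
      then have "cline N (\<lambda>_. 0) x (of_real 1) = x"
        by (auto simp: cline_def restrict_def in_D cspace_undefined)
      then have "x \<in> (\<lambda>t::real. cline N (\<lambda>_. 0) x (of_real t)) ` {0..1}" by (intro image_eqI[of _ _ 1]) auto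
      then show "x \<in> \<Union> S" using x by (auto simp: S_def)
    qed
  qed
  have "cline N (\<lambda>_. 0) x (of_real 0) = o'" for x by (auto simp: o'_def cline_def)
  then have "o' \<in> \<Inter> S" by (force simp: S_def)
  then have "\<Inter> S \<noteq> {}" by blast
  then have "connected (\<Union> S)" by (rule connected_Union[rotated]) (use conn in \<open>auto simp: S_def\<close>)
  then show ?thesis by (simp add: D)
qed

lemma D_cdomain: "cdomain N D"
proof -
  have "fibre_scale 0 (\<lambda>_. 0) \<in> D" by (simp add: in_D)
  then show ?thesis using D_open D_connected by (auto simp: cdomain_def)
qed

section \<open>Homogeneous parts in the fibre variable\<close>

text \<open>
  The k-th Taylor coefficient at 0 of \<open>l \<mapsto> f (z, l * \<zeta>)\<close>. Since \<open>(z, l * \<zeta>)\<close> lies in the domain for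
  all small l, this is meaningful at every point of the space, in the domain or not.
\<close>

definition hom_part :: "((nat \<Rightarrow> complex) \<Rightarrow> complex) \<Rightarrow> nat \<Rightarrow> (nat \<Rightarrow> complex) \<Rightarrow> complex" where
  "hom_part f k x = (deriv ^^ k) (\<lambda>l. f (fibre_scale l x)) 0 / fact k"

lemma slice_holomorphic:
  assumes f: "cholomorphic_on N f D" and R: "R\<^sup>2 * fibre_sq x \<le> exp (- \<mu> * base_sq x)"
  shows "(\<lambda>l. f (fibre_scale l x)) holomorphic_on ball 0 R"
proof -
  have "(\<lambda>l. f (fibre_scale l x)) holomorphic_on {l. fibre_scale l x \<in> D}"
    unfolding fibre_scale_cline by (rule holomorphic_on_cline[OF D_subset f])
  moreover have "ball 0 R \<subseteq> {l. fibre_scale l x \<in> D}"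
  proof
    fix l :: complex assume "l \<in> ball 0 R"
    then have l: "(cmod l)\<^sup>2 < R\<^sup>2" by (simp add: power_strict_mono)
    have "(cmod l)\<^sup>2 * fibre_sq x < exp (- \<mu> * base_sq x)"
    proof (cases "fibre_sq x = 0")
      case False
      then have "fibre_sq x > 0" using fibre_sq_nonneg[of x] by linarith
      then have "(cmod l)\<^sup>2 * fibre_sq x < R\<^sup>2 * fibre_sq x" using l by simp
      then show ?thesis using R by linarith
    qed simp
    then show "l \<in> {l. fibre_scale l x \<in> D}" by (simp add: in_D)
  qed
  ultimately show ?thesis by (rule holomorphic_on_subset)
qed

text \<open>
  The fibre is an open ball, so a circle that fits into it lies inside a slightly larger disc that
  still fits.
\<close>

lemma radius_ex:
  assumes "r\<^sup>2 * fibre_sq x < exp (- \<mu> * base_sq x)" "0 \<le> r"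
  shows "\<exists>R>r. R\<^sup>2 * fibre_sq x \<le> exp (- \<mu> * base_sq x)"
proof (cases "fibre_sq x = 0")
  case True
  then show ?thesis by (intro exI[of _ "r + 1"]) auto
next
  case False
  then have p: "fibre_sq x > 0" using fibre_sq_nonneg[of x] by linarith
  then have "r\<^sup>2 < exp (- \<mu> * base_sq x) / fibre_sq x" using assms by (simp add: pos_less_divide_eq)
  then have "r < sqrt (exp (- \<mu> * base_sq x) / fibre_sq x)" using real_less_rsqrt by blast
  moreover have "(sqrt (exp (- \<mu> * base_sq x) / fibre_sq x))\<^sup>2 * fibre_sq x = exp (- \<mu> * base_sq x)" using p by simp
  ultimately show ?thesis by (metis order_refl)
qed

lemma hom_part_mean:
  assumes f: "cholomorphic_on N f D" and r: "0 < r" "r\<^sup>2 * fibre_sq x < exp (- \<mu> * base_sq x)"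
  shows "(\<integral>t. f (fibre_scale (of_real r * circle_pt t) x) * cnj (circle_pt t) ^ k \<partial>circ) = of_real r ^ k * hom_part f k x"
proof -
  obtain R where R: "r < R" "R\<^sup>2 * fibre_sq x \<le> exp (- \<mu> * base_sq x)" using radius_ex[OF r(2)] r(1) by auto
  show ?thesis unfolding hom_part_def
    by (rule higher_deriv_circle_mean[OF slice_holomorphic[OF f R(2)] r(1) R(1)])
qed

lemma hom_part_fibre_scale:
  assumes f: "cholomorphic_on N f D"
  shows "hom_part f k (fibre_scale a x) = a ^ k * hom_part f k x"
proof -
  obtain R where R: "0 < R" "R\<^sup>2 * fibre_sq x \<le> exp (- \<mu> * base_sq x)" using radius_ex[of 0 x] by auto
  have "(deriv ^^ k) (\<lambda>l. f (fibre_scale (a * l) x)) 0 = a ^ k * (deriv ^^ k) (\<lambda>l. f (fibre_scale l x)) (a * 0)"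
  proof (rule higher_deriv_compose_linear[OF slice_holomorphic[OF f R(2)], of "ball 0 (R / (cmod a + 1))"])
    fix w :: complex assume "w \<in> ball 0 (R / (cmod a + 1))"
    then have "cmod w * (cmod a + 1) < R" by (simp add: pos_less_divide_eq add_nonneg_pos)
    moreover have "cmod a * cmod w \<le> cmod w * (cmod a + 1)" by (simp add: algebra_simps)
    ultimately show "a * w \<in> ball 0 R" by (simp add: norm_mult)
  qed (use R in \<open>auto intro!: divide_pos_pos add_nonneg_pos\<close>)
  then show ?thesis unfolding hom_part_def fibre_scale_fibre_scale by (simp add: mult.commute)
qed

lemma hom_part_sums:
  assumes f: "cholomorphic_on N f D" and x: "x \<in> D"
  shows "(\<lambda>k. hom_part f k x) sums f x"
proof -
  obtain R where R: "1 < R" "R\<^sup>2 * fibre_sq x \<le> exp (- \<mu> * base_sq x)" using radius_ex[of 1 x] x by (auto simp: in_D)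
  have "(\<lambda>k. (deriv ^^ k) (\<lambda>l. f (fibre_scale l x)) 0 / fact k * (1 - 0) ^ k) sums f (fibre_scale 1 x)"
    by (rule holomorphic_power_series[OF slice_holomorphic[OF f R(2)]]) (use R in auto)
  then show ?thesis using x by (simp add: hom_part_def fibre_scale_1 in_D)
qed

lemma cholomorphic_D_measurable:
  assumes f: "cholomorphic_on N f D"
  shows "(\<lambda>x. indicator D x *\<^sub>R f x) \<in> borel_measurable L"
  using cholomorphic_measurable[OF D_open f] by (simp add: lebesgue_C_def)

text \<open>
  The circle mean \<open>hom_part_mean\<close> on a radius that depends measurably on the point expresses the
  homogeneous part as a parameter integral.
\<close>

lemma hom_part_measurable [measurable]:
  assumes f: "cholomorphic_on N f D"
  shows "hom_part f k \<in> borel_measurable L"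
proof -
  define r where "r x = sqrt (exp (- \<mu> * base_sq x) / (1 + fibre_sq x))" for x
  have r: "0 < r x" "(r x)\<^sup>2 * fibre_sq x < exp (- \<mu> * base_sq x)" for x
  proof -
    show "0 < r x" by (simp add: r_def add_pos_nonneg)
    have "(r x)\<^sup>2 * fibre_sq x = exp (- \<mu> * base_sq x) * (fibre_sq x / (1 + fibre_sq x))"
      by (simp add: r_def add_nonneg_nonneg)
    also have "\<dots> < exp (- \<mu> * base_sq x) * 1" by (intro mult_strict_left_mono) (auto simp: divide_less_eq_1 add_pos_nonneg)
    finally show "(r x)\<^sup>2 * fibre_sq x < exp (- \<mu> * base_sq x)" by simp
  qed
  define F where "F x = indicator D x *\<^sub>R f x" for x
  have [measurable]: "F \<in> borel_measurable L" unfolding F_def by (rule cholomorphic_D_measurable[OF f])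
  have [measurable]: "r \<in> borel_measurable L" unfolding r_def by measurable
  have "hom_part f k x = (\<integral>t. F (fibre_scale (of_real (r x) * circle_pt t) x) * cnj (circle_pt t) ^ k \<partial>circ) / of_real (r x) ^ k" for x
  proof -
    have "fibre_scale (of_real (r x) * circle_pt t) x \<in> D" for t using r[of x] by (simp add: in_D norm_mult)
    then have "(\<integral>t. F (fibre_scale (of_real (r x) * circle_pt t) x) * cnj (circle_pt t) ^ k \<partial>circ) = of_real (r x) ^ k * hom_part f k x"
      using hom_part_mean[OF f r] by (simp add: F_def)
    then show ?thesis using r(1)[of x] by simp
  qed
  then have eq: "hom_part f k = (\<lambda>x. (\<integral>t. F (fibre_scale (of_real (r x) * circle_pt t) x) * cnj (circle_pt t) ^ k \<partial>circ) / of_real (r x) ^ k)" by blast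
  have "(\<lambda>x. (\<integral>t. F (fibre_scale (of_real (r x) * circle_pt t) x) * cnj (circle_pt t) ^ k \<partial>circ)) \<in> borel_measurable L"
    by (intro circ.borel_measurable_lebesgue_integral) measurable
  then show ?thesis unfolding eq by measurable
qed

text \<open>
  This replaces the statement that the homogeneous part is an entire function: all that is needed
  of it is the mean value property on circles, and the latter follows from that of \<open>f\<close> by
  interchanging two circle averages. The factor \<open>exp (- (l * s))\<close> is what remains of the Fock kernel
  after a translation.
\<close>

lemma hom_part_mean_value:
  assumes f: "cholomorphic_on N f D" and w: "w \<in> cspace N"
  shows "(\<integral>t. hom_part f k (cline N w v (circle_pt t)) * exp (- (circle_pt t * s)) \<partial>circ) = hom_part f k w"
proof -
  define A where "A = (\<Sum>i<n. (cmod (w i) + 2 * cmod (v i))\<^sup>2)"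
  define B where "B = (\<Sum>i\<in>{n..<n+m}. (cmod (w i) + 2 * cmod (v i))\<^sup>2)"
  have bnd: "(cmod (cline N w v l i))\<^sup>2 \<le> (cmod (w i) + 2 * cmod (v i))\<^sup>2" if "cmod l \<le> 2" "i < N" for l i
  proof (rule power_mono)
    have "cmod (w i + l * v i) \<le> cmod (w i) + cmod l * cmod (v i)" by (rule norm_triangle_le) (simp add: norm_mult)
    also have "\<dots> \<le> cmod (w i) + 2 * cmod (v i)" using that by (intro add_left_mono mult_right_mono) auto
    finally show "cmod (cline N w v l i) \<le> cmod (w i) + 2 * cmod (v i)" using that by (simp add: cline_def)
  qed simp
  have hA: "base_sq (cline N w v l) \<le> A" if "cmod l \<le> 2" for l
    unfolding base_sq_def A_def using bnd[OF that] by (intro sum_mono) auto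
  have fB: "fibre_sq (cline N w v l) \<le> B" if "cmod l \<le> 2" for l
    unfolding fibre_sq_def B_def using bnd[OF that] by (intro sum_mono) auto
  have B0: "B \<ge> 0" by (simp add: B_def sum_nonneg)
  \<comment> \<open>The radius is chosen so small that the fibre dilates of all points on the disc stay in the domain.
    The disc has radius 2, so that the unit circle lies in the interior.\<close>
  define r where "r = sqrt (exp (- \<mu> * A) / (1 + B))"
  have r0: "r > 0" using B0 by (simp add: r_def)
  have r: "r\<^sup>2 * fibre_sq (cline N w v l) < exp (- \<mu> * base_sq (cline N w v l))" if "cmod l \<le> 2" for l
  proof -
    have "r\<^sup>2 * fibre_sq (cline N w v l) \<le> r\<^sup>2 * B" using fB[OF that] by (intro mult_left_mono) auto
    also have "\<dots> = exp (- \<mu> * A) * (B / (1 + B))" using B0 by (simp add: r_def)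
    also have "\<dots> < exp (- \<mu> * A) * 1" using B0 by (intro mult_strict_left_mono) (auto simp: divide_less_eq_1)
    also have "\<dots> \<le> exp (- \<mu> * base_sq (cline N w v l))" using hA[OF that] mu_pos by simp
    finally show ?thesis .
  qed
  let ?p = "\<lambda>\<theta> l. fibre_scale (of_real r * circle_pt \<theta>) (cline N w v l)"
  have pD: "?p \<theta> l \<in> D" if "cmod l \<le> 2" for \<theta> l
    using r[OF that] r0 by (simp add: in_D norm_mult)
  have w0: "cline N w v 0 = w" using w by (auto simp: cline_def restrict_def cspace_undefined)
  define F where "F x = indicator D x *\<^sub>R f x" for x
  have [measurable]: "F \<in> borel_measurable L" unfolding F_def by (rule cholomorphic_D_measurable[OF f])
  have vc: "cline N w v l = cline N w (\<lambda>i\<in>{..<N}. v i) l" for l by (auto simp: cline_def)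
  have "(\<lambda>z. ?p (fst z) (circle_pt (snd z))) \<in> measurable (circ \<Otimes>\<^sub>M circ) L"
  proof -
    have [measurable]: "(\<lambda>i\<in>{..<N}. v i) \<in> space L" by (simp add: space_PiM)
    show ?thesis unfolding vc by measurable
  qed
  from measurable_compose[OF this, of F borel]
  have Fp: "(\<lambda>z. F (?p (fst z) (circle_pt (snd z)))) \<in> borel_measurable (circ \<Otimes>\<^sub>M circ)" by simp
  define h where "h = (\<lambda>z. F (?p (fst z) (circle_pt (snd z))))"
  have [measurable]: "h \<in> borel_measurable (circ \<Otimes>\<^sub>M circ)" unfolding h_def by (rule Fp)
  let ?g = "\<lambda>\<theta> t. f (?p \<theta> (circle_pt t)) * cnj (circle_pt \<theta>) ^ k * exp (- (circle_pt t * s))"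
  have gF: "?g \<theta> t = h (\<theta>, t) * cnj (circle_pt \<theta>) ^ k * exp (- (circle_pt t * s))" for \<theta> t
    using pD[of "circle_pt t" \<theta>] by (simp add: F_def h_def)
  interpret P: pair_sigma_finite circ circ ..
  interpret P: finite_measure "circ \<Otimes>\<^sub>M circ" by (intro finite_measure_pair_measure circ.finite_measure_axioms)
  have cont: "continuous_on ({0..1} \<times> {0..1}) (\<lambda>z. ?g (fst z) (snd z))"
  proof -
    have "continuous_on ({0..1} \<times> {0..1}) (\<lambda>z. ?p (fst z) (circle_pt (snd z)))"
    proof (rule continuous_on_coordinatewise_then_product)
      fix i
      show "continuous_on ({0..1} \<times> {0..1}) (\<lambda>z. ?p (fst z) (circle_pt (snd z)) i)"
        by (cases "i < N"; cases "i < n")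
           (auto simp: fibre_scale_def affine_map_def cline_def circle_pt_def intro!: continuous_intros)
    qed
    then have "continuous_on ({0..1} \<times> {0..1}) (\<lambda>z. f (?p (fst z) (circle_pt (snd z))))"
      by (rule continuous_on_compose2[OF cholomorphic_imp_continuous_on[OF D_subset f]]) (auto intro: pD)
    then show ?thesis unfolding circle_pt_def by (intro continuous_intros)
  qed
  have int: "integrable (circ \<Otimes>\<^sub>M circ) (\<lambda>(\<theta>, t). ?g \<theta> t)"
  proof -
    have "compact ((\<lambda>z. ?g (fst z) (snd z)) ` ({0..1} \<times> {0..1}))"
      by (intro compact_continuous_image cont compact_Times) auto
    then obtain b where b: "\<And>z. z \<in> {0..1} \<times> {0..1} \<Longrightarrow> cmod (?g (fst z) (snd z)) \<le> b"
      by (meson bounded_iff compact_imp_bounded imageI)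
    show ?thesis
    proof (rule P.integrable_const_bound)
      show "AE z in circ \<Otimes>\<^sub>M circ. norm (case z of (\<theta>, t) \<Rightarrow> ?g \<theta> t) \<le> b"
        using b by (intro AE_I2) (auto simp: space_pair_measure)
      show "(\<lambda>(\<theta>, t). ?g \<theta> t) \<in> borel_measurable (circ \<Otimes>\<^sub>M circ)"
        unfolding gF case_prod_beta by measurable
    qed
  qed
  have inner: "(\<integral>t. ?g \<theta> t \<partial>circ) = f (fibre_scale (of_real r * circle_pt \<theta>) w) * cnj (circle_pt \<theta>) ^ k" for \<theta>
  proof -
    let ?a = "of_real r * circle_pt \<theta>"
    have "(\<lambda>l. f (?p \<theta> l)) holomorphic_on {l. ?p \<theta> l \<in> D}"
      unfolding fibre_scale_of_cline by (rule holomorphic_on_cline[OF D_subset f])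
    then have "(\<lambda>l. f (?p \<theta> l)) holomorphic_on ball 0 2"
      by (rule holomorphic_on_subset) (auto intro: pD)
    then have "(\<lambda>l. f (?p \<theta> l) * cnj (circle_pt \<theta>) ^ k * exp (- (l * s))) holomorphic_on ball 0 2"
      by (intro holomorphic_intros)
    from higher_deriv_circle_mean[OF this, of 1 0] show ?thesis by (simp add: w0)
  qed
  have "of_real r ^ k * (\<integral>t. hom_part f k (cline N w v (circle_pt t)) * exp (- (circle_pt t * s)) \<partial>circ)
      = (\<integral>t. (of_real r ^ k * hom_part f k (cline N w v (circle_pt t))) * exp (- (circle_pt t * s)) \<partial>circ)"
    by (simp add: mult.assoc)
  also have "\<dots> = (\<integral>t. (\<integral>\<theta>. ?g \<theta> t \<partial>circ) \<partial>circ)"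
    by (intro Bochner_Integration.integral_cong refl, subst hom_part_mean[OF f r0 r, symmetric]) auto
  also have "\<dots> = (\<integral>\<theta>. (\<integral>t. ?g \<theta> t \<partial>circ) \<partial>circ)" by (rule P.Fubini_integral[OF int])
  also have "\<dots> = of_real r ^ k * hom_part f k w"
    unfolding inner using r[of 0] by (intro hom_part_mean[OF f r0]) (simp add: w0)
  finally show ?thesis using r0 by simp
qed

end

section \<open>From the domain to Gaussian integrals\<close>

text \<open>
  Integrated against \<open>exp (- s)\<close>, the indicators of the balls of squared radius s add up to a
  Gaussian. Both the value of Gaussian integrals and the comparison with integrals over \<open>D\<close> rest on
  this.
\<close>

lemma exp_layer_cake:
  assumes "0 \<le> a"
  shows "ennreal (exp (- a)) = (\<integral>\<^sup>+s. ennreal (exp (- s)) * indicator {a<..} s \<partial>lborel)"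
proof -
  have "(\<integral>\<^sup>+s. ennreal (exp (- s)) * indicator {a..} s \<partial>lborel) = ennreal (0 - (- exp (- a)))"
  proof (rule nn_integral_FTC_atLeast)
    show "((\<lambda>x::real. - exp (- x)) \<longlongrightarrow> 0) at_top"
      using filterlim_compose[OF exp_at_bot filterlim_uminus_at_bot_at_top] tendsto_minus by fastforce
  qed (auto intro!: derivative_eq_intros)
  moreover have "(\<integral>\<^sup>+s. ennreal (exp (- s)) * indicator {a<..} s \<partial>lborel) = (\<integral>\<^sup>+s. ennreal (exp (- s)) * indicator {a..} s \<partial>lborel)"
    using AE_lborel_singleton[of a] by (intro nn_integral_cong_AE) (auto elim!: eventually_mono simp: indicator_def)
  ultimately show ?thesis by simp
qed

lemma gauss_complex:
  assumes c: "0 < c"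
  shows "(\<integral>\<^sup>+z. ennreal (exp (- (c * (cmod z)\<^sup>2))) \<partial>lborel) = ennreal (pi / c)"
proof -
  have "(\<integral>\<^sup>+z. ennreal (exp (- (c * (cmod z)\<^sup>2))) \<partial>lborel)
     = (\<integral>\<^sup>+z. (\<integral>\<^sup>+s. ennreal (exp (- s)) * indicator {c * (cmod z)\<^sup>2<..} s \<partial>lborel) \<partial>lborel)"
    using c by (intro nn_integral_cong exp_layer_cake) simp
  also have "\<dots> = (\<integral>\<^sup>+s. (\<integral>\<^sup>+z. ennreal (exp (- s)) * indicator {c * (cmod z)\<^sup>2<..} s \<partial>lborel) \<partial>lborel)"
  proof (rule lborel_pair.Fubini')
    have "(\<lambda>(s::real, z). ennreal (exp (- s)) * (if c * (cmod z)\<^sup>2 < s then 1 else 0)) \<in> borel_measurable (lborel \<Otimes>\<^sub>M lborel)"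
      by measurable
    then show "(\<lambda>(s::real, z). ennreal (exp (- s)) * indicator {c * (cmod z)\<^sup>2<..} s) \<in> borel_measurable (lborel \<Otimes>\<^sub>M lborel)"
      by (simp add: indicator_def)
  qed
  also have "\<dots> = (\<integral>\<^sup>+s. ennreal (pi / c) * (ennreal (s ^ 1 * exp (- s)) * indicator {0..} s) \<partial>lborel)"
  proof (rule nn_integral_cong)
    fix s :: real
    have "(\<integral>\<^sup>+z. ennreal (exp (- s)) * indicator {c * (cmod z)\<^sup>2<..} s \<partial>lborel)
       = (\<integral>\<^sup>+z. ennreal (exp (- s)) * indicator {z. c * (cmod z)\<^sup>2 < s} (z::complex) \<partial>lborel)"
      by (intro nn_integral_cong) (auto simp: indicator_def)
    also have "\<dots> = ennreal (exp (- s)) * emeasure lborel {z::complex. c * (cmod z)\<^sup>2 < s}"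
      by (subst nn_integral_cmult_indicator) auto
    also have "\<dots> = ennreal (pi / c) * (ennreal (s ^ 1 * exp (- s)) * indicator {0..} s)"
    proof (cases "s \<le> 0")
      case True
      then have "{z::complex. c * (cmod z)\<^sup>2 < s} = {}" using c by (auto simp: not_less) (meson order_trans mult_nonneg_nonneg less_imp_le zero_le_power2)
      then show ?thesis using True by (auto simp: indicator_def)
    next
      case False
      have "c * (cmod z)\<^sup>2 < s \<longleftrightarrow> cmod z < sqrt (s / c)" for z
      proof -
        have "c * (cmod z)\<^sup>2 < s \<longleftrightarrow> (cmod z)\<^sup>2 < s / c" using c by (simp add: pos_less_divide_eq mult.commute)
        also have "\<dots> \<longleftrightarrow> sqrt ((cmod z)\<^sup>2) < sqrt (s / c)" by (simp only: real_sqrt_less_iff)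
        finally show ?thesis by simp
      qed
      then have "{z. c * (cmod z)\<^sup>2 < s} = ball 0 (sqrt (s / c))"
        by (intro set_eqI) (simp only: mem_Collect_eq mem_ball_0)
      then have "emeasure lborel {z. c * (cmod z)\<^sup>2 < s} = ennreal (pi * (s / c))"
        using False c by (simp add: emeasure_ball unit_ball_vol_2)
      then have "ennreal (exp (- s)) * emeasure lborel {z::complex. c * (cmod z)\<^sup>2 < s} = ennreal (exp (- s) * (pi * (s / c)))"
        using False c by (simp only:) (rule ennreal_mult[symmetric], auto)
      also have "exp (- s) * (pi * (s / c)) = pi / c * (s ^ 1 * exp (- s))" by simp
      also have "ennreal \<dots> = ennreal (pi / c) * ennreal (s ^ 1 * exp (- s))"
        using False c by (intro ennreal_mult) auto
      finally show ?thesis using False by simp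
    qed
    finally show "(\<integral>\<^sup>+z. ennreal (exp (- s)) * indicator {c * (cmod z)\<^sup>2<..} s \<partial>lborel)
       = ennreal (pi / c) * (ennreal (s ^ 1 * exp (- s)) * indicator {0..} s)" .
  qed
  also have "\<dots> = ennreal (pi / c)"
  proof -
    have "(\<integral>\<^sup>+s. ennreal (s ^ 1 * exp (- s)) * indicator {0..} s \<partial>lborel) = 1"
      by (subst nn_intergal_power_times_exp_Ici) simp
    then show ?thesis by (subst nn_integral_cmult) simp_all
  qed
  finally show ?thesis .
qed

lemma gauss_PiM:
  assumes J: "finite J" and c: "\<And>i. i \<in> J \<Longrightarrow> 0 < c i"
  shows "(\<integral>\<^sup>+x. ennreal (exp (- (\<Sum>i\<in>J. c i * (cmod (x i))\<^sup>2))) \<partial>lebesgue_PiM J) = ennreal (\<Prod>i\<in>J. pi / c i)"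
proof -
  have "(\<integral>\<^sup>+x. ennreal (exp (- (\<Sum>i\<in>J. c i * (cmod (x i))\<^sup>2))) \<partial>lebesgue_PiM J)
    = (\<integral>\<^sup>+x. (\<Prod>i\<in>J. ennreal (exp (- (c i * (cmod (x i))\<^sup>2)))) \<partial>lebesgue_PiM J)"
    by (intro nn_integral_cong) (simp add: sum_negf[symmetric] exp_sum[OF J] prod_ennreal)
  also have "\<dots> = (\<Prod>i\<in>J. ennreal (pi / c i))"
    using c by (subst cpl.product_nn_integral_prod[OF J]) (auto intro!: prod.cong simp: gauss_complex)
  also have "\<dots> = ennreal (\<Prod>i\<in>J. pi / c i)" using c by (intro prod_ennreal) (simp add: less_imp_le)
  finally show ?thesis .
qed

lemma ennreal_mult3:
  assumes "0 \<le> A" "0 \<le> B" "0 \<le> C"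
  shows "ennreal A * (ennreal B * h * ennreal C * i) = ennreal (A * B * C) * (h * i)"
proof -
  have "ennreal A * (ennreal B * h * ennreal C * i) = (ennreal A * ennreal B * ennreal C) * (h * i)"
    by (simp only: mult_ac)
  also have "ennreal A * ennreal B * ennreal C = ennreal (A * B * C)"
    using assms by (simp only: ennreal_mult mult_nonneg_nonneg)
  finally show ?thesis .
qed

context fock_bargmann_hartogs begin

text \<open>
  The base exponent depends on the degree k; this choice makes the factor cancel that is produced by
  dilating the fibre over \<open>z\<close> to the unit ball.
\<close>

definition gauss_weight :: "nat \<Rightarrow> (nat \<Rightarrow> complex) \<Rightarrow> real" where
  "gauss_weight k x = exp (- (fibre_sq x + \<mu> * real (k + m) * base_sq x))"

lemma gauss_weight_measurable [measurable]: "gauss_weight k \<in> borel_measurable L"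
  unfolding gauss_weight_def by measurable

interpretation Lsf: sigma_finite_measure L
  by (rule cpl.sigma_finite) simp

interpretation P: pair_sigma_finite lborel L ..

text \<open>
  Over a fixed base point \<open>z\<close>, dilating the fibre by \<open>a = sqrt (s * exp (\<mu> |z|\<^sup>2))\<close> maps the fibre of
  \<open>D\<close> onto the ball of squared radius s. The Jacobian \<open>a ^ (2 * m)\<close> and the homogeneity factor
  \<open>a ^ (2 * k)\<close> together give \<open>s ^ (k + m)\<close> times the inverse of the base weight.
\<close>

lemma homogeneous_fibre_scaling:
  assumes H[measurable]: "H \<in> borel_measurable L"
    and hom: "\<And>r x. 0 < r \<Longrightarrow> x \<in> cspace N \<Longrightarrow> H (fibre_scale (of_real r) x) = ennreal (r ^ (2 * k)) * H x"
    and s: "0 < s"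
  shows "(\<integral>\<^sup>+x. H x * ennreal (exp (- (\<mu> * real (k + m) * base_sq x))) * indicator {x. fibre_sq x < s} x \<partial>L)
    = ennreal (s ^ (k + m)) * (\<integral>\<^sup>+x. H x * indicator D x \<partial>L)"
proof -
  let ?I = "{..<n}" and ?J = "{n..<n+m}"
  let ?c = "\<mu> * real (k + m)"
  let ?g = "\<lambda>x. H x * ennreal (exp (- (?c * base_sq x))) * indicator {x. fibre_sq x < s} x"
  have IJ: "?I \<inter> ?J = {}" "finite ?I" "finite ?J" and un: "{..<n + m} = ?I \<union> ?J" by auto
  have [measurable]: "?g \<in> borel_measurable L"
  proof -
    have "(\<lambda>x. H x * ennreal (exp (- (?c * base_sq x))) * (if fibre_sq x < s then 1 else 0)) \<in> borel_measurable L" by measurable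
    then show ?thesis by (simp add: indicator_def)
  qed
  have "(\<integral>\<^sup>+x. ?g x \<partial>L) = (\<integral>\<^sup>+z. (\<integral>\<^sup>+y. ?g (merge ?I ?J (z, y)) \<partial>lebesgue_PiM ?J) \<partial>lebesgue_PiM ?I)"
    unfolding un by (rule cpl.product_nn_integral_fold[OF IJ]) (simp add: un[symmetric])
  also have "\<dots> = (\<integral>\<^sup>+z. (\<integral>\<^sup>+y. ennreal (s ^ (k + m)) * (H (merge ?I ?J (z, y)) * indicator D (merge ?I ?J (z, y))) \<partial>lebesgue_PiM ?J) \<partial>lebesgue_PiM ?I)"
  proof (rule nn_integral_cong)
    fix z assume z: "z \<in> space (lebesgue_PiM ?I)"
    define h where "h = (\<Sum>i<n. (cmod (z i))\<^sup>2)"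
    define a where "a = sqrt (s * exp (\<mu> * h))"
    have a: "a > 0" "a\<^sup>2 = s * exp (\<mu> * h)" using s by (auto simp: a_def)
    let ?X = "\<lambda>y. merge ?I ?J (z, y)"
    have Xm: "?X \<in> measurable (lebesgue_PiM ?J) L"
    proof -
      have "(\<lambda>y. (z, y)) \<in> measurable (lebesgue_PiM ?J) (lebesgue_PiM ?I \<Otimes>\<^sub>M lebesgue_PiM ?J)" using z by simp
      from measurable_compose[OF this measurable_merge] show ?thesis by (simp add: un)
    qed
    have "(\<integral>\<^sup>+y. ?g (?X y) \<partial>lebesgue_PiM ?J) = ennreal (\<Prod>i\<in>?J. (cmod (of_real a))\<^sup>2) * (\<integral>\<^sup>+y. ?g (?X (affine_map ?J (\<lambda>_. of_real a) (\<lambda>_. 0) y)) \<partial>lebesgue_PiM ?J)"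
      using a Xm by (intro nn_integral_affine_map) auto
    also have "\<dots> = (\<integral>\<^sup>+y. ennreal ((a\<^sup>2) ^ m) * ?g (?X (affine_map ?J (\<lambda>_. of_real a) (\<lambda>_. 0) y)) \<partial>lebesgue_PiM ?J)"
    proof (subst nn_integral_cmult[symmetric])
      have "(\<lambda>y. ?g (?X y)) \<in> borel_measurable (lebesgue_PiM ?J)" using Xm by (rule measurable_compose) simp
      from measurable_compose[OF measurable_affine_map this] show "(\<lambda>y. ?g (?X (affine_map ?J (\<lambda>_. of_real a) (\<lambda>_. 0) y))) \<in> borel_measurable (lebesgue_PiM ?J)" .
    qed simp
    also have "\<dots> = (\<integral>\<^sup>+y. ennreal (s ^ (k + m)) * (H (?X y) * indicator D (?X y)) \<partial>lebesgue_PiM ?J)"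
    proof (rule nn_integral_cong)
      fix y assume y: "y \<in> space (lebesgue_PiM ?J)"
      have X: "?X y \<in> cspace N" using z y by (auto simp: cspace_def space_PiM merge_def PiE_def extensional_def)
      have Xa: "?X (affine_map ?J (\<lambda>_. of_real a) (\<lambda>_. 0) y) = fibre_scale (of_real a) (?X y)"
        by (auto simp: merge_def affine_map_def fibre_scale_def restrict_def)
      have hX: "base_sq (?X y) = h" by (simp add: base_sq_def h_def merge_def)
      have "a\<^sup>2 * fibre_sq (?X y) < s \<longleftrightarrow> fibre_sq (?X y) < exp (- \<mu> * h)"
      proof -
        have "a\<^sup>2 * fibre_sq (?X y) < s \<longleftrightarrow> s * (exp (\<mu> * h) * fibre_sq (?X y)) < s * 1" by (simp add: a(2) mult.assoc)
        also have "\<dots> \<longleftrightarrow> exp (\<mu> * h) * fibre_sq (?X y) < 1" using s by (subst mult_less_cancel_left_pos) auto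
        also have "\<dots> \<longleftrightarrow> fibre_sq (?X y) < exp (- \<mu> * h)" by (simp add: exp_minus field_simps)
        finally show ?thesis .
      qed
      then have ind: "indicator {x. fibre_sq x < s} (fibre_scale (of_real a) (?X y)) = (indicator D (?X y) :: ennreal)"
        using a X by (auto simp: indicator_def in_D hX)
      have "ennreal ((a\<^sup>2) ^ m) * ?g (fibre_scale (of_real a) (?X y)) =
        ennreal ((a\<^sup>2) ^ m) * (ennreal (a ^ (2 * k)) * H (?X y) * ennreal (exp (- (?c * h))) * indicator D (?X y))"
        using a X by (simp add: ind hom hX del: indicator_simps)
      also have "\<dots> = ennreal ((a\<^sup>2) ^ m * (a ^ (2 * k)) * exp (- (?c * h))) * (H (?X y) * indicator D (?X y))"
        using a(1) by (intro ennreal_mult3 zero_le_power zero_le_power2 exp_ge_zero) auto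
      also have "(a\<^sup>2) ^ m * (a ^ (2 * k)) * exp (- (?c * h)) = s ^ (k + m)"
      proof -
        have "(a\<^sup>2) ^ m * (a ^ (2 * k)) = (s * exp (\<mu> * h)) ^ (k + m)"
          unfolding a(2)[symmetric] power_mult power_add by (rule mult.commute)
        also have "\<dots> = s ^ (k + m) * exp (?c * h)"
        proof -
          have "real (k + m) * (\<mu> * h) = ?c * h" by simp
          then show ?thesis unfolding power_mult_distrib exp_of_nat_mult[symmetric] by simp
        qed
        finally show ?thesis by (simp add: exp_minus)
      qed
      finally show "ennreal ((a\<^sup>2) ^ m) * ?g (?X (affine_map ?J (\<lambda>_. of_real a) (\<lambda>_. 0) y)) = ennreal (s ^ (k + m)) * (H (?X y) * indicator D (?X y))"
        by (simp only: Xa)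
    qed
    finally show "(\<integral>\<^sup>+y. ?g (?X y) \<partial>lebesgue_PiM ?J) = (\<integral>\<^sup>+y. ennreal (s ^ (k + m)) * (H (?X y) * indicator D (?X y)) \<partial>lebesgue_PiM ?J)" .
  qed
  also have "\<dots> = (\<integral>\<^sup>+x. ennreal (s ^ (k + m)) * (H x * indicator D x) \<partial>L)"
    unfolding un by (rule cpl.product_nn_integral_fold[OF IJ, symmetric]) (simp add: un[symmetric])
  also have "\<dots> = ennreal (s ^ (k + m)) * (\<integral>\<^sup>+x. H x * indicator D x \<partial>L)"
    by (rule nn_integral_cmult) simp
  finally show ?thesis .
qed

text \<open>
  Integrating \<open>homogeneous_fibre_scaling\<close> against \<open>exp (- s)\<close> yields the factorial as a Gamma integral.
\<close>

lemma gaussian_transfer_nn: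
  assumes H[measurable]: "H \<in> borel_measurable L"
    and hom: "\<And>r x. 0 < r \<Longrightarrow> x \<in> cspace N \<Longrightarrow> H (fibre_scale (of_real r) x) = ennreal (r ^ (2 * k)) * H x"
  shows "(\<integral>\<^sup>+x. H x * ennreal (gauss_weight k x) \<partial>L) = ennreal (fact (k + m)) * (\<integral>\<^sup>+x. H x * indicator D x \<partial>L)"
proof -
  let ?c = "\<mu> * real (k + m)"
  let ?g = "\<lambda>s x. H x * ennreal (exp (- (?c * base_sq x))) * (ennreal (exp (- s)) * indicator {fibre_sq x<..} s)"
  have "(\<integral>\<^sup>+x. H x * ennreal (gauss_weight k x) \<partial>L) = (\<integral>\<^sup>+x. (\<integral>\<^sup>+s. ?g s x \<partial>lborel) \<partial>L)"
  proof (rule nn_integral_cong)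
    fix x
    have "- (fibre_sq x + ?c * base_sq x) = - (?c * base_sq x) + - fibre_sq x" by simp
    then have "gauss_weight k x = exp (- (?c * base_sq x)) * exp (- fibre_sq x)" unfolding gauss_weight_def exp_add[symmetric] by simp
    then have "H x * ennreal (gauss_weight k x) = H x * ennreal (exp (- (?c * base_sq x))) * ennreal (exp (- fibre_sq x))"
      by (simp only: ennreal_mult exp_ge_zero mult.assoc)
    also have "\<dots> = H x * ennreal (exp (- (?c * base_sq x))) * (\<integral>\<^sup>+s. ennreal (exp (- s)) * indicator {fibre_sq x<..} s \<partial>lborel)"
      by (subst exp_layer_cake[of "fibre_sq x"]) simp_all
    also have "\<dots> = (\<integral>\<^sup>+s. ?g s x \<partial>lborel)" by (subst nn_integral_cmult) auto
    finally show "H x * ennreal (gauss_weight k x) = (\<integral>\<^sup>+s. ?g s x \<partial>lborel)" .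
  qed
  also have "\<dots> = (\<integral>\<^sup>+s. (\<integral>\<^sup>+x. ?g s x \<partial>L) \<partial>lborel)"
  proof (rule P.Fubini')
    have "(\<lambda>(s, x). H x * ennreal (exp (- (?c * base_sq x))) * (ennreal (exp (- s)) * (if fibre_sq x < s then 1 else 0))) \<in> borel_measurable (lborel \<Otimes>\<^sub>M L)"
      by measurable
    then show "(\<lambda>(s, x). ?g s x) \<in> borel_measurable (lborel \<Otimes>\<^sub>M L)"
      by (simp add: indicator_def)
  qed
  also have "\<dots> = (\<integral>\<^sup>+s. ennreal (s ^ (k + m) * exp (- s)) * indicator {0..} s * (\<integral>\<^sup>+x. H x * indicator D x \<partial>L) \<partial>lborel)"
  proof (rule nn_integral_cong)
    fix s :: real
    show "(\<integral>\<^sup>+x. ?g s x \<partial>L) = ennreal (s ^ (k + m) * exp (- s)) * indicator {0..} s * (\<integral>\<^sup>+x. H x * indicator D x \<partial>L)"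
    proof (cases "0 < s")
      case False
      then have "\<not> fibre_sq x < s" for x using fibre_sq_nonneg[of x] by linarith
      then have z: "?g s x = 0" for x by (simp add: indicator_def)
      have "ennreal (s ^ (k + m) * exp (- s)) * indicator {0..} s = 0"
        using False m_pos by (cases "s = 0") (auto simp: indicator_def)
      then show ?thesis unfolding z by simp
    next
      case True
      have "(\<integral>\<^sup>+x. ?g s x \<partial>L) = (\<integral>\<^sup>+x. ennreal (exp (- s)) * (H x * ennreal (exp (- (?c * base_sq x))) * indicator {x. fibre_sq x < s} x) \<partial>L)"
        by (intro nn_integral_cong) (auto simp: indicator_def mult_ac)
      also have "\<dots> = ennreal (exp (- s)) * (\<integral>\<^sup>+x. H x * ennreal (exp (- (?c * base_sq x))) * indicator {x. fibre_sq x < s} x \<partial>L)"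
      proof (rule nn_integral_cmult)
        have "(\<lambda>x. H x * ennreal (exp (- (?c * base_sq x))) * (if fibre_sq x < s then 1 else 0)) \<in> borel_measurable L" by measurable
        then show "(\<lambda>x. H x * ennreal (exp (- (?c * base_sq x))) * indicator {x. fibre_sq x < s} x) \<in> borel_measurable L" by (simp add: indicator_def)
      qed
      also have "\<dots> = ennreal (exp (- s)) * (ennreal (s ^ (k + m)) * (\<integral>\<^sup>+x. H x * indicator D x \<partial>L))"
        by (subst homogeneous_fibre_scaling[OF H hom True]) auto
      also have "\<dots> = ennreal (s ^ (k + m) * exp (- s)) * indicator {0..} s * (\<integral>\<^sup>+x. H x * indicator D x \<partial>L)"
      proof -
        have "ennreal (s ^ (k + m) * exp (- s)) = ennreal (s ^ (k + m)) * ennreal (exp (- s))"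
          using True by (intro ennreal_mult) auto
        then show ?thesis using True by (simp add: mult_ac)
      qed
      finally show ?thesis .
    qed
  qed
  also have "\<dots> = (\<integral>\<^sup>+s. ennreal (s ^ (k + m) * exp (- s)) * indicator {0..} s \<partial>lborel) * (\<integral>\<^sup>+x. H x * indicator D x \<partial>L)"
    by (rule nn_integral_multc) simp
  also have "(\<integral>\<^sup>+s. ennreal (s ^ (k + m) * exp (- s)) * indicator {0..} s \<partial>lborel) = ennreal (fact (k + m))"
    using nn_intergal_power_times_exp_Ici[of "k + m"] by simp
  finally show ?thesis .
qed

lemma gaussian_transfer_real:
  fixes g :: "(nat \<Rightarrow> complex) \<Rightarrow> real"
  assumes [measurable]: "g \<in> borel_measurable L"
    and hom: "\<And>r x. 0 < r \<Longrightarrow> x \<in> cspace N \<Longrightarrow> g (fibre_scale (of_real r) x) = r ^ (2 * k) * g x"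
    and int: "integrable L (\<lambda>x. g x * indicator D x)"
  shows "integrable L (\<lambda>x. g x * gauss_weight k x)"
    and "(\<integral>x. g x * gauss_weight k x \<partial>L) = fact (k + m) * (\<integral>x. g x * indicator D x \<partial>L)"
proof -
  have tr: "(\<integral>\<^sup>+x. ennreal (h x * gauss_weight k x) \<partial>L) = ennreal (fact (k + m)) * (\<integral>\<^sup>+x. ennreal (h x * indicator D x) \<partial>L)"
    if [measurable]: "h \<in> borel_measurable L" and hh: "\<And>r x. 0 < r \<Longrightarrow> x \<in> cspace N \<Longrightarrow> h (fibre_scale (of_real r) x) = r ^ (2 * k) * h x" for h
  proof -
    have "(\<integral>\<^sup>+x. ennreal (h x * gauss_weight k x) \<partial>L) = (\<integral>\<^sup>+x. ennreal (h x) * ennreal (gauss_weight k x) \<partial>L)"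
      by (intro nn_integral_cong) (simp add: ennreal_mult'' gauss_weight_def)
    also have "\<dots> = ennreal (fact (k + m)) * (\<integral>\<^sup>+x. ennreal (h x) * indicator D x \<partial>L)"
      by (rule gaussian_transfer_nn) (auto simp: hh ennreal_mult')
    also have "(\<integral>\<^sup>+x. ennreal (h x) * indicator D x \<partial>L) = (\<integral>\<^sup>+x. ennreal (h x * indicator D x) \<partial>L)"
      by (intro nn_integral_cong) (auto simp: indicator_def)
    finally show ?thesis .
  qed
  have abs: "(\<integral>\<^sup>+x. ennreal (\<bar>g x\<bar> * gauss_weight k x) \<partial>L) = ennreal (fact (k + m)) * (\<integral>\<^sup>+x. ennreal (\<bar>g x\<bar> * indicator D x) \<partial>L)"
    by (rule tr) (auto simp: hom abs_mult)
  have fin: "(\<integral>\<^sup>+x. ennreal (\<bar>g x\<bar> * indicator D x) \<partial>L) < \<infinity>"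
    using int unfolding integrable_iff_bounded by (simp add: abs_mult)
  show I: "integrable L (\<lambda>x. g x * gauss_weight k x)"
    unfolding integrable_iff_bounded
  proof
    have "(\<integral>\<^sup>+x. ennreal (norm (g x * gauss_weight k x)) \<partial>L) = (\<integral>\<^sup>+x. ennreal (\<bar>g x\<bar> * gauss_weight k x) \<partial>L)"
      by (intro nn_integral_cong) (simp add: abs_mult gauss_weight_def)
    also have "\<dots> < \<infinity>" unfolding abs using fin by (simp add: ennreal_mult_less_top)
    finally show "(\<integral>\<^sup>+x. ennreal (norm (g x * gauss_weight k x)) \<partial>L) < \<infinity>" .
  qed measurable
  have m1: "(\<integral>\<^sup>+x. ennreal (g x * gauss_weight k x) \<partial>L) = ennreal (fact (k + m)) * (\<integral>\<^sup>+x. ennreal (g x * indicator D x) \<partial>L)"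
    by (rule tr) (auto simp: hom)
  have m2: "(\<integral>\<^sup>+x. ennreal (- (g x * gauss_weight k x)) \<partial>L) = ennreal (fact (k + m)) * (\<integral>\<^sup>+x. ennreal (- (g x * indicator D x)) \<partial>L)"
    using tr[of "\<lambda>x. - g x"] by (simp add: hom)
  show "(\<integral>x. g x * gauss_weight k x \<partial>L) = fact (k + m) * (\<integral>x. g x * indicator D x \<partial>L)"
    unfolding real_lebesgue_integral_def[OF I] real_lebesgue_integral_def[OF int] m1 m2
    by (simp add: enn2real_mult right_diff_distrib)
qed

text \<open>
  In the sequel \<open>g\<close> is a product of a function and a conjugate of a function that are both homogeneous
  of degree k in the fibre variable, whence the exponent \<open>2 * k\<close>.
\<close>

lemma gaussian_transfer:
  fixes g :: "(nat \<Rightarrow> complex) \<Rightarrow> complex"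
  assumes [measurable]: "g \<in> borel_measurable L"
    and hom: "\<And>r x. 0 < r \<Longrightarrow> x \<in> cspace N \<Longrightarrow> g (fibre_scale (of_real r) x) = of_real (r ^ (2 * k)) * g x"
    and int: "integrable L (\<lambda>x. g x * of_real (indicator D x))"
  shows "integrable L (\<lambda>x. g x * of_real (gauss_weight k x))"
    and "(\<integral>x. g x * of_real (gauss_weight k x) \<partial>L) = fact (k + m) * (\<integral>x. g x * of_real (indicator D x) \<partial>L)"
proof -
  have Re: "integrable L (\<lambda>x. Re (g x) * indicator D x)" and Im: "integrable L (\<lambda>x. Im (g x) * indicator D x)"
    using integrable_Re[OF int] integrable_Im[OF int] by simp_all
  note R = gaussian_transfer_real[OF _ _ Re, of k] and I = gaussian_transfer_real[OF _ _ Im, of k]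
  have R1: "integrable L (\<lambda>x. Re (g x) * gauss_weight k x)" and R2: "(\<integral>x. Re (g x) * gauss_weight k x \<partial>L) = fact (k + m) * (\<integral>x. Re (g x) * indicator D x \<partial>L)"
    using R by (auto simp: hom)
  have I1: "integrable L (\<lambda>x. Im (g x) * gauss_weight k x)" and I2: "(\<integral>x. Im (g x) * gauss_weight k x \<partial>L) = fact (k + m) * (\<integral>x. Im (g x) * indicator D x \<partial>L)"
    using I by (auto simp: hom)
  show *: "integrable L (\<lambda>x. g x * of_real (gauss_weight k x))"
  proof -
    have "integrable L (\<lambda>x. complex_of_real (Re (g x) * gauss_weight k x) + \<i> * complex_of_real (Im (g x) * gauss_weight k x))"
      by (intro Bochner_Integration.integrable_add integrable_mult_right integrable_of_real R1 I1)
    moreover have "complex_of_real (Re (g x) * gauss_weight k x) + \<i> * complex_of_real (Im (g x) * gauss_weight k x) = g x * of_real (gauss_weight k x)" for x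
      by (rule complex_eqI) auto
    ultimately show ?thesis by simp
  qed
  show "(\<integral>x. g x * of_real (gauss_weight k x) \<partial>L) = fact (k + m) * (\<integral>x. g x * of_real (indicator D x) \<partial>L)"
  proof (rule complex_eqI)
    have f: "fact (k + m) * z = fact (k + m) *\<^sub>R z" for z :: complex by (simp add: scaleR_conv_of_real)
    show "Re (\<integral>x. g x * of_real (gauss_weight k x) \<partial>L) = Re (fact (k + m) * (\<integral>x. g x * of_real (indicator D x) \<partial>L))"
      unfolding f scaleR_complex.sel by (subst (1 2) integral_Re[symmetric]) (use * int R2 in auto)
    show "Im (\<integral>x. g x * of_real (gauss_weight k x) \<partial>L) = Im (fact (k + m) * (\<integral>x. g x * of_real (indicator D x) \<partial>L))"
      unfolding f scaleR_complex.sel by (subst (1 2) integral_Im[symmetric]) (use * int I2 in auto)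
  qed
qed

section \<open>Reproduction in a Gaussian space\<close>

text \<open>
  The reproducing property of the Fock space with weight \<open>exp (- \<Sum> c\<^sub>i |x\<^sub>i|\<^sup>2)\<close>. The hypothesis \<open>mv\<close> is
  the only trace of holomorphy of \<open>F\<close>.
\<close>

lemma fock_reproducing:
  assumes c: "\<And>i. i < N \<Longrightarrow> 0 < c i" and w: "w \<in> cspace N"
    and int: "integrable L (\<lambda>x. F x * cnj (exp (\<Sum>i<N. of_real (c i) * x i * cnj (w i))) * of_real (exp (- (\<Sum>i<N. c i * (cmod (x i))\<^sup>2))))"
    and mv: "\<And>v s. v \<in> cspace N \<Longrightarrow> (\<integral>t. F (cline N w v (circle_pt t)) * exp (- (circle_pt t * s)) \<partial>circ) = F w"
  shows "(\<integral>x. F x * cnj (exp (\<Sum>i<N. of_real (c i) * x i * cnj (w i))) * of_real (exp (- (\<Sum>i<N. c i * (cmod (x i))\<^sup>2))) \<partial>L)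
    = F w * of_real (\<Prod>i<N. pi / c i)"
proof -
  let ?g = "\<lambda>x. F x * cnj (exp (\<Sum>i<N. of_real (c i) * x i * cnj (w i))) * of_real (exp (- (\<Sum>i<N. c i * (cmod (x i))\<^sup>2)))"
  let ?T = "affine_map {..<N} (\<lambda>_. 1) w"
  let ?G = "\<lambda>x::nat \<Rightarrow> complex. exp (- (\<Sum>i<N. c i * (cmod (x i))\<^sup>2))"
  let ?s = "\<lambda>x::nat \<Rightarrow> complex. \<Sum>i<N. of_real (c i) * x i * cnj (w i)"
  \<comment> \<open>Translate the point of evaluation to the origin, then average over rotations of all coordinates.\<close>
  have dT: "distr L L ?T = L" by (rule distr_affine_map_unimodular) auto
  have gT: "?g (?T x) = F (?T x) * exp (- ?s x) * of_real (?G x)" for x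
  proof -
    \<comment> \<open>Completing the square in each coordinate.\<close>
    have "cnj (of_real (c i) * (x i + w i) * cnj (w i)) - of_real (c i * (cmod (x i + w i))\<^sup>2)
        = - (of_real (c i) * x i * cnj (w i)) - of_real (c i * (cmod (x i))\<^sup>2)" for i
      unfolding of_real_mult complex_norm_square by (simp add: algebra_simps)
    then have "(\<Sum>i<N. cnj (of_real (c i) * (x i + w i) * cnj (w i)) - of_real (c i * (cmod (x i + w i))\<^sup>2))
        = (\<Sum>i<N. - (of_real (c i) * x i * cnj (w i)) - of_real (c i * (cmod (x i))\<^sup>2))" by simp
    then have eq: "cnj (\<Sum>i<N. of_real (c i) * ?T x i * cnj (w i)) + of_real (- (\<Sum>i<N. c i * (cmod (?T x i))\<^sup>2))
       = - ?s x + of_real (- (\<Sum>i<N. c i * (cmod (x i))\<^sup>2))"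
      by (simp add: affine_map_def sum_subtractf sum_negf)
    have "cnj (exp (\<Sum>i<N. of_real (c i) * ?T x i * cnj (w i))) * of_real (exp (- (\<Sum>i<N. c i * (cmod (?T x i))\<^sup>2)))
       = exp (- ?s x) * of_real (?G x)"
      unfolding exp_cnj exp_of_real[symmetric] exp_add[symmetric] eq by (rule refl)
    then show ?thesis by (simp add: mult.assoc)
  qed
  have gm: "?g \<in> borel_measurable L" using int by (rule borel_measurable_integrable)
  have int1: "integrable L (\<lambda>x. F (?T x) * exp (- ?s x) * of_real (?G x))"
  proof -
    have "integrable (distr L L ?T) ?g" using int by (simp add: dT)
    then have "integrable L (\<lambda>x. ?g (?T x))" using gm by (subst (asm) integrable_distr_eq) auto
    then show ?thesis unfolding gT .
  qed
  have "(\<integral>x. ?g x \<partial>L) = (\<integral>x. ?g x \<partial>distr L L ?T)" by (simp add: dT)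
  also have "\<dots> = (\<integral>x. ?g (?T x) \<partial>L)" using gm by (subst integral_distr) auto
  also have "\<dots> = (\<integral>x. F (?T x) * exp (- ?s x) * of_real (?G x) \<partial>L)" unfolding gT ..
  also have "\<dots> = (\<integral>x. (\<integral>t. F (?T (affine_map {..<N} (\<lambda>_. circle_pt t) (\<lambda>_. 0) x)) * exp (- ?s (affine_map {..<N} (\<lambda>_. circle_pt t) (\<lambda>_. 0) x)) * of_real (?G (affine_map {..<N} (\<lambda>_. circle_pt t) (\<lambda>_. 0) x)) \<partial>circ) \<partial>L)"
  proof (rule integral_circle_average(3)[OF Lsf.sigma_finite_measure_axioms _ _ int1, symmetric])
    show "(\<lambda>(t, x). affine_map {..<N} (\<lambda>_. circle_pt t) (\<lambda>_. 0) x) \<in> measurable (circ \<Otimes>\<^sub>M L) L"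
      unfolding affine_map_def case_prod_beta by measurable
    show "distr L L (affine_map {..<N} (\<lambda>_. circle_pt t) (\<lambda>_. 0)) = L" for t
      by (rule distr_affine_map_unimodular) auto
  qed
  also have "\<dots> = (\<integral>x. F w * of_real (?G x) \<partial>L)"
  proof (rule Bochner_Integration.integral_cong[OF refl])
    fix x assume "x \<in> space L"
    then have x: "x \<in> cspace N" by (simp add: space_L)
    have 1: "?T (affine_map {..<N} (\<lambda>_. circle_pt t) (\<lambda>_. 0) x) = cline N w x (circle_pt t)" for t
      by (auto simp: affine_map_def cline_def restrict_def)
    have 2: "?s (affine_map {..<N} (\<lambda>_. circle_pt t) (\<lambda>_. 0) x) = circle_pt t * ?s x" for t
      by (simp add: affine_map_def sum_distrib_left mult_ac)
    have 3: "?G (affine_map {..<N} (\<lambda>_. circle_pt t) (\<lambda>_. 0) x) = ?G x" for t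
      by (simp add: affine_map_def norm_mult)
    show "(\<integral>t. F (?T (affine_map {..<N} (\<lambda>_. circle_pt t) (\<lambda>_. 0) x)) * exp (- ?s (affine_map {..<N} (\<lambda>_. circle_pt t) (\<lambda>_. 0) x)) * of_real (?G (affine_map {..<N} (\<lambda>_. circle_pt t) (\<lambda>_. 0) x)) \<partial>circ) = F w * of_real (?G x)"
      unfolding 1 2 3 by (simp add: mv[OF x])
  qed
  also have "\<dots> = F w * of_real (\<integral>x. ?G x \<partial>L)" by simp
  also have "(\<integral>x. ?G x \<partial>L) = (\<Prod>i<N. pi / c i)"
  proof -
    have "?G \<in> borel_measurable L" by measurable
    then have "(\<integral>x. ?G x \<partial>L) = enn2real (\<integral>\<^sup>+x. ennreal (?G x) \<partial>L)" by (intro integral_eq_nn_integral) auto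
    also have "(\<integral>\<^sup>+x. ennreal (?G x) \<partial>L) = ennreal (\<Prod>i<N. pi / c i)"
      by (rule gauss_PiM) (auto simp: c)
    also have "enn2real \<dots> = (\<Prod>i<N. pi / c i)"
      by (intro enn2real_ennreal prod_nonneg) (simp add: c less_imp_le)
    finally show ?thesis .
  qed
  finally show ?thesis .
qed

end

section \<open>Integration against one homogeneous mode\<close>

lemma integrable_L2_product:
  fixes g h :: "'a \<Rightarrow> complex" and \<omega> :: "'a \<Rightarrow> real"
  assumes [measurable]: "g \<in> borel_measurable M" "h \<in> borel_measurable M" "\<omega> \<in> borel_measurable M"
    and \<omega>: "\<And>x. 0 \<le> \<omega> x"
    and g: "integrable M (\<lambda>x. (cmod (g x))\<^sup>2 * \<omega> x)" and h: "integrable M (\<lambda>x. (cmod (h x))\<^sup>2 * \<omega> x)"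
  shows "integrable M (\<lambda>x. g x * cnj (h x) * of_real (\<omega> x))"
proof (rule Bochner_Integration.integrable_bound)
  show "integrable M (\<lambda>x. (cmod (g x))\<^sup>2 * \<omega> x + (cmod (h x))\<^sup>2 * \<omega> x)" using g h by simp
  show "(\<lambda>x. g x * cnj (h x) * of_real (\<omega> x)) \<in> borel_measurable M" by measurable
  have "cmod (g x) * cmod (h x) * \<omega> x \<le> (cmod (g x))\<^sup>2 * \<omega> x + (cmod (h x))\<^sup>2 * \<omega> x" for x
  proof -
    have "cmod (g x) * cmod (h x) \<le> (cmod (g x))\<^sup>2 + (cmod (h x))\<^sup>2"
    proof -
      have "2 * (cmod (g x) * cmod (h x)) \<le> (cmod (g x))\<^sup>2 + (cmod (h x))\<^sup>2"
        using sum_squares_bound[of "cmod (g x)" "cmod (h x)"] by (simp only: mult.assoc)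
      moreover have "0 \<le> cmod (g x) * cmod (h x)" by simp
      ultimately show ?thesis by linarith
    qed
    then show ?thesis using \<omega>[of x] by (metis distrib_right mult_right_mono)
  qed
  then show "AE x in M. norm (g x * cnj (h x) * of_real (\<omega> x)) \<le> norm ((cmod (g x))\<^sup>2 * \<omega> x + (cmod (h x))\<^sup>2 * \<omega> x)"
    using \<omega> by (intro AE_I2) (simp add: norm_mult)
qed

text \<open>
  Jensen's inequality for the square; it makes the passage to homogeneous parts bounded in \<open>L\<^sup>2\<close>.
\<close>

lemma norm_integral_circ_square_le:
  fixes h :: "real \<Rightarrow> complex"
  assumes "continuous_on {0..1} h"
  shows "(cmod (\<integral>t. h t \<partial>circ))\<^sup>2 \<le> (\<integral>t. (cmod (h t))\<^sup>2 \<partial>circ)"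
proof -
  have cont: "integrable circ g" if "continuous_on {0..1} g" for g :: "real \<Rightarrow> real"
    using integral_circ_eq(1)[of "\<lambda>t. complex_of_real (g t)"] that
    by (auto intro!: continuous_intros dest: integrable_Re)
  have i1: "integrable circ (\<lambda>t. cmod (h t))" and i2: "integrable circ (\<lambda>t. (cmod (h t))\<^sup>2)"
    using assms by (auto intro!: cont continuous_intros)
  let ?c = "\<integral>t. cmod (h t) \<partial>circ"
  have "0 \<le> (\<integral>t. (cmod (h t) - ?c)\<^sup>2 \<partial>circ)" by simp
  also have "\<dots> = (\<integral>t. (cmod (h t))\<^sup>2 - 2 * ?c * cmod (h t) + ?c\<^sup>2 \<partial>circ)"
    by (intro Bochner_Integration.integral_cong refl) (simp add: power2_eq_square algebra_simps)
  also have "\<dots> = (\<integral>t. (cmod (h t))\<^sup>2 \<partial>circ) - 2 * ?c * ?c + ?c\<^sup>2"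
    using i1 i2 circ.prob_space by simp
  finally have "?c\<^sup>2 \<le> (\<integral>t. (cmod (h t))\<^sup>2 \<partial>circ)" by (simp add: power2_eq_square)
  moreover have "(cmod (\<integral>t. h t \<partial>circ))\<^sup>2 \<le> ?c\<^sup>2"
    by (intro power_mono integral_norm_bound) auto
  ultimately show ?thesis by linarith
qed

lemma higher_deriv_exp_linear: "(deriv ^^ k) (\<lambda>l. exp (l * s)) 0 = (s :: complex) ^ k"
proof -
  have "(deriv ^^ k) exp = (exp :: complex \<Rightarrow> complex)"
  proof (induction k)
    case (Suc k)
    have "deriv exp = (exp :: complex \<Rightarrow> complex)" by (rule ext) (rule DERIV_imp_deriv, rule DERIV_exp)
    then show ?case using Suc by simp
  qed simp
  moreover have "(deriv ^^ k) (\<lambda>l. exp (s * l)) 0 = s ^ k * (deriv ^^ k) exp (s * 0)"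
    by (rule higher_deriv_compose_linear[of exp UNIV UNIV]) (auto intro: holomorphic_intros)
  ultimately show ?thesis by (simp add: mult.commute)
qed

lemma power_le_fact_exp: "0 \<le> y \<Longrightarrow> y ^ j \<le> fact j * exp (y :: real)"
proof -
  assume y: "0 \<le> y"
  have "(\<lambda>k. y ^ k /\<^sub>R fact k) sums exp y" by (rule exp_converges)
  then have "(\<Sum>k\<in>{j}. y ^ k /\<^sub>R fact k) \<le> exp y"
    using y by (metis (no_types, lifting) finite.emptyI finite.insertI sums_unique sums_summable sum_le_suminf divideR_right fact_nonzero inverse_nonnegative_iff_nonnegative fact_ge_zero scaleR_nonneg_nonneg zero_le_power)
  then show ?thesis by (simp add: field_simps)
qed

context fock_bargmann_hartogs begin

definition base_form :: "(nat \<Rightarrow> complex) \<Rightarrow> (nat \<Rightarrow> complex) \<Rightarrow> complex" where "base_form x w = (\<Sum>i<n. x i * cnj (w i))"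
definition fibre_form :: "(nat \<Rightarrow> complex) \<Rightarrow> (nat \<Rightarrow> complex) \<Rightarrow> complex" where "fibre_form x w = (\<Sum>i\<in>{n..<n + m}. x i * cnj (w i))"

text \<open>
  The homogeneous building block of degree k of the kernel at the point \<open>w\<close>; \<open>mode_coeff k\<close> below is
  its coefficient in the kernel.
\<close>

definition mode :: "nat \<Rightarrow> (nat \<Rightarrow> complex) \<Rightarrow> (nat \<Rightarrow> complex) \<Rightarrow> complex" where
  "mode k w x = fibre_form x w ^ k * exp (of_real (\<mu> * real (k + m)) * base_form x w)"

definition mode_coeff :: "nat \<Rightarrow> real" where
  "mode_coeff k = fact (k + m) / fact k * (\<mu> * real (k + m)) ^ n / pi ^ N"

lemma mode_coeff_pos: "0 < mode_coeff k"
  using mu_pos m_pos by (simp add: mode_coeff_def)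

lemma base_form_measurable [measurable]: "(\<lambda>x. base_form x w) \<in> borel_measurable L"
  unfolding base_form_def by (intro borel_measurable_sum) auto

lemma fibre_form_measurable [measurable]: "(\<lambda>x. fibre_form x w) \<in> borel_measurable L"
  unfolding fibre_form_def by (intro borel_measurable_sum) auto

lemma mode_measurable [measurable]: "mode k w \<in> borel_measurable L"
  unfolding mode_def by measurable

lemma base_form_fibre_scale [simp]: "base_form (fibre_scale l x) w = base_form x w"
  unfolding base_form_def by (intro sum.cong) (auto simp: fibre_scale_nth)

lemma fibre_form_fibre_scale [simp]: "fibre_form (fibre_scale l x) w = l * fibre_form x w"
  unfolding fibre_form_def sum_distrib_left by (intro sum.cong) (auto simp: fibre_scale_nth)

lemma mode_fibre_scale: "mode k w (fibre_scale l x) = l ^ k * mode k w x"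
  by (simp add: mode_def power_mult_distrib)

lemma base_form_self: "base_form w w = of_real (base_sq w)" and fibre_form_self: "fibre_form w w = of_real (fibre_sq w)"
  unfolding base_form_def base_sq_def fibre_form_def fibre_sq_def of_real_sum complex_norm_square by (rule refl)+

lemma cholomorphic_base_form: "cholomorphic_on N (\<lambda>x. base_form x w) D"
proof -
  have "base_form x w = (\<Sum>i<N. (if i < n then cnj (w i) else 0) * x i)" for x
    unfolding base_form_def by (intro sum.mono_neutral_cong_left) auto
  then show ?thesis by (simp add: cholomorphic_on_linear_form)
qed

lemma cholomorphic_fibre_form: "cholomorphic_on N (\<lambda>x. fibre_form x w) D"
proof -
  have "fibre_form x w = (\<Sum>i<N. (if i < n then 0 else cnj (w i)) * x i)" for x
    unfolding fibre_form_def by (intro sum.mono_neutral_cong_left) auto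
  then show ?thesis by (simp add: cholomorphic_on_linear_form)
qed

lemma cholomorphic_compose_entire:
  assumes "cholomorphic_on N f D" "h holomorphic_on UNIV"
  shows "cholomorphic_on N (\<lambda>x. h (f x)) D"
proof (rule cholomorphic_on_compose[OF D_subset assms(1)])
  show "h field_differentiable at (f z)" for z
    using assms(2) by (simp add: holomorphic_on_def)
qed

lemma cholomorphic_mode: "cholomorphic_on N (mode k w) D"
  unfolding mode_def
proof (rule cholomorphic_on_mult[OF D_subset])
  show "cholomorphic_on N (\<lambda>x. fibre_form x w ^ k) D"
    by (rule cholomorphic_compose_entire[OF cholomorphic_fibre_form, of "\<lambda>z. z ^ k"]) (intro holomorphic_intros)
  show "cholomorphic_on N (\<lambda>x. exp (of_real (\<mu> * real (k + m)) * base_form x w)) D"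
    by (rule cholomorphic_compose_entire[OF cholomorphic_base_form, of "\<lambda>z. exp (of_real (\<mu> * real (k + m)) * z)"])
       (intro holomorphic_intros)
qed

text \<open>
  The unequal weights keep the exponentials of these forms square integrable against the Gaussian.
\<close>

lemma form_bound:
  assumes "finite I"
  shows "cmod (\<Sum>i\<in>I. x i * cnj (w i)) \<le> (\<Sum>i\<in>I. (cmod (x i))\<^sup>2) / 4 + (\<Sum>i\<in>I. (cmod (w i))\<^sup>2)"
proof -
  have "cmod (\<Sum>i\<in>I. x i * cnj (w i)) \<le> (\<Sum>i\<in>I. (cmod (x i))\<^sup>2 / 4 + (cmod (w i))\<^sup>2)"
  proof (rule sum_norm_le)
    fix i
    have "0 \<le> (cmod (x i) / 2 - cmod (w i))\<^sup>2" by simp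
    then show "cmod (x i * cnj (w i)) \<le> (cmod (x i))\<^sup>2 / 4 + (cmod (w i))\<^sup>2"
      by (simp add: norm_mult power2_eq_square field_simps)
  qed
  then show ?thesis by (simp add: sum.distrib sum_divide_distrib)
qed

lemma base_form_bound: "cmod (base_form x w) \<le> base_sq x / 4 + base_sq w" and fibre_form_bound: "cmod (fibre_form x w) \<le> fibre_sq x / 4 + fibre_sq w"
  unfolding base_form_def fibre_form_def base_sq_def fibre_sq_def by (rule form_bound; simp)+

lemma sum_split_base_fibre:
  "(\<Sum>i<N. of_real (if i < n then c else 1) * x i * cnj (w i)) = of_real c * base_form x w + fibre_form x w"
  "(\<Sum>i<N. (if i < n then c else 1) * (cmod (x i))\<^sup>2) = fibre_sq x + c * base_sq x"
proof -
  have un: "{..<N} = {..<n} \<union> {n..<N}" by auto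
  have "(\<Sum>i<N. of_real (if i < n then c else 1) * x i * cnj (w i)) =
     (\<Sum>i<n. of_real (if i < n then c else 1) * x i * cnj (w i)) + (\<Sum>i\<in>{n..<N}. of_real (if i < n then c else 1) * x i * cnj (w i))"
    unfolding un by (rule sum.union_disjoint) auto
  also have "(\<Sum>i<n. of_real (if i < n then c else 1) * x i * cnj (w i)) = of_real c * base_form x w"
    unfolding base_form_def sum_distrib_left by (rule sum.cong) auto
  also have "(\<Sum>i\<in>{n..<N}. of_real (if i < n then c else 1) * x i * cnj (w i)) = fibre_form x w"
    unfolding fibre_form_def by (rule sum.cong) auto
  finally show "(\<Sum>i<N. of_real (if i < n then c else 1) * x i * cnj (w i)) = of_real c * base_form x w + fibre_form x w" .
  have "(\<Sum>i<N. (if i < n then c else 1) * (cmod (x i))\<^sup>2) =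
     (\<Sum>i<n. (if i < n then c else 1) * (cmod (x i))\<^sup>2) + (\<Sum>i\<in>{n..<N}. (if i < n then c else 1) * (cmod (x i))\<^sup>2)"
    unfolding un by (rule sum.union_disjoint) auto
  also have "(\<Sum>i<n. (if i < n then c else 1) * (cmod (x i))\<^sup>2) = c * base_sq x"
    unfolding base_sq_def sum_distrib_left by (rule sum.cong) auto
  also have "(\<Sum>i\<in>{n..<N}. (if i < n then c else 1) * (cmod (x i))\<^sup>2) = fibre_sq x"
    unfolding fibre_sq_def by (rule sum.cong) auto
  finally show "(\<Sum>i<N. (if i < n then c else 1) * (cmod (x i))\<^sup>2) = fibre_sq x + c * base_sq x" by simp
qed

text \<open>
  Half of the Gaussian exponent is enough for integrability; the other half may be spent on growth.
\<close>

lemma integrable_gaussian_dominated: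
  assumes [measurable]: "g \<in> borel_measurable L"
    and le: "\<And>x. (cmod (g x))\<^sup>2 \<le> C * exp ((fibre_sq x + \<mu> * real (k + m) * base_sq x) / 2)"
  shows "integrable L (\<lambda>x. (cmod (g x))\<^sup>2 * gauss_weight k x)"
proof (rule Bochner_Integration.integrable_bound)
  let ?c = "\<lambda>i. (if i < n then \<mu> * real (k + m) else 1) / 2"
  let ?G = "\<lambda>x::nat \<Rightarrow> complex. exp (- (\<Sum>i<N. ?c i * (cmod (x i))\<^sup>2))"
  have sum: "(\<Sum>i<N. ?c i * (cmod (x i))\<^sup>2) = (fibre_sq x + \<mu> * real (k + m) * base_sq x) / 2" for x :: "nat \<Rightarrow> complex"
    unfolding sum_split_base_fibre(2)[symmetric] sum_divide_distrib by (intro sum.cong refl) auto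
  have "integrable L ?G"
    unfolding integrable_iff_bounded
  proof
    have "(\<integral>\<^sup>+x. ennreal (?G x) \<partial>L) = ennreal (\<Prod>i<N. pi / ?c i)"
      using mu_pos m_pos by (intro gauss_PiM) auto
    then show "(\<integral>\<^sup>+x. ennreal (norm (?G x)) \<partial>L) < \<infinity>" by simp
  qed measurable
  then show "integrable L (\<lambda>x. C * ?G x)" by simp
  show "AE x in L. norm ((cmod (g x))\<^sup>2 * gauss_weight k x) \<le> norm (C * ?G x)"
  proof (rule AE_I2)
    fix x
    let ?q = "fibre_sq x + \<mu> * real (k + m) * base_sq x"
    have "(cmod (g x))\<^sup>2 * gauss_weight k x \<le> C * exp (?q / 2) * exp (- ?q)"
      unfolding gauss_weight_def by (intro mult_right_mono le) simp
    also have "\<dots> = C * exp (?q / 2 + - ?q)" unfolding exp_add by simp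
    also have "?q / 2 + - ?q = - (?q / 2)" using field_sum_of_halves[of ?q] by linarith
    finally have "(cmod (g x))\<^sup>2 * gauss_weight k x \<le> C * ?G x" unfolding sum .
    then show "norm ((cmod (g x))\<^sup>2 * gauss_weight k x) \<le> norm (C * ?G x)" by (simp add: gauss_weight_def)
  qed
qed measurable

lemma exp_form_square_le:
  "(cmod (exp (of_real c * base_form x w)))\<^sup>2 \<le> exp (2 * c * base_sq w) * exp (c * base_sq x / 2)" if "0 \<le> c"
proof -
  have "Re (of_real c * base_form x w) \<le> c * (base_sq x / 4 + base_sq w)"
    using that order.trans[OF complex_Re_le_cmod base_form_bound[of x w]] by (simp add: mult_left_mono)
  then have "2 * Re (of_real c * base_form x w) \<le> 2 * c * base_sq w + c * base_sq x / 2" by (simp add: algebra_simps)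
  then have "exp (2 * Re (of_real c * base_form x w)) \<le> exp (2 * c * base_sq w + c * base_sq x / 2)" by simp
  then show ?thesis by (simp add: exp_add norm_exp_eq_Re exp_double del: exp_le_cancel_iff)
qed

lemma mode_L2_gaussian: "integrable L (\<lambda>x. (cmod (mode k w x))\<^sup>2 * gauss_weight k x)"
proof (rule integrable_gaussian_dominated[OF mode_measurable])
  fix x
  let ?c = "\<mu> * real (k + m)"
  have "(cmod (fibre_form x w) ^ k)\<^sup>2 \<le> fact (2 * k) * exp (fibre_sq w) * exp (fibre_sq x / 2)"
  proof -
    have "(cmod (fibre_form x w) ^ k)\<^sup>2 = cmod (fibre_form x w) ^ (2 * k)" by (simp add: power_mult[symmetric] mult.commute)
    also have "\<dots> \<le> fact (2 * k) * exp (cmod (fibre_form x w))" by (rule power_le_fact_exp) simp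
    also have "\<dots> \<le> fact (2 * k) * exp (fibre_sq w + fibre_sq x / 2)"
    proof -
      have "cmod (fibre_form x w) \<le> fibre_sq w + fibre_sq x / 2" using fibre_form_bound[of x w] fibre_sq_nonneg[of x] by linarith
      then show ?thesis by (intro mult_left_mono) auto
    qed
    finally show ?thesis by (simp add: exp_add)
  qed
  moreover have "(cmod (exp (of_real ?c * base_form x w)))\<^sup>2 \<le> exp (2 * ?c * base_sq w) * exp (?c * base_sq x / 2)"
    using mu_pos by (intro exp_form_square_le) simp
  ultimately have "(cmod (fibre_form x w) ^ k)\<^sup>2 * (cmod (exp (of_real ?c * base_form x w)))\<^sup>2
     \<le> (fact (2 * k) * exp (fibre_sq w) * exp (fibre_sq x / 2)) * (exp (2 * ?c * base_sq w) * exp (?c * base_sq x / 2))"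
    by (rule mult_mono) auto
  also have "\<dots> = (fact (2 * k) * exp (fibre_sq w) * exp (2 * ?c * base_sq w)) * exp ((fibre_sq x + ?c * base_sq x) / 2)"
    by (simp only: add_divide_distrib exp_add mult_ac)
  finally show "(cmod (mode k w x))\<^sup>2 \<le> (fact (2 * k) * exp (fibre_sq w) * exp (2 * ?c * base_sq w)) * exp ((fibre_sq x + ?c * base_sq x) / 2)"
    by (simp only: mode_def norm_mult norm_power power_mult_distrib)
qed

text \<open>
  The base directions of the domain are unbounded, so square integrability is not immediate; it is
  read off from the Gaussian side of the transfer.
\<close>

lemma mode_L2: "integrable L (\<lambda>x. (cmod (mode k w x))\<^sup>2 * indicator D x)"
  unfolding integrable_iff_bounded
proof
  let ?H = "\<lambda>x. ennreal ((cmod (mode k w x))\<^sup>2)"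
  have "(\<integral>\<^sup>+x. ?H x * ennreal (gauss_weight k x) \<partial>L) = ennreal (fact (k + m)) * (\<integral>\<^sup>+x. ?H x * indicator D x \<partial>L)"
    by (rule gaussian_transfer_nn)
       (auto simp: mode_fibre_scale norm_mult norm_power power_mult_distrib ennreal_mult' power_mult[symmetric] mult.commute[of 2])
  moreover have "(\<integral>\<^sup>+x. ?H x * ennreal (gauss_weight k x) \<partial>L) < \<infinity>"
  proof -
    have "(\<integral>\<^sup>+x. ?H x * ennreal (gauss_weight k x) \<partial>L) = (\<integral>\<^sup>+x. ennreal (norm ((cmod (mode k w x))\<^sup>2 * gauss_weight k x)) \<partial>L)"
      by (intro nn_integral_cong) (simp add: ennreal_mult'' gauss_weight_def)
    then show ?thesis using mode_L2_gaussian[of k w] unfolding integrable_iff_bounded by simp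
  qed
  ultimately have "(\<integral>\<^sup>+x. ?H x * indicator D x \<partial>L) < \<infinity>"
    by (auto simp: ennreal_mult_less_top)
  also have "(\<integral>\<^sup>+x. ?H x * indicator D x \<partial>L) = (\<integral>\<^sup>+x. ennreal (norm ((cmod (mode k w x))\<^sup>2 * indicator D x)) \<partial>L)"
    by (intro nn_integral_cong) (auto simp: indicator_def)
  finally show "(\<integral>\<^sup>+x. ennreal (norm ((cmod (mode k w x))\<^sup>2 * indicator D x)) \<partial>L) < \<infinity>" .
qed measurable

definition bergman_D :: "((nat \<Rightarrow> complex) \<Rightarrow> complex) set" where "bergman_D = bergman_space N D"

lemma bergman_D_iff: "f \<in> bergman_D \<longleftrightarrow> cholomorphic_on N f D \<and> integrable L (\<lambda>x. (cmod (f x))\<^sup>2 * indicator D x)"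
  by (simp add: bergman_D_def bergman_space_def set_integrable_def lebesgue_C_def mult.commute)

lemma mode_bergman_D: "mode k w \<in> bergman_D"
  by (simp add: bergman_D_iff cholomorphic_mode mode_L2)

lemma fibre_rotation:
  shows "(\<lambda>(t, x). fibre_scale (circle_pt t) x) \<in> measurable (circ \<Otimes>\<^sub>M L) L" "distr L L (fibre_scale (circle_pt t)) = L"
proof -
  show "(\<lambda>(t, x). fibre_scale (circle_pt t) x) \<in> measurable (circ \<Otimes>\<^sub>M L) L"
    unfolding case_prod_beta by measurable
  show "distr L L (fibre_scale (circle_pt t)) = L" unfolding fibre_scale_def by (rule distr_affine_map_unimodular) auto
qed

lemma L_sigma_finite: "sigma_finite_measure L"
  by (rule cpl.sigma_finite) simp

lemmas fibre_average = integral_circle_average[OF L_sigma_finite fibre_rotation]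

lemma fibre_scale_circle_pt_D: "fibre_scale (circle_pt t) x \<in> D \<longleftrightarrow> x \<in> D" if "x \<in> cspace N"
  using that by (simp add: in_D)

lemma continuous_on_rotated:
  assumes f: "cholomorphic_on N f D" and x: "x \<in> D"
  shows "continuous_on S (\<lambda>t. f (fibre_scale (circle_pt t) x))"
proof (rule continuous_on_compose2[OF cholomorphic_imp_continuous_on[OF D_subset f]])
  show "continuous_on S (\<lambda>t. fibre_scale (circle_pt t) x)"
    unfolding fibre_scale_cline by (rule continuous_on_compose2[OF continuous_on_cline[of UNIV]]) (auto intro: continuous_intros)
  show "(\<lambda>t. fibre_scale (circle_pt t) x) ` S \<subseteq> D" using x by (auto simp: in_D)
qed

lemma hom_part_mean_1:
  assumes f: "cholomorphic_on N f D" and x: "x \<in> D"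
  shows "(\<integral>t. f (fibre_scale (circle_pt t) x) * cnj (circle_pt t) ^ k \<partial>circ) = hom_part f k x"
  using hom_part_mean[OF f, of 1 x k] x by (simp add: in_D)

lemma hom_part_L2:
  assumes f: "f \<in> bergman_D"
  shows "integrable L (\<lambda>x. (cmod (hom_part f k x))\<^sup>2 * indicator D x)"
proof -
  have hol: "cholomorphic_on N f D" and int: "integrable L (\<lambda>x. (cmod (f x))\<^sup>2 * indicator D x)"
    using f by (auto simp: bergman_D_iff)
  note [measurable] = hom_part_measurable[OF hol]
  let ?g = "\<lambda>x. (cmod (f x))\<^sup>2 * indicator D x"
  show ?thesis
  proof (rule Bochner_Integration.integrable_bound)
    show "integrable L (\<lambda>x. \<integral>t. ?g (fibre_scale (circle_pt t) x) \<partial>circ)" by (rule fibre_average(2)[OF int])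
    show "AE x in L. norm ((cmod (hom_part f k x))\<^sup>2 * indicator D x) \<le> norm (\<integral>t. ?g (fibre_scale (circle_pt t) x) \<partial>circ)"
    proof (rule AE_I2)
      fix x assume "x \<in> space L"
      show "norm ((cmod (hom_part f k x))\<^sup>2 * indicator D x) \<le> norm (\<integral>t. ?g (fibre_scale (circle_pt t) x) \<partial>circ)"
      proof (cases "x \<in> D")
        case True
        have "(cmod (hom_part f k x))\<^sup>2 \<le> (\<integral>t. (cmod (f (fibre_scale (circle_pt t) x) * cnj (circle_pt t) ^ k))\<^sup>2 \<partial>circ)"
          unfolding hom_part_mean_1[OF hol True, symmetric]
          by (intro norm_integral_circ_square_le continuous_intros continuous_on_rotated[OF hol True])
        also have "\<dots> = (\<integral>t. ?g (fibre_scale (circle_pt t) x) \<partial>circ)"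
          using True D_subset by (intro Bochner_Integration.integral_cong refl) (auto simp: norm_mult norm_power fibre_scale_circle_pt_D)
        finally show ?thesis using True by simp
      qed simp
    qed
  qed measurable
qed

text \<open>
  The heart of the computation. Rotating the fibre replaces \<open>f\<close> by its part of degree k; the transfer
  replaces \<open>D\<close> by the Gaussian; in the Fock kernel \<open>exp (c \<langle>z, w\<rangle> + \<langle>\<zeta>, w\<rangle>)\<close> rotating the fibre picks
  out the term of degree k in \<open>\<zeta>\<close>, which is the mode divided by k!. Comparing the constants gives
  \<open>mode_coeff\<close>.
\<close>

lemma coefficient_integral:
  assumes f: "f \<in> bergman_D" and w: "w \<in> cspace N"
  shows "integrable L (\<lambda>x. indicator D x *\<^sub>R (f x * cnj (mode k w x)))"
    and "(\<integral>x. indicator D x *\<^sub>R (f x * cnj (mode k w x)) \<partial>L) = hom_part f k w / of_real (mode_coeff k)"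
proof -
  have hol: "cholomorphic_on N f D" and int: "integrable L (\<lambda>x. (cmod (f x))\<^sup>2 * indicator D x)"
    using f by (auto simp: bergman_D_iff)
  note [measurable] = hom_part_measurable[OF hol] cholomorphic_D_measurable[OF hol]
  let ?c = "\<mu> * real (k + m)"
  have c: "0 < ?c" using mu_pos m_pos by simp
  have I: "integrable L (\<lambda>x. (indicator D x *\<^sub>R f x) * cnj (mode k w x) * of_real (indicator D x))"
  proof (rule integrable_L2_product)
    have "(cmod (indicator D x *\<^sub>R f x))\<^sup>2 * indicator D x = (cmod (f x))\<^sup>2 * indicator D x" for x
      by (simp add: indicator_def)
    then show "integrable L (\<lambda>x. (cmod (indicator D x *\<^sub>R f x))\<^sup>2 * indicator D x)" using int by (simp only:)
  qed (auto intro: mode_L2)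
  have eq: "(indicator D x *\<^sub>R f x) * cnj (mode k w x) * of_real (indicator D x) = indicator D x *\<^sub>R (f x * cnj (mode k w x))" for x
    by (simp add: indicator_def)
  show I1: "integrable L (\<lambda>x. indicator D x *\<^sub>R (f x * cnj (mode k w x)))" using I unfolding eq .
  have J: "integrable L (\<lambda>x. hom_part f k x * cnj (mode k w x) * of_real (indicator D x))"
    by (rule integrable_L2_product) (auto intro: mode_L2 hom_part_L2[OF f])
  have "(\<integral>x. indicator D x *\<^sub>R (f x * cnj (mode k w x)) \<partial>L)
     = (\<integral>x. (\<integral>t. indicator D (fibre_scale (circle_pt t) x) *\<^sub>R (f (fibre_scale (circle_pt t) x) * cnj (mode k w (fibre_scale (circle_pt t) x))) \<partial>circ) \<partial>L)"
    by (rule fibre_average(3)[OF I1, symmetric])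
  also have "\<dots> = (\<integral>x. hom_part f k x * cnj (mode k w x) * of_real (indicator D x) \<partial>L)"
  proof (rule Bochner_Integration.integral_cong[OF refl])
    fix x assume "x \<in> space L"
    then have x: "x \<in> cspace N" by (simp add: space_L)
    show "(\<integral>t. indicator D (fibre_scale (circle_pt t) x) *\<^sub>R (f (fibre_scale (circle_pt t) x) * cnj (mode k w (fibre_scale (circle_pt t) x))) \<partial>circ)
       = hom_part f k x * cnj (mode k w x) * of_real (indicator D x)"
    proof (cases "x \<in> D")
      case True
      have "(\<integral>t. indicator D (fibre_scale (circle_pt t) x) *\<^sub>R (f (fibre_scale (circle_pt t) x) * cnj (mode k w (fibre_scale (circle_pt t) x))) \<partial>circ)
         = (\<integral>t. (f (fibre_scale (circle_pt t) x) * cnj (circle_pt t) ^ k) * cnj (mode k w x) \<partial>circ)"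
        using True x by (intro Bochner_Integration.integral_cong refl) (simp add: fibre_scale_circle_pt_D mode_fibre_scale mult_ac)
      also have "\<dots> = hom_part f k x * cnj (mode k w x)"
        by (simp add: hom_part_mean_1[OF hol True])
      finally show ?thesis using True by simp
    next
      case False
      then show ?thesis using x by (simp add: fibre_scale_circle_pt_D)
    qed
  qed
  \<comment> \<open>Rotating the fibre has replaced \<open>f\<close> by its homogeneous part.\<close>
  finally have step1: "(\<integral>x. indicator D x *\<^sub>R (f x * cnj (mode k w x)) \<partial>L) = (\<integral>x. hom_part f k x * cnj (mode k w x) * of_real (indicator D x) \<partial>L)" .
  have step2: "(\<integral>x. hom_part f k x * cnj (mode k w x) * of_real (gauss_weight k x) \<partial>L) = fact (k + m) * (\<integral>x. hom_part f k x * cnj (mode k w x) * of_real (indicator D x) \<partial>L)"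
  proof (rule gaussian_transfer(2)[OF _ _ J])
    show "hom_part f k (fibre_scale (of_real r) x) * cnj (mode k w (fibre_scale (of_real r) x)) = of_real (r ^ (2 * k)) * (hom_part f k x * cnj (mode k w x))" for r x
      by (simp add: hom_part_fibre_scale[OF hol] mode_fibre_scale mult_ac power_mult power2_eq_square power_mult_distrib)
  qed measurable
  define E where "E x = exp (of_real ?c * base_form x w + fibre_form x w)" for x
  have [measurable]: "E \<in> borel_measurable L" unfolding E_def by measurable
  have K: "integrable L (\<lambda>x. hom_part f k x * cnj (E x) * of_real (gauss_weight k x))"
  proof (rule integrable_L2_product)
    show "integrable L (\<lambda>x. (cmod (hom_part f k x))\<^sup>2 * gauss_weight k x)"
      by (rule gaussian_transfer_real(1)[OF _ _ hom_part_L2[OF f]])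
         (simp_all add: hom_part_fibre_scale[OF hol] norm_mult norm_power power_mult_distrib power_mult[symmetric] mult.commute)
    show "integrable L (\<lambda>x. (cmod (E x))\<^sup>2 * gauss_weight k x)"
    proof (rule integrable_gaussian_dominated)
      fix x
      have "(cmod (exp (fibre_form x w)))\<^sup>2 \<le> exp (2 * fibre_sq w) * exp (fibre_sq x / 2)"
      proof -
        have "2 * Re (fibre_form x w) \<le> 2 * fibre_sq w + fibre_sq x / 2"
          using order.trans[OF complex_Re_le_cmod fibre_form_bound[of x w]] by simp
        then have "exp (2 * Re (fibre_form x w)) \<le> exp (2 * fibre_sq w + fibre_sq x / 2)" by simp
        then show ?thesis by (simp add: exp_add norm_exp_eq_Re exp_double del: exp_le_cancel_iff)
      qed
      then have "(cmod (exp (of_real ?c * base_form x w)))\<^sup>2 * (cmod (exp (fibre_form x w)))\<^sup>2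
         \<le> (exp (2 * ?c * base_sq w) * exp (?c * base_sq x / 2)) * (exp (2 * fibre_sq w) * exp (fibre_sq x / 2))"
        using c by (intro mult_mono exp_form_square_le) auto
      also have "\<dots> = (exp (2 * ?c * base_sq w) * exp (2 * fibre_sq w)) * exp ((fibre_sq x + ?c * base_sq x) / 2)"
        by (simp only: add_divide_distrib exp_add mult_ac)
      finally show "(cmod (E x))\<^sup>2 \<le> (exp (2 * ?c * base_sq w) * exp (2 * fibre_sq w)) * exp ((fibre_sq x + ?c * base_sq x) / 2)"
        by (simp only: E_def exp_add norm_mult power_mult_distrib)
    qed measurable
  qed (auto simp: gauss_weight_def)
  have "(\<integral>x. hom_part f k x * cnj (E x) * of_real (gauss_weight k x) \<partial>L) = hom_part f k w * of_real (\<Prod>i<N. pi / (if i < n then ?c else 1))"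
    unfolding E_def gauss_weight_def sum_split_base_fibre[symmetric]
  proof (rule fock_reproducing[OF _ w])
    show "0 < (if i < n then ?c else 1)" for i using c by simp
    show "integrable L (\<lambda>x. hom_part f k x * cnj (exp (\<Sum>i<N. of_real (if i < n then ?c else 1) * x i * cnj (w i)))
        * of_real (exp (- (\<Sum>i<N. (if i < n then ?c else 1) * (cmod (x i))\<^sup>2))))"
      using K unfolding E_def gauss_weight_def sum_split_base_fibre[symmetric] .
  qed (rule hom_part_mean_value[OF hol w])
  also have "(\<Prod>i<N. pi / (if i < n then ?c else 1)) = pi ^ N / ?c ^ n"
  proof -
    have un: "{..<N} = {..<n} \<union> {n..<N}" by auto
    have "(\<Prod>i<N. pi / (if i < n then ?c else 1)) = (\<Prod>i<n. pi / (if i < n then ?c else 1)) * (\<Prod>i\<in>{n..<N}. pi / (if i < n then ?c else 1))"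
      unfolding un by (rule prod.union_disjoint) auto
    also have "(\<Prod>i<n. pi / (if i < n then ?c else 1)) = (\<Prod>i<n. pi / ?c)" by (rule prod.cong) auto
    also have "(\<Prod>i\<in>{n..<N}. pi / (if i < n then ?c else 1)) = (\<Prod>i\<in>{n..<N}. pi)" by (rule prod.cong) auto
    finally show ?thesis by (simp add: power_divide power_add)
  qed
  \<comment> \<open>The Fock kernel reproduces the homogeneous part, with the total mass of the Gaussian as a factor.\<close>
  finally have step3: "(\<integral>x. hom_part f k x * cnj (E x) * of_real (gauss_weight k x) \<partial>L) = hom_part f k w * of_real (pi ^ N / ?c ^ n)" .
  have "(\<integral>x. hom_part f k x * cnj (E x) * of_real (gauss_weight k x) \<partial>L)
     = (\<integral>x. (\<integral>t. hom_part f k (fibre_scale (circle_pt t) x) * cnj (E (fibre_scale (circle_pt t) x)) * of_real (gauss_weight k (fibre_scale (circle_pt t) x)) \<partial>circ) \<partial>L)"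
    by (rule fibre_average(3)[OF K, symmetric])
  also have "\<dots> = (\<integral>x. hom_part f k x * cnj (mode k w x) * of_real (gauss_weight k x) / fact k \<partial>L)"
  proof (rule Bochner_Integration.integral_cong[OF refl])
    fix x
    let ?s = "fibre_form x w" and ?e = "exp (of_real ?c * base_form x w)"
    \<comment> \<open>The circle average of the Fock kernel is its Taylor term of degree k in the fibre form.\<close>
    have hd: "(\<integral>t. exp (circle_pt t * ?s) * cnj (circle_pt t) ^ k \<partial>circ) = ?s ^ k / fact k"
    proof -
      have "(\<lambda>l. exp (l * ?s)) holomorphic_on ball 0 2" by (intro holomorphic_intros)
      from higher_deriv_circle_mean[OF this, of 1 k] show ?thesis by (simp add: higher_deriv_exp_linear)
    qed
    have "(\<integral>t. hom_part f k (fibre_scale (circle_pt t) x) * cnj (E (fibre_scale (circle_pt t) x)) * of_real (gauss_weight k (fibre_scale (circle_pt t) x)) \<partial>circ)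
       = (\<integral>t. (hom_part f k x * cnj ?e * of_real (gauss_weight k x)) * cnj (exp (circle_pt t * ?s) * cnj (circle_pt t) ^ k) \<partial>circ)"
      by (intro Bochner_Integration.integral_cong refl)
         (simp add: hom_part_fibre_scale[OF hol] E_def gauss_weight_def exp_add mult_ac)
    also have "\<dots> = (hom_part f k x * cnj ?e * of_real (gauss_weight k x)) * cnj (?s ^ k / fact k)"
      unfolding integral_mult_right_zero Bochner_Integration.integral_cnj hd ..
    also have "\<dots> = hom_part f k x * cnj (mode k w x) * of_real (gauss_weight k x) / fact k"
      by (simp add: mode_def mult_ac)
    finally show "(\<integral>t. hom_part f k (fibre_scale (circle_pt t) x) * cnj (E (fibre_scale (circle_pt t) x)) * of_real (gauss_weight k (fibre_scale (circle_pt t) x)) \<partial>circ)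
       = hom_part f k x * cnj (mode k w x) * of_real (gauss_weight k x) / fact k" .
  qed
  also have "\<dots> = (\<integral>x. hom_part f k x * cnj (mode k w x) * of_real (gauss_weight k x) \<partial>L) / fact k" by simp
  finally have "fact (k + m) / fact k * (\<integral>x. indicator D x *\<^sub>R (f x * cnj (mode k w x)) \<partial>L) = hom_part f k w * of_real (pi ^ N / ?c ^ n)"
    using step1 step2 step3 by simp
  moreover define P R where "P = complex_of_real (pi ^ N / ?c ^ n)" and "R = (fact (k + m) / fact k :: complex)"
  ultimately have RA: "R * (\<integral>x. indicator D x *\<^sub>R (f x * cnj (mode k w x)) \<partial>L) = hom_part f k w * P" by simp
  have dkRP: "of_real (mode_coeff k) = R / P"
    by (simp add: mode_coeff_def P_def R_def)
  have "P \<noteq> 0"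
  proof -
    have "?c ^ n \<noteq> 0" using c by (intro power_not_zero) linarith
    then have "pi ^ N / ?c ^ n \<noteq> 0" using power_not_zero[OF pi_neq_zero] by (metis divide_eq_0_iff)
    then show ?thesis unfolding P_def by (simp only: of_real_eq_0_iff not_False_eq_True)
  qed
  moreover have "R \<noteq> 0" by (simp add: R_def)
  ultimately show "(\<integral>x. indicator D x *\<^sub>R (f x * cnj (mode k w x)) \<partial>L) = hom_part f k w / of_real (mode_coeff k)"
    using RA unfolding dkRP by (simp add: eq_divide_eq mult.commute)
qed

end

section \<open>Zeros of the kernel series\<close>

text \<open>
  The coefficients of \<open>x ^ n\<close> in the basis of the rising factorials \<open>pochhammer (x + 1) j\<close>. In this basis
  the kernel series becomes a finite combination of derivatives of the geometric series.
\<close>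

fun rising_coeff :: "nat \<Rightarrow> nat \<Rightarrow> real" where
  "rising_coeff 0 j = (if j = 0 then 1 else 0)"
| "rising_coeff (Suc n) 0 = - rising_coeff n 0"
| "rising_coeff (Suc n) (Suc j) = rising_coeff n j - real (j + 2) * rising_coeff n (Suc j)"

lemma rising_coeff_eq_0: "n < j \<Longrightarrow> rising_coeff n j = 0"
proof (induction n arbitrary: j)
  case (Suc n) then show ?case by (cases j) auto
qed auto

lemma rising_coeff_diag: "rising_coeff n n = 1"
  by (induction n) (auto simp: rising_coeff_eq_0)

lemma power_eq_sum_pochhammer:
  "x ^ n = (\<Sum>j\<le>n. rising_coeff n j * pochhammer (x + 1) j)" for x :: real
proof (induction n)
  case (Suc n)
  have *: "x * pochhammer (x + 1) j = pochhammer (x + 1) (Suc j) - real (Suc j) * pochhammer (x + 1) j" for j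
    by (simp add: pochhammer_Suc algebra_simps)
  have "x ^ Suc n = (\<Sum>j\<le>n. rising_coeff n j * (x * pochhammer (x + 1) j))"
    by (simp add: Suc sum_distrib_left mult_ac)
  also have "\<dots> = (\<Sum>j\<le>n. rising_coeff n j * pochhammer (x + 1) (Suc j)) - (\<Sum>j\<le>n. real (Suc j) * rising_coeff n j * pochhammer (x + 1) j)"
    unfolding * by (simp add: sum_subtractf[symmetric] algebra_simps)
  also have "(\<Sum>j\<le>n. real (Suc j) * rising_coeff n j * pochhammer (x + 1) j) = (\<Sum>j\<le>Suc n. real (Suc j) * rising_coeff n j * pochhammer (x + 1) j)"
    by (simp add: rising_coeff_eq_0)
  also have "\<dots> = rising_coeff n 0 + (\<Sum>j\<le>n. real (j + 2) * rising_coeff n (Suc j) * pochhammer (x + 1) (Suc j))"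
    by (subst sum.atMost_Suc_shift) (simp add: add.commute)
  also have "(\<Sum>j\<le>n. rising_coeff n j * pochhammer (x + 1) (Suc j)) - \<dots> = (\<Sum>j\<le>Suc n. rising_coeff (Suc n) j * pochhammer (x + 1) j)"
    by (subst sum.atMost_Suc_shift) (simp add: sum_subtractf[symmetric] algebra_simps)
  finally show ?case .
qed auto

text \<open>
  The p-th derivative of the geometric series, obtained here from the binomial series.
\<close>

lemma fact_ratio_series:
  fixes t :: complex
  assumes "cmod t < 1"
  shows "(\<lambda>k. fact (k + p) / fact k * t ^ k) sums (fact p * (1 / (1 - t)) ^ Suc p)"
proof -
  have nz: "1 - t \<noteq> 0" using assms by auto
  have "(\<lambda>k. ((- of_nat (Suc p)) gchoose k) * (- t) ^ k) sums (1 + (- t)) powr (- of_nat (Suc p))"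
    by (rule gen_binomial_complex) (use assms in simp)
  also have "(\<lambda>k. ((- of_nat (Suc p)) gchoose k) * (- t) ^ k) = (\<lambda>k. fact (k + p) / (fact p * fact k) * t ^ k)"
  proof
    fix k
    have "((- of_nat (Suc p)) gchoose k) = (- 1) ^ k * (of_nat (p + k) gchoose k :: complex)"
      using gbinomial_minus[of "of_nat (Suc p)" k] by (simp add: algebra_simps)
    then have "((- of_nat (Suc p)) gchoose k) * (- t) ^ k = (of_nat (p + k) gchoose k) * ((- 1) * (- t)) ^ k"
      unfolding power_mult_distrib by (simp only: mult_ac)
    then have "((- of_nat (Suc p)) gchoose k) * (- t) ^ k = (of_nat (p + k) gchoose k) * t ^ k"
      by simp
    also have "(of_nat (p + k) gchoose k :: complex) = of_nat ((p + k) choose k)"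
      by (simp add: binomial_gbinomial)
    also have "\<dots> = fact (k + p) / (fact p * fact k)"
      by (simp add: binomial_fact add_ac)
    finally show "((- of_nat (Suc p)) gchoose k) * (- t) ^ k = fact (k + p) / (fact p * fact k) * t ^ k" .
  qed
  also have "(1 + (- t)) powr (- of_nat (Suc p)) = (1 / (1 - t)) ^ Suc p"
    using nz by (simp add: powr_minus power_one_over inverse_eq_divide powr_nat' del: of_nat_Suc)
  finally have "(\<lambda>k. fact p * (fact (k + p) / (fact p * fact k) * t ^ k)) sums (fact p * (1 / (1 - t)) ^ Suc p)"
    by (rule sums_mult)
  then show ?thesis by simp
qed

definition kernel_series :: "nat \<Rightarrow> nat \<Rightarrow> complex \<Rightarrow> complex" where
  "kernel_series n m t = (\<Sum>k. fact (k + m) / fact k * of_nat (k + m) ^ n * t ^ k)"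

text \<open>
  The kernel series as a polynomial in \<open>u = 1 / (1 - t)\<close>.
\<close>

definition kernel_poly :: "nat \<Rightarrow> nat \<Rightarrow> complex poly" where
  "kernel_poly n m = (\<Sum>j\<le>n. monom (of_real (rising_coeff n j) * fact (m + j)) (Suc (m + j)))"

lemma kernel_series_sums:
  assumes "cmod t < 1"
  shows "(\<lambda>k. fact (k + m) / fact k * of_nat (k + m) ^ n * t ^ k) sums poly (kernel_poly n m) (1 / (1 - t))"
proof -
  have "(\<lambda>k. \<Sum>j\<le>n. of_real (rising_coeff n j) * (fact (k + (m + j)) / fact k * t ^ k)) sums
     (\<Sum>j\<le>n. of_real (rising_coeff n j) * (fact (m + j) * (1 / (1 - t)) ^ Suc (m + j)))"
    by (intro sums_sum sums_mult fact_ratio_series assms)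
  also have "(\<Sum>j\<le>n. of_real (rising_coeff n j) * (fact (m + j) * (1 / (1 - t)) ^ Suc (m + j))) = poly (kernel_poly n m) (1 / (1 - t))"
    by (simp add: kernel_poly_def poly_sum poly_monom mult_ac)
  also have "(\<lambda>k. \<Sum>j\<le>n. of_real (rising_coeff n j) * (fact (k + (m + j)) / fact k * t ^ k)) =
     (\<lambda>k. fact (k + m) / fact k * of_nat (k + m) ^ n * t ^ k)"
  proof
    fix k
    have "(fact (k + (m + j)) :: complex) = fact (k + m) * of_real (pochhammer (real (k + m) + 1) j)" for j
    proof -
      have "(fact (k + m + j) :: real) = pochhammer 1 (k + m + j)" by (simp add: pochhammer_fact)
      also have "\<dots> = fact (k + m) * pochhammer (real (k + m) + 1) j"
        by (subst pochhammer_product'[of 1]) (simp add: pochhammer_fact add_ac)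
      finally have "complex_of_real (fact (k + m + j)) = of_real (fact (k + m) * pochhammer (real (k + m) + 1) j)" by simp
      then show ?thesis by (simp add: add_ac)
    qed
    then have "(\<Sum>j\<le>n. of_real (rising_coeff n j) * (fact (k + (m + j)) / fact k * t ^ k))
       = fact (k + m) / fact k * t ^ k * of_real (\<Sum>j\<le>n. rising_coeff n j * pochhammer (real (k + m) + 1) j)"
      by (simp add: sum_distrib_left sum_distrib_right mult_ac)
    also have "(\<Sum>j\<le>n. rising_coeff n j * pochhammer (real (k + m) + 1) j) = real (k + m) ^ n"
      by (rule power_eq_sum_pochhammer[symmetric])
    finally show "(\<Sum>j\<le>n. of_real (rising_coeff n j) * (fact (k + (m + j)) / fact k * t ^ k)) = fact (k + m) / fact k * of_nat (k + m) ^ n * t ^ k"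
      by (simp add: mult_ac)
  qed
  finally show ?thesis .
qed

lemma kernel_series_eq: "cmod t < 1 \<Longrightarrow> kernel_series n m t = poly (kernel_poly n m) (1 / (1 - t))"
  unfolding kernel_series_def by (rule sums_unique[symmetric, OF kernel_series_sums])

text \<open>
  Raising m by one differentiates the kernel series in t, and \<open>du/dt = u\<^sup>2\<close>.
\<close>

lemma kernel_poly_Suc: "kernel_poly n (Suc m) = monom 1 2 * pderiv (kernel_poly n m)"
  unfolding kernel_poly_def
  by (simp add: higher_pderiv_sum[where n=1, simplified] pderiv_monom sum_distrib_left mult_monom algebra_simps numeral_2_eq_2)

lemma unit_disc_iff_half_plane:
  "cmod t < 1 \<and> u = 1 / (1 - t) \<longleftrightarrow> 1/2 < Re u \<and> t = 1 - 1 / u" for t u :: complex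
proof -
  have *: "cmod (1 - 1 / u) < 1 \<longleftrightarrow> 1/2 < Re u" if "u \<noteq> 0"
  proof -
    have "cmod (1 - 1 / u) = cmod (u - 1) / cmod u" using that by (simp add: norm_divide[symmetric] diff_divide_distrib)
    then have "cmod (1 - 1 / u) < 1 \<longleftrightarrow> cmod (u - 1) < cmod u" using that by (simp add: divide_less_eq_1)
    also have "\<dots> \<longleftrightarrow> (cmod (u - 1))\<^sup>2 < (cmod u)\<^sup>2" by (simp add: power_mono_iff pos2 flip: not_le)
    also have "\<dots> \<longleftrightarrow> 1/2 < Re u" unfolding cmod_power2 by (simp add: power2_eq_square algebra_simps)
    finally show ?thesis .
  qed
  show ?thesis
  proof (cases "u = 0 \<or> t = 1")
    case True then show ?thesis by auto
  next
    case False
    then have "u = 1 / (1 - t) \<longleftrightarrow> t = 1 - 1 / u" by (auto simp: field_simps)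
    then show ?thesis using * False by auto
  qed
qed

lemma kernel_series_zero_free_iff:
  "(\<forall>t. cmod t < 1 \<longrightarrow> kernel_series n m t \<noteq> 0) \<longleftrightarrow> (\<forall>u. 1/2 < Re u \<longrightarrow> poly (kernel_poly n m) u \<noteq> 0)"
  by (metis kernel_series_eq unit_disc_iff_half_plane)

text \<open>
  The Gauss-Lucas theorem for half planes: each root a of p contributes \<open>1 / (u - a)\<close> to the
  logarithmic derivative, and this has positive real part when u lies to the right of all roots.
\<close>

lemma Re_logderiv_half_plane:
  fixes p :: "complex poly"
  assumes "p \<noteq> 0" "\<forall>u. c < Re u \<longrightarrow> poly p u \<noteq> 0" "c < Re u"
  shows "Re (poly (pderiv p) u / poly p u) \<ge> 0 \<and> (degree p > 0 \<longrightarrow> Re (poly (pderiv p) u / poly p u) > 0)"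
  using assms(1,2)
proof (induction "degree p" arbitrary: p)
  case 0
  then show ?case by (metis degree_eq_zeroE pderiv_singleton poly_0 div_0 zero_complex.sel(1) order.refl less_irrefl)
next
  case (Suc d)
  then have "\<not> constant (poly p)" by (simp add: constant_degree)
  then obtain a where a: "poly p a = 0" using fundamental_theorem_of_algebra by blast
  then obtain q where q: "p = [:- a, 1:] * q" using poly_eq_0_iff_dvd by (metis dvdE)
  have q0: "q \<noteq> 0" using Suc.prems q by auto
  have dq: "d = degree q" using Suc(2) q0 unfolding q by (subst (asm) degree_mult_eq) auto
  have nq: "\<forall>u. c < Re u \<longrightarrow> poly q u \<noteq> 0" using Suc.prems(2) q by auto
  have IH: "Re (poly (pderiv q) u / poly q u) \<ge> 0" using Suc(1)[OF dq q0 nq] by simp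
  have ra: "Re a \<le> c" using Suc.prems(2) a by force
  then have pos: "Re (1 / (u - a)) > 0" and ua: "u \<noteq> a" using assms(3)
    by (auto simp: Re_divide intro!: divide_pos_pos add_pos_nonneg)
  have "pderiv [:- a, 1:] = 1" by (simp add: pderiv_pCons)
  then have "pderiv p = q + [:- a, 1:] * pderiv q" unfolding q pderiv_mult by simp
  then have "poly (pderiv p) u = poly (q + [:- a, 1:] * pderiv q) u" by (rule arg_cong)
  also have "\<dots> = poly q u + (u - a) * poly (pderiv q) u" by (simp add: algebra_simps)
  finally have "poly (pderiv p) u = poly q u + (u - a) * poly (pderiv q) u" .
  moreover have "poly p u = (u - a) * poly q u" unfolding q by (simp add: algebra_simps)
  ultimately have "poly (pderiv p) u / poly p u = 1 / (u - a) + poly (pderiv q) u / poly q u"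
    using nq assms(3) ua by (simp add: add_divide_distrib)
  then show ?case using IH pos by simp
qed

lemma kernel_poly_coeff_top: "coeff (kernel_poly n m) (Suc (m + n)) = fact (m + n)"
  unfolding kernel_poly_def by (simp add: coeff_sum sum.delta rising_coeff_diag if_distrib cong: if_cong)

lemma kernel_poly_zero_free_Suc:
  assumes "\<forall>u. 1/2 < Re u \<longrightarrow> poly (kernel_poly n m) u \<noteq> 0"
  shows "\<forall>u. 1/2 < Re u \<longrightarrow> poly (kernel_poly n (Suc m)) u \<noteq> 0"
proof (intro allI impI)
  fix u :: complex assume u: "1/2 < Re u"
  have nz: "coeff (kernel_poly n m) (Suc (m + n)) \<noteq> 0" by (simp add: kernel_poly_coeff_top)
  then have "kernel_poly n m \<noteq> 0" and "degree (kernel_poly n m) > 0"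
    by (auto dest: le_degree)
  then have "Re (poly (pderiv (kernel_poly n m)) u / poly (kernel_poly n m) u) > 0"
    using Re_logderiv_half_plane[OF _ assms u] by blast
  then have "poly (pderiv (kernel_poly n m)) u \<noteq> 0" by auto
  moreover have "u \<noteq> 0" using u by auto
  ultimately show "poly (kernel_poly n (Suc m)) u \<noteq> 0" by (simp add: kernel_poly_Suc poly_monom)
qed

text \<open>
  The coefficients \<open>rising_coeff n j\<close> do not depend on m, while the factorial of the leading term
  exceeds the others by a factor of at least \<open>m + n\<close>; and \<open>|u| > 1/2\<close> bounds the lower powers of u.
\<close>

lemma kernel_poly_zero_free_eventually:
  "\<exists>m\<ge>1. \<forall>u. 1/2 < Re u \<longrightarrow> poly (kernel_poly n m) u \<noteq> 0"
proof -
  \<comment> \<open>On the half plane the lower terms are at most \<open>S / (m + n)\<close> times the leading term.\<close>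
  define S where "S = (\<Sum>j<n. \<bar>rising_coeff n j\<bar> * 2 ^ (n - j))"
  obtain m :: nat where m: "S < real m" using reals_Archimedean2 by blast
  have S0: "S \<ge> 0" by (simp add: S_def sum_nonneg)
  have "poly (kernel_poly n m) u \<noteq> 0" if u: "1/2 < Re u" for u
  proof
    assume 0: "poly (kernel_poly n m) u = 0"
    have un: "1/2 \<le> cmod u" using u complex_Re_le_cmod[of u] by linarith
    have u0: "u \<noteq> 0" using u by auto
    have "poly (kernel_poly n m) u = (\<Sum>j<n. of_real (rising_coeff n j) * fact (m + j) * u ^ Suc (m + j)) + fact (m + n) * u ^ Suc (m + n)"
      by (simp add: kernel_poly_def poly_sum poly_monom lessThan_Suc_atMost[symmetric] rising_coeff_diag del: power_Suc)
    then have "fact (m + n) * u ^ Suc (m + n) = - (\<Sum>j<n. of_real (rising_coeff n j) * fact (m + j) * u ^ Suc (m + j))"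
      using 0 by (simp add: eq_neg_iff_add_eq_0 add.commute)
    then have "fact (m + n) * cmod u ^ Suc (m + n) = cmod (\<Sum>j<n. of_real (rising_coeff n j) * fact (m + j) * u ^ Suc (m + j))"
      by (metis norm_fact norm_minus_cancel norm_mult norm_power)
    also have "\<dots> \<le> (\<Sum>j<n. \<bar>rising_coeff n j\<bar> * fact (m + j) * cmod u ^ Suc (m + j))"
      by (rule order.trans[OF norm_sum]) (simp add: norm_mult norm_power)
    also have "\<dots> \<le> (\<Sum>j<n. \<bar>rising_coeff n j\<bar> * 2 ^ (n - j) * (fact (m + n) / real (m + n) * cmod u ^ Suc (m + n)))"
    proof (rule sum_mono)
      fix j assume "j \<in> {..<n}"
      then have j: "j < n" by simp
      have "fact (m + j) \<le> (fact (m + n - 1) :: real)" using j by (intro fact_mono) auto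
      moreover have "(fact (m + n) :: real) = real (m + n) * fact (m + n - 1)" using j by (subst fact_reduce) auto
      ultimately have f: "fact (m + j) \<le> (fact (m + n) / real (m + n) :: real)" using j by simp
      \<comment> \<open>The factor \<open>(2 |u|) ^ (n - j)\<close>, which is at least 1, raises the power of u to that of the leading term.\<close>
      have "1 \<le> (2 * cmod u) ^ (n - j)" using un by (intro one_le_power) simp
      then have "cmod u ^ Suc (m + j) \<le> (2 * cmod u) ^ (n - j) * cmod u ^ Suc (m + j)"
        using mult_right_mono[of 1 "(2 * cmod u) ^ (n - j)" "cmod u ^ Suc (m + j)"] by simp
      also have "\<dots> = 2 ^ (n - j) * cmod u ^ Suc (m + n)"
        using j by (simp add: power_mult_distrib power_add[symmetric] add.commute del: power_Suc)
      finally have "fact (m + j) * cmod u ^ Suc (m + j) \<le> fact (m + n) / real (m + n) * (2 ^ (n - j) * cmod u ^ Suc (m + n))"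
        by (intro mult_mono f) auto
      then have "\<bar>rising_coeff n j\<bar> * (fact (m + j) * cmod u ^ Suc (m + j)) \<le> \<bar>rising_coeff n j\<bar> * (fact (m + n) / real (m + n) * (2 ^ (n - j) * cmod u ^ Suc (m + n)))"
        by (intro mult_left_mono) auto
      then show "\<bar>rising_coeff n j\<bar> * fact (m + j) * cmod u ^ Suc (m + j) \<le> \<bar>rising_coeff n j\<bar> * 2 ^ (n - j) * (fact (m + n) / real (m + n) * cmod u ^ Suc (m + n))"
        by (simp add: mult_ac)
    qed
    also have "\<dots> = S * (fact (m + n) / real (m + n) * cmod u ^ Suc (m + n))"
      unfolding S_def sum_distrib_right ..
    also have "\<dots> < real (m + n) * (fact (m + n) / real (m + n) * cmod u ^ Suc (m + n))"
      using m S0 u0 by (intro mult_strict_right_mono) (auto intro!: mult_pos_pos divide_pos_pos)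
    also have "\<dots> = fact (m + n) * cmod u ^ Suc (m + n)" using m S0 by simp
    finally show False by simp
  qed
  moreover have "m \<ge> 1" using m S0 by (cases m) auto
  ultimately show ?thesis by blast
qed

theorem kernel_series_threshold:
  "\<exists>m0\<ge>1. \<forall>m\<ge>1. (\<forall>t. cmod t < 1 \<longrightarrow> kernel_series n m t \<noteq> 0) \<longleftrightarrow> m0 \<le> m"
proof -
  define P where "P m \<longleftrightarrow> (\<forall>u. 1/2 < Re u \<longrightarrow> poly (kernel_poly n m) u \<noteq> 0)" for m
  have ex: "\<exists>m. 1 \<le> m \<and> P m" unfolding P_def using kernel_poly_zero_free_eventually by blast
  define m0 where "m0 = (LEAST m. 1 \<le> m \<and> P m)"
  have m0: "1 \<le> m0" "P m0" using LeastI_ex[OF ex] by (auto simp: m0_def)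
  have "P m" if "m0 \<le> m" for m using that
    by (induction rule: dec_induct) (use m0 kernel_poly_zero_free_Suc in \<open>auto simp: P_def\<close>)
  moreover have "m0 \<le> m" if "1 \<le> m" "P m" for m unfolding m0_def using that by (intro Least_le) auto
  ultimately show ?thesis using m0(1) unfolding kernel_series_zero_free_iff P_def[symmetric] by blast
qed

section \<open>The Bergman kernel of the Hartogs domain\<close>

lemma cholomorphic_on_cong:
  assumes "\<And>x. x \<in> \<Omega> \<Longrightarrow> f x = g x" "cholomorphic_on N f \<Omega>"
  shows "cholomorphic_on N g \<Omega>"
  unfolding cholomorphic_on_def
proof
  fix z assume z: "z \<in> \<Omega>"
  then obtain a where a: "((\<lambda>w. (f w - f z - (\<Sum>i<N. a i * (w i - z i))) / of_real (cdist N w z)) \<longlongrightarrow> 0) (at z within \<Omega>)"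
    using assms(2) by (auto simp: cholomorphic_on_def)
  have "((\<lambda>w. (g w - g z - (\<Sum>i<N. a i * (w i - z i))) / of_real (cdist N w z)) \<longlongrightarrow> 0) (at z within \<Omega>)"
    by (rule Lim_transform_eventually[OF a]) (use z assms(1) in \<open>auto simp: eventually_at_filter\<close>)
  then show "\<exists>a. ((\<lambda>w. (g w - g z - (\<Sum>i<N. a i * (w i - z i))) / of_real (cdist N w z)) \<longlongrightarrow> 0) (at z within \<Omega>)"
    by blast
qed

lemma weighted_sum_square_le:
  fixes b :: "nat \<Rightarrow> real"
  assumes q: "0 < q" "q < 1"
  shows "(\<Sum>k<j. b k)\<^sup>2 \<le> 1 / (1 - q) * (\<Sum>k<j. (b k)\<^sup>2 / q ^ k)"
proof -
  have "(\<Sum>k<j. b k)\<^sup>2 = (\<Sum>k<j. sqrt (q ^ k) * (b k / sqrt (q ^ k)))\<^sup>2" using q by simp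
  also have "\<dots> \<le> (\<Sum>k<j. (sqrt (q ^ k))\<^sup>2) * (\<Sum>k<j. (b k / sqrt (q ^ k))\<^sup>2)"
    by (rule Cauchy_Schwarz_ineq_sum)
  also have "\<dots> = (\<Sum>k<j. q ^ k) * (\<Sum>k<j. (b k)\<^sup>2 / q ^ k)"
    using q by (simp add: power_divide)
  also have "\<dots> \<le> 1 / (1 - q) * (\<Sum>k<j. (b k)\<^sup>2 / q ^ k)"
  proof (rule mult_right_mono)
    have "(\<Sum>k<j. q ^ k) \<le> (\<Sum>k. q ^ k)" using q by (intro sum_le_suminf summable_geometric) auto
    then show "(\<Sum>k<j. q ^ k) \<le> 1 / (1 - q)" using q by (simp add: suminf_geometric)
    show "0 \<le> (\<Sum>k<j. (b k)\<^sup>2 / q ^ k)" using q by (intro sum_nonneg) auto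
  qed
  finally show ?thesis .
qed

lemma kernel_series_field_differentiable:
  assumes "cmod t < 1"
  shows "kernel_series n m field_differentiable at t"
proof -
  have "(\<lambda>t. poly (kernel_poly n m) (1 / (1 - t))) holomorphic_on ball 0 1"
    by (intro holomorphic_intros) auto
  then have "kernel_series n m holomorphic_on ball 0 1"
    by (rule holomorphic_transform) (simp add: kernel_series_eq)
  then show ?thesis using assms by (intro holomorphic_on_imp_differentiable_at[of _ "ball 0 1"]) auto
qed

text \<open>
  Reproducing one kernel by the other shows that each is the conjugate transpose of the other, and in
  particular that each is Hermitian.
\<close>

lemma bergman_kernel_unique:
  assumes K: "is_bergman_kernel N \<Omega> K" and K': "is_bergman_kernel N \<Omega> K'"
  shows "K = K'"
proof -
  have herm: "cnj (A z w) = B w z"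
    if A: "is_bergman_kernel N \<Omega> A" and B: "is_bergman_kernel N \<Omega> B" and zw: "z \<in> \<Omega>" "w \<in> \<Omega>" for A B z w
  proof -
    have "A z w = set_lebesgue_integral (lebesgue_C N) \<Omega> (\<lambda>x. A x w * cnj (B x z))"
      using A B zw by (auto simp: is_bergman_kernel_def)
    then have "cnj (A z w) = set_lebesgue_integral (lebesgue_C N) \<Omega> (\<lambda>x. B x z * cnj (A x w))"
      unfolding set_lebesgue_integral_def by (simp flip: Bochner_Integration.integral_cnj add: mult.commute)
    also have "\<dots> = B w z" using A B zw by (auto simp: is_bergman_kernel_def)
    finally show ?thesis .
  qed
  show ?thesis
  proof (intro ext)
    fix z w
    show "K z w = K' z w"
    proof (cases "z \<in> \<Omega> \<and> w \<in> \<Omega>")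
      case True
      then have "cnj (K w z) = K z w" "cnj (K w z) = K' z w" using herm K K' by blast+
      then show ?thesis by simp
    next
      case False
      then show ?thesis using K K' by (metis is_bergman_kernel_def)
    qed
  qed
qed

context fock_bargmann_hartogs begin

lemma hom_part_mode:
  assumes "x \<in> cspace N"
  shows "hom_part (mode k w) k x = mode k w x"
proof -
  obtain R where R: "0 < R" "R\<^sup>2 * fibre_sq x \<le> exp (- \<mu> * base_sq x)" using radius_ex[of 0 x] by auto
  have "(R / 2)\<^sup>2 * fibre_sq x = R\<^sup>2 * fibre_sq x / 4" by (simp add: power_divide)
  also have "\<dots> < exp (- \<mu> * base_sq x)" using R(2) exp_gt_zero[of "- \<mu> * base_sq x"] by linarith
  finally have r: "0 < R / 2" "(R / 2)\<^sup>2 * fibre_sq x < exp (- \<mu> * base_sq x)" using R by auto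
  have "of_real (R / 2) ^ k * hom_part (mode k w) k x = (\<integral>t. mode k w (fibre_scale (of_real (R / 2) * circle_pt t) x) * cnj (circle_pt t) ^ k \<partial>circ)"
    by (rule hom_part_mean[OF cholomorphic_mode r, symmetric])
  also have "\<dots> = (\<integral>t. of_real (R / 2) ^ k * mode k w x \<partial>circ)"
  proof (intro Bochner_Integration.integral_cong refl)
    fix t
    have "(circle_pt t * cnj (circle_pt t)) ^ k = 1" using complex_norm_square[of "circle_pt t"] by simp
    then have "circle_pt t ^ k * cnj (circle_pt t) ^ k = 1" by (simp only: power_mult_distrib)
    moreover have "mode k w (fibre_scale (of_real (R / 2) * circle_pt t) x) * cnj (circle_pt t) ^ k
        = (circle_pt t ^ k * cnj (circle_pt t) ^ k) * (of_real (R / 2) ^ k * mode k w x)"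
      by (simp only: mode_fibre_scale power_mult_distrib mult_ac)
    ultimately show "mode k w (fibre_scale (of_real (R / 2) * circle_pt t) x) * cnj (circle_pt t) ^ k = of_real (R / 2) ^ k * mode k w x"
      by simp
  qed
  also have "\<dots> = of_real (R / 2) ^ k * mode k w x" using circ.prob_space by simp
  finally show ?thesis using R by simp
qed

definition rho :: "(nat \<Rightarrow> complex) \<Rightarrow> real" where "rho w = exp (\<mu> * base_sq w) * fibre_sq w"

lemma rho_nonneg: "0 \<le> rho w" by (simp add: rho_def)

lemma rho_less_1: "w \<in> D \<Longrightarrow> rho w < 1"
  by (simp add: in_D rho_def exp_minus field_simps)

text \<open>
  The modes are powers of this function, up to a common factor; see \<open>mode_kernel_arg\<close>.
\<close>

definition kernel_arg :: "(nat \<Rightarrow> complex) \<Rightarrow> (nat \<Rightarrow> complex) \<Rightarrow> complex" where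
  "kernel_arg x w = exp (of_real \<mu> * base_form x w) * fibre_form x w"

lemma mode_kernel_arg: "mode k w x = exp (of_real (\<mu> * real m) * base_form x w) * kernel_arg x w ^ k"
proof -
  have "exp (of_real (\<mu> * real (k + m)) * base_form x w) = exp (of_real (\<mu> * real m) * base_form x w) * exp (of_real \<mu> * base_form x w) ^ k"
    unfolding exp_of_nat_mult[symmetric] exp_add[symmetric] by (simp add: algebra_simps)
  then show ?thesis by (simp add: mode_def kernel_arg_def power_mult_distrib)
qed

lemma form_cauchy_schwarz:
  fixes x w :: "nat \<Rightarrow> complex"
  assumes "finite I"
  shows "cmod (\<Sum>i\<in>I. x i * cnj (w i)) \<le> sqrt (\<Sum>i\<in>I. (cmod (x i))\<^sup>2) * sqrt (\<Sum>i\<in>I. (cmod (w i))\<^sup>2)"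
proof -
  have "cmod (\<Sum>i\<in>I. x i * cnj (w i)) \<le> (\<Sum>i\<in>I. \<bar>cmod (x i)\<bar> * \<bar>cmod (w i)\<bar>)"
    by (rule sum_norm_le) (simp add: norm_mult)
  also have "\<dots> \<le> L2_set (\<lambda>i. cmod (x i)) I * L2_set (\<lambda>i. cmod (w i)) I" by (rule L2_set_mult_ineq)
  finally show ?thesis by (simp add: L2_set_def)
qed

text \<open>
  Cauchy-Schwarz for both forms bounds \<open>|t|\<^sup>2\<close> by the product of the values of \<open>rho\<close> at the two points,
  and the domain is where \<open>rho\<close> is less than 1.
\<close>

lemma kernel_arg_less_1:
  assumes "x \<in> D" "w \<in> D"
  shows "cmod (kernel_arg x w) < 1"
proof -
  have fibre_form: "cmod (fibre_form x w) \<le> sqrt (fibre_sq x) * sqrt (fibre_sq w)"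
    unfolding fibre_form_def fibre_sq_def by (rule form_cauchy_schwarz) simp
  have "2 * Re (base_form x w) \<le> base_sq x + base_sq w"
  proof -
    have "Re (base_form x w) \<le> sqrt (base_sq x) * sqrt (base_sq w)"
      using order.trans[OF complex_Re_le_cmod form_cauchy_schwarz[of "{..<n}" x w]] by (simp add: base_form_def base_sq_def)
    moreover have "2 * (sqrt (base_sq x) * sqrt (base_sq w)) \<le> base_sq x + base_sq w"
      using sum_squares_bound[of "sqrt (base_sq x)" "sqrt (base_sq w)"] by (simp add: mult.assoc)
    ultimately show ?thesis by linarith
  qed
  then have "\<mu> * (2 * Re (base_form x w)) \<le> \<mu> * (base_sq x + base_sq w)" using mu_pos by (intro mult_left_mono) auto
  then have e: "exp (\<mu> * Re (base_form x w)) \<le> exp (\<mu> * base_sq x / 2) * exp (\<mu> * base_sq w / 2)"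
    unfolding exp_add[symmetric] by (simp add: algebra_simps)
  have sq: "exp (\<mu> * base_sq x / 2) * sqrt (fibre_sq x) = sqrt (rho x)" for x
  proof -
    have "exp (\<mu> * base_sq x / 2) = sqrt (exp (\<mu> * base_sq x))"
      by (rule real_sqrt_unique[symmetric]) (auto simp: power2_eq_square exp_add[symmetric])
    then show ?thesis by (simp add: rho_def real_sqrt_mult)
  qed
  have "cmod (kernel_arg x w) = exp (\<mu> * Re (base_form x w)) * cmod (fibre_form x w)"
    by (simp add: kernel_arg_def norm_mult norm_exp_eq_Re)
  also have "\<dots> \<le> (exp (\<mu> * base_sq x / 2) * exp (\<mu> * base_sq w / 2)) * (sqrt (fibre_sq x) * sqrt (fibre_sq w))"
    using e fibre_form by (intro mult_mono) auto
  also have "\<dots> = sqrt (rho x) * sqrt (rho w)" unfolding sq[symmetric] by (simp only: mult_ac)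
  also have "\<dots> < 1 * 1"
    using rho_less_1[OF assms(1)] rho_less_1[OF assms(2)] rho_nonneg by (intro mult_strict_mono') auto
  finally show ?thesis by simp
qed

lemma mode_coeff_series:
  assumes "cmod t < 1"
  shows "(\<lambda>k. of_real (mode_coeff k) * t ^ k) sums (of_real (\<mu> ^ n / pi ^ N) * kernel_series n m t)"
proof -
  have "(\<lambda>k. of_real (\<mu> ^ n / pi ^ N) * (fact (k + m) / fact k * of_nat (k + m) ^ n * t ^ k)) sums (of_real (\<mu> ^ n / pi ^ N) * kernel_series n m t)"
    unfolding kernel_series_eq[OF assms] by (intro sums_mult kernel_series_sums assms)
  moreover have "of_real (\<mu> ^ n / pi ^ N) * (fact (k + m) / fact k * of_nat (k + m) ^ n * t ^ k) = of_real (mode_coeff k) * t ^ k" for k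
    by (simp add: mode_coeff_def power_mult_distrib mult_ac)
  ultimately show ?thesis by simp
qed

lemma mode_coeff_summable:
  assumes "0 \<le> r" "r < 1"
  shows "summable (\<lambda>k. mode_coeff k * r ^ k)"
proof -
  have "summable (\<lambda>k. complex_of_real (mode_coeff k) * of_real r ^ k)"
    using mode_coeff_series[of "of_real r"] assms by (auto simp: sums_iff)
  then have "summable (\<lambda>k. Re (complex_of_real (mode_coeff k) * of_real r ^ k))" by (rule summable_Re)
  moreover have "Re (complex_of_real (mode_coeff k) * of_real r ^ k) = mode_coeff k * r ^ k" for k
    by (metis Re_complex_of_real of_real_mult of_real_power)
  ultimately show ?thesis by simp
qed

text \<open>
  A mode is reproduced by itself, so its norm can be read off from its value on the diagonal.
\<close>

lemma mode_norm:
  assumes w: "w \<in> cspace N"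
  shows "(\<integral>x. (cmod (mode k w x))\<^sup>2 * indicator D x \<partial>L) = exp (\<mu> * real m * base_sq w) * rho w ^ k / mode_coeff k"
proof -
  have "complex_of_real (\<integral>x. (cmod (mode k w x))\<^sup>2 * indicator D x \<partial>L) = (\<integral>x. complex_of_real ((cmod (mode k w x))\<^sup>2 * indicator D x) \<partial>L)"
    by (rule integral_complex_of_real[symmetric])
  also have "\<dots> = (\<integral>x. indicator D x *\<^sub>R (mode k w x * cnj (mode k w x)) \<partial>L)"
    unfolding of_real_mult complex_norm_square by (simp add: scaleR_conv_of_real mult_ac)
  also have "\<dots> = mode k w w / of_real (mode_coeff k)"
    using coefficient_integral(2)[OF mode_bergman_D w] by (simp add: hom_part_mode[OF w])
  also have "mode k w w = of_real (exp (\<mu> * real m * base_sq w) * rho w ^ k)"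
    unfolding mode_kernel_arg kernel_arg_def base_form_self fibre_form_self rho_def by (simp add: exp_of_real[symmetric])
  finally have "complex_of_real (\<integral>x. (cmod (mode k w x))\<^sup>2 * indicator D x \<partial>L) = of_real (exp (\<mu> * real m * base_sq w) * rho w ^ k / mode_coeff k)"
    by simp
  then show ?thesis by (simp only: of_real_eq_iff)
qed

text \<open>
  The series of absolute values of the kernel series. Its square integrability in \<open>x\<close> puts the kernel
  into the Bergman space and also justifies integrating the kernel series term by term.
\<close>

definition majorant :: "(nat \<Rightarrow> complex) \<Rightarrow> (nat \<Rightarrow> complex) \<Rightarrow> real" where
  "majorant w x = (\<Sum>k. mode_coeff k * cmod (mode k w x))"

lemma majorant_measurable [measurable]: "majorant w \<in> borel_measurable L"
  unfolding majorant_def by measurable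

lemma majorant_summable:
  assumes "x \<in> D" "w \<in> D"
  shows "summable (\<lambda>k. mode_coeff k * cmod (mode k w x))"
proof -
  have "summable (\<lambda>k. cmod (exp (of_real (\<mu> * real m) * base_form x w)) * (mode_coeff k * cmod (kernel_arg x w) ^ k))"
    by (intro summable_mult mode_coeff_summable kernel_arg_less_1 assms) simp
  then show ?thesis by (simp add: mode_kernel_arg norm_mult norm_power mult_ac)
qed

text \<open>
  Up to polynomial factors the norms of the terms decay like powers of \<open>sqrt (rho w)\<close>. Cauchy-Schwarz with the weights \<open>q ^ k\<close>
  for some q between \<open>rho w\<close> and 1 reduces the norm of the sum to a sum of squared norms.
\<close>

lemma majorant_L2:
  assumes w: "w \<in> D"
  shows "integrable L (\<lambda>x. (majorant w x)\<^sup>2 * indicator D x)"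
  unfolding integrable_iff_bounded
proof
  \<comment> \<open>Any q strictly between \<open>rho w\<close> and 1 works.\<close>
  define q where "q = (1 + rho w) / 2"
  have q: "0 < q" "q < 1" "rho w < q" using rho_less_1[OF w] rho_nonneg[of w] by (auto simp: q_def)
  let ?b = "\<lambda>k x. mode_coeff k * cmod (mode k w x)"
  let ?g = "\<lambda>k x. (?b k x)\<^sup>2 / q ^ k"
  have ptw: "ennreal ((majorant w x)\<^sup>2) \<le> ennreal (1 / (1 - q)) * (\<Sum>k. ennreal (?g k x))" if x: "x \<in> D" for x
  proof (rule LIMSEQ_le_const2)
    have "(\<lambda>j. \<Sum>k<j. ?b k x) \<longlonglongrightarrow> majorant w x"
      unfolding majorant_def by (rule summable_LIMSEQ[OF majorant_summable[OF x w]])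
    then show "(\<lambda>j. ennreal ((\<Sum>k<j. ?b k x)\<^sup>2)) \<longlonglongrightarrow> ennreal ((majorant w x)\<^sup>2)"
      by (intro tendsto_ennrealI tendsto_power)
    show "\<exists>N. \<forall>j\<ge>N. ennreal ((\<Sum>k<j. ?b k x)\<^sup>2) \<le> ennreal (1 / (1 - q)) * (\<Sum>k. ennreal (?g k x))"
    proof (intro exI allI impI)
      fix j
      have "ennreal ((\<Sum>k<j. ?b k x)\<^sup>2) \<le> ennreal (1 / (1 - q) * (\<Sum>k<j. ?g k x))"
        by (intro ennreal_leI weighted_sum_square_le q)
      also have "\<dots> = ennreal (1 / (1 - q)) * (\<Sum>k<j. ennreal (?g k x))"
        using q by (subst ennreal_mult) (auto intro!: sum_nonneg simp: sum_ennreal)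
      also have "\<dots> \<le> ennreal (1 / (1 - q)) * (\<Sum>k. ennreal (?g k x))"
        by (intro mult_left_mono sum_le_suminf) auto
      finally show "ennreal ((\<Sum>k<j. ?b k x)\<^sup>2) \<le> ennreal (1 / (1 - q)) * (\<Sum>k. ennreal (?g k x))" .
    qed
  qed
  have gi: "(\<integral>\<^sup>+x. ennreal (?g k x * indicator D x) \<partial>L) = ennreal (exp (\<mu> * real m * base_sq w) * (mode_coeff k * (rho w / q) ^ k))" for k
  proof -
    have eq: "?g k x * indicator D x = (mode_coeff k)\<^sup>2 / q ^ k * ((cmod (mode k w x))\<^sup>2 * indicator D x)" for x
      by (simp add: power_mult_distrib)
    have "(\<integral>\<^sup>+x. ennreal (?g k x * indicator D x) \<partial>L) = ennreal (\<integral>x. ?g k x * indicator D x \<partial>L)"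
    proof (rule nn_integral_eq_integral)
      show "integrable L (\<lambda>x. ?g k x * indicator D x)" unfolding eq using mode_L2 by simp
      show "AE x in L. 0 \<le> ?g k x * indicator D x" using q by (intro AE_I2) auto
    qed
    also have "(\<integral>x. ?g k x * indicator D x \<partial>L) = (mode_coeff k)\<^sup>2 / q ^ k * (exp (\<mu> * real m * base_sq w) * rho w ^ k / mode_coeff k)"
      unfolding eq using w D_subset mode_norm[of w k] by (subst integral_mult_right_zero) auto
    also have "\<dots> = exp (\<mu> * real m * base_sq w) * (mode_coeff k * (rho w / q) ^ k)"
      using mode_coeff_pos[of k] by (simp add: power2_eq_square power_divide)
    finally show ?thesis .
  qed
  have "(\<integral>\<^sup>+x. ennreal (norm ((majorant w x)\<^sup>2 * indicator D x)) \<partial>L) \<le> (\<integral>\<^sup>+x. ennreal (1 / (1 - q)) * (\<Sum>k. ennreal (?g k x * indicator D x)) \<partial>L)"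
  proof (rule nn_integral_mono)
    fix x show "ennreal (norm ((majorant w x)\<^sup>2 * indicator D x)) \<le> ennreal (1 / (1 - q)) * (\<Sum>k. ennreal (?g k x * indicator D x))"
      using ptw[of x] by (cases "x \<in> D") auto
  qed
  also have "\<dots> = ennreal (1 / (1 - q)) * (\<Sum>k. (\<integral>\<^sup>+x. ennreal (?g k x * indicator D x) \<partial>L))"
    by (subst nn_integral_cmult) (simp_all add: nn_integral_suminf)
  also have "\<dots> < \<infinity>"
  proof -
    have "summable (\<lambda>k. exp (\<mu> * real m * base_sq w) * (mode_coeff k * (rho w / q) ^ k))"
      using q rho_nonneg[of w] by (intro summable_mult mode_coeff_summable) auto
    then have "(\<Sum>k. ennreal (exp (\<mu> * real m * base_sq w) * (mode_coeff k * (rho w / q) ^ k))) \<noteq> top"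
      using q rho_nonneg[of w] mode_coeff_pos by (intro ennreal_suminf_neq_top) (auto simp: less_imp_le)
    then show ?thesis unfolding gi by (simp add: less_top[symmetric] ennreal_mult_eq_top_iff)
  qed
  finally show "(\<integral>\<^sup>+x. ennreal (norm ((majorant w x)\<^sup>2 * indicator D x)) \<partial>L) < \<infinity>" .
qed measurable

definition fbh_kernel :: "(nat \<Rightarrow> complex) \<Rightarrow> (nat \<Rightarrow> complex) \<Rightarrow> complex" where
  "fbh_kernel x w = (if x \<in> D \<and> w \<in> D then of_real (\<mu> ^ n / pi ^ N) * exp (of_real (\<mu> * real m) * base_form x w) * kernel_series n m (kernel_arg x w) else 0)"

lemma fbh_kernel_sums:
  assumes "x \<in> D" "w \<in> D"
  shows "(\<lambda>k. of_real (mode_coeff k) * mode k w x) sums fbh_kernel x w"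
proof -
  have "(\<lambda>k. exp (of_real (\<mu> * real m) * base_form x w) * (of_real (mode_coeff k) * kernel_arg x w ^ k)) sums
     (exp (of_real (\<mu> * real m) * base_form x w) * (of_real (\<mu> ^ n / pi ^ N) * kernel_series n m (kernel_arg x w)))"
    by (intro sums_mult mode_coeff_series kernel_arg_less_1 assms)
  then show ?thesis using assms by (simp add: fbh_kernel_def mode_kernel_arg mult_ac)
qed

lemma fbh_kernel_le_majorant:
  assumes "x \<in> D" "w \<in> D"
  shows "cmod (fbh_kernel x w) \<le> majorant w x"
proof -
  have s: "summable (\<lambda>k. cmod (of_real (mode_coeff k) * mode k w x))"
    using majorant_summable[OF assms] mode_coeff_pos by (simp add: norm_mult less_imp_le)
  have "cmod (fbh_kernel x w) = cmod (\<Sum>k. of_real (mode_coeff k) * mode k w x)"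
    using fbh_kernel_sums[OF assms] by (simp add: sums_iff)
  also have "\<dots> \<le> (\<Sum>k. cmod (of_real (mode_coeff k) * mode k w x))" by (rule summable_norm[OF s])
  also have "\<dots> = majorant w x" using mode_coeff_pos by (simp add: majorant_def norm_mult less_imp_le)
  finally show ?thesis .
qed

lemma cholomorphic_fbh_kernel:
  assumes w: "w \<in> D"
  shows "cholomorphic_on N (\<lambda>x. fbh_kernel x w) D"
proof (rule cholomorphic_on_cong)
  have kernel_arg: "cholomorphic_on N (\<lambda>x. kernel_arg x w) D"
    unfolding kernel_arg_def
    by (intro cholomorphic_on_mult[OF D_subset] cholomorphic_fibre_form
        cholomorphic_compose_entire[OF cholomorphic_base_form, of "\<lambda>z. exp (of_real \<mu> * z)"] holomorphic_intros)
  have ks: "cholomorphic_on N (\<lambda>x. kernel_series n m (kernel_arg x w)) D"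
    by (rule cholomorphic_on_compose[OF D_subset kernel_arg])
       (use w in \<open>auto intro: kernel_series_field_differentiable kernel_arg_less_1\<close>)
  have ex: "cholomorphic_on N (\<lambda>x. of_real (\<mu> ^ n / pi ^ N) * exp (of_real (\<mu> * real m) * base_form x w)) D"
    by (rule cholomorphic_compose_entire[OF cholomorphic_base_form, of "\<lambda>z. of_real (\<mu> ^ n / pi ^ N) * exp (of_real (\<mu> * real m) * z)"])
       (intro holomorphic_intros)
  show "cholomorphic_on N (\<lambda>x. of_real (\<mu> ^ n / pi ^ N) * exp (of_real (\<mu> * real m) * base_form x w) * kernel_series n m (kernel_arg x w)) D"
    by (rule cholomorphic_on_mult[OF D_subset ex ks])
qed (use w in \<open>simp add: fbh_kernel_def\<close>)

lemma fbh_kernel_bergman_D: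
  assumes w: "w \<in> D"
  shows "(\<lambda>x. fbh_kernel x w) \<in> bergman_D"
  unfolding bergman_D_iff
proof
  show hol: "cholomorphic_on N (\<lambda>x. fbh_kernel x w) D" by (rule cholomorphic_fbh_kernel[OF w])
  have [measurable]: "(\<lambda>x. fbh_kernel x w) \<in> borel_measurable L"
  proof -
    have "(\<lambda>x. indicator D x *\<^sub>R fbh_kernel x w) = (\<lambda>x. fbh_kernel x w)" by (auto simp: fbh_kernel_def indicator_def)
    then show ?thesis using cholomorphic_D_measurable[OF hol] by simp
  qed
  show "integrable L (\<lambda>x. (cmod (fbh_kernel x w))\<^sup>2 * indicator D x)"
  proof (rule Bochner_Integration.integrable_bound[OF majorant_L2[OF w]])
    show "AE x in L. norm ((cmod (fbh_kernel x w))\<^sup>2 * indicator D x) \<le> norm ((majorant w x)\<^sup>2 * indicator D x)"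
    proof (rule AE_I2)
      fix x
      show "norm ((cmod (fbh_kernel x w))\<^sup>2 * indicator D x) \<le> norm ((majorant w x)\<^sup>2 * indicator D x)"
        using fbh_kernel_le_majorant[OF _ w, of x] by (auto simp: indicator_def intro!: power_mono)
    qed
  qed measurable
qed

text \<open>
  The partial sums of the kernel series integrate to the partial sums of the homogeneous expansion of
  \<open>f\<close> at \<open>w\<close>, and they are dominated by the product of \<open>|f|\<close> and the majorant, both of which are square
  integrable.
\<close>

lemma fbh_kernel_reproducing:
  assumes f: "f \<in> bergman_D" and w: "w \<in> D"
  shows "(\<integral>x. indicator D x *\<^sub>R (f x * cnj (fbh_kernel x w)) \<partial>L) = f w"
proof -
  have hol: "cholomorphic_on N f D" and int: "integrable L (\<lambda>x. (cmod (f x))\<^sup>2 * indicator D x)"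
    using f by (auto simp: bergman_D_iff)
  note [measurable] = cholomorphic_D_measurable[OF hol]
  have wc: "w \<in> cspace N" using w D_subset by blast
  let ?t = "\<lambda>k x. of_real (mode_coeff k) * (indicator D x *\<^sub>R (f x * cnj (mode k w x)))"
  let ?S = "\<lambda>j x. \<Sum>k<j. ?t k x"
  have it: "integrable L (?t k)" for k by (intro integrable_mult_right coefficient_integral(1)[OF f wc])
  have tm [measurable]: "?t k \<in> borel_measurable L" for k using it by (rule borel_measurable_integrable)
  have conv: "(\<lambda>j. ?S j x) \<longlonglongrightarrow> indicator D x *\<^sub>R (f x * cnj (fbh_kernel x w))" for x
  proof (cases "x \<in> D")
    case True
    have "(\<lambda>k. f x * cnj (of_real (mode_coeff k) * mode k w x)) sums (f x * cnj (fbh_kernel x w))"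
      by (intro sums_mult) (use fbh_kernel_sums[OF True w] in \<open>simp only: sums_cnj\<close>)
    then show ?thesis using True by (simp add: sums_def mult_ac)
  qed simp
  have "(\<lambda>j. \<integral>x. ?S j x \<partial>L) \<longlonglongrightarrow> (\<integral>x. indicator D x *\<^sub>R (f x * cnj (fbh_kernel x w)) \<partial>L)"
  proof (rule integral_dominated_convergence)
    show "?S j \<in> borel_measurable L" for j by (intro borel_measurable_sum tm)
    show "(\<lambda>x. indicator D x *\<^sub>R (f x * cnj (fbh_kernel x w))) \<in> borel_measurable L"
    proof (rule borel_measurable_LIMSEQ_metric)
      show "?S j \<in> borel_measurable L" for j by (intro borel_measurable_sum tm)
    qed (rule conv)
    have "integrable L (\<lambda>x. (indicator D x *\<^sub>R f x) * cnj (of_real (majorant w x)) * of_real (indicator D x))"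
    proof (rule integrable_L2_product)
      have "(cmod (indicator D x *\<^sub>R f x))\<^sup>2 * indicator D x = (cmod (f x))\<^sup>2 * indicator D x" for x
        by (simp add: indicator_def)
      then show "integrable L (\<lambda>x. (cmod (indicator D x *\<^sub>R f x))\<^sup>2 * indicator D x)" using int by (simp only:)
      show "integrable L (\<lambda>x. (cmod (complex_of_real (majorant w x)))\<^sup>2 * indicator D x)"
        using majorant_L2[OF w] by simp
    qed auto
    then show "integrable L (\<lambda>x. norm ((indicator D x *\<^sub>R f x) * cnj (of_real (majorant w x)) * of_real (indicator D x)))"
      by (rule integrable_norm)
    show "AE x in L. (\<lambda>j. ?S j x) \<longlonglongrightarrow> indicator D x *\<^sub>R (f x * cnj (fbh_kernel x w))"
      using conv by simp
    show "AE x in L. norm (?S j x) \<le> norm ((indicator D x *\<^sub>R f x) * cnj (of_real (majorant w x)) * of_real (indicator D x))" for j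
    proof (rule AE_I2)
      fix x
      show "norm (?S j x) \<le> norm ((indicator D x *\<^sub>R f x) * cnj (of_real (majorant w x)) * of_real (indicator D x))"
      proof (cases "x \<in> D")
        case True
        have "norm (?S j x) \<le> (\<Sum>k<j. cmod (f x) * (mode_coeff k * cmod (mode k w x)))"
          by (rule sum_norm_le) (use True mode_coeff_pos in \<open>simp add: norm_mult less_imp_le\<close>)
        also have "\<dots> = cmod (f x) * (\<Sum>k<j. mode_coeff k * cmod (mode k w x))" by (simp add: sum_distrib_left)
        also have "\<dots> \<le> cmod (f x) * majorant w x"
          unfolding majorant_def using mode_coeff_pos
          by (intro mult_left_mono sum_le_suminf majorant_summable[OF True w]) (auto simp: less_imp_le)
        also have "\<dots> \<le> norm ((indicator D x *\<^sub>R f x) * cnj (of_real (majorant w x)) * of_real (indicator D x))"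
          using True by (simp add: norm_mult mult_left_mono)
        finally show ?thesis .
      qed simp
    qed
  qed
  moreover have "(\<integral>x. ?S j x \<partial>L) = (\<Sum>k<j. hom_part f k w)" for j
  proof -
    have "(\<integral>x. ?S j x \<partial>L) = (\<Sum>k<j. \<integral>x. ?t k x \<partial>L)" by (rule Bochner_Integration.integral_sum) (rule it)
    also have "\<dots> = (\<Sum>k<j. hom_part f k w)"
    proof (rule sum.cong[OF refl])
      fix k
      have "(\<integral>x. ?t k x \<partial>L) = of_real (mode_coeff k) * (hom_part f k w / of_real (mode_coeff k))"
        unfolding integral_mult_right_zero coefficient_integral(2)[OF f wc] ..
      then show "(\<integral>x. ?t k x \<partial>L) = hom_part f k w" using mode_coeff_pos[of k] by simp
    qed
    finally show ?thesis .
  qed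
  ultimately have "(\<lambda>j. \<Sum>k<j. hom_part f k w) \<longlonglongrightarrow> (\<integral>x. indicator D x *\<^sub>R (f x * cnj (fbh_kernel x w)) \<partial>L)" by simp
  moreover have "(\<lambda>j. \<Sum>k<j. hom_part f k w) \<longlonglongrightarrow> f w" using hom_part_sums[OF hol w] by (simp add: sums_def)
  ultimately show ?thesis by (rule LIMSEQ_unique)
qed

theorem bergman_kernel_D: "bergman_kernel N D = fbh_kernel"
proof -
  have fbh_kernel: "is_bergman_kernel N D fbh_kernel"
    unfolding is_bergman_kernel_def set_lebesgue_integral_def
    using fbh_kernel_bergman_D fbh_kernel_reproducing by (auto simp: bergman_D_def lebesgue_C_def fbh_kernel_def)
  show ?thesis unfolding bergman_kernel_def
    by (rule the_equality[where P = "is_bergman_kernel N D", OF fbh_kernel]) (rule bergman_kernel_unique[OF _ fbh_kernel])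
qed

text \<open>
  Two points of the fibre over 0 on one complex line suffice.
\<close>

lemma kernel_arg_surj:
  assumes t: "cmod t < 1"
  shows "\<exists>x\<in>D. \<exists>w\<in>D. kernel_arg x w = t"
proof -
  define e where "e a = (\<lambda>i\<in>{..<N}. if i = n then a else 0 :: complex)" for a
  have base_sq: "base_sq (e a) = 0" for a by (simp add: base_sq_def e_def)
  have fibre_sq: "fibre_sq (e a) = (cmod a)\<^sup>2" for a
  proof -
    have "fibre_sq (e a) = (\<Sum>i\<in>{n..<N}. if i = n then (cmod a)\<^sup>2 else 0)"
      unfolding fibre_sq_def by (rule sum.cong) (auto simp: e_def)
    then show ?thesis using m_pos by simp
  qed
  have base_form: "base_form (e a) (e b) = 0" for a b by (simp add: base_form_def e_def)
  have fibre_form: "fibre_form (e a) (e b) = a * cnj b" for a b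
  proof -
    have "fibre_form (e a) (e b) = (\<Sum>i\<in>{n..<N}. if i = n then a * cnj b else 0)"
      unfolding fibre_form_def by (rule sum.cong) (auto simp: e_def)
    then show ?thesis using m_pos by simp
  qed
  have inD: "e a \<in> D" if "(cmod a)\<^sup>2 < 1" for a
    using that by (simp add: in_D base_sq fibre_sq) (simp add: e_def cspace_def)
  \<comment> \<open>The two points \<open>a\<close> and \<open>b\<close> have the same modulus \<open>sqrt |t|\<close>, and the phase of t is put into \<open>a\<close>.\<close>
  define b where "b = complex_of_real (sqrt (cmod t))"
  have b: "(cmod b)\<^sup>2 = cmod t" by (simp add: b_def)
  define a where "a = sgn t * b"
  have a: "(cmod a)\<^sup>2 \<le> cmod t"
    by (simp add: a_def norm_mult power_mult_distrib b norm_sgn)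
  have "a * cnj b = sgn t * of_real ((cmod b)\<^sup>2)" unfolding a_def complex_norm_square by simp
  also have "\<dots> = t" unfolding b by (cases "t = 0") (simp_all add: sgn_eq)
  finally have "kernel_arg (e a) (e b) = t" by (simp add: kernel_arg_def base_form fibre_form)
  moreover have "e a \<in> D" "e b \<in> D" using a b t by (auto intro!: inD)
  ultimately show ?thesis by blast
qed

theorem lu_qi_keng_iff: "lu_qi_keng_domain N D \<longleftrightarrow> (\<forall>t. cmod t < 1 \<longrightarrow> kernel_series n m t \<noteq> 0)"
proof -
  have "fbh_kernel z w \<noteq> 0 \<longleftrightarrow> kernel_series n m (kernel_arg z w) \<noteq> 0" if "z \<in> D" "w \<in> D" for z w
    using that mu_pos by (simp add: fbh_kernel_def)
  then have "lu_qi_keng_domain N D \<longleftrightarrow> (\<forall>z\<in>D. \<forall>w\<in>D. kernel_series n m (kernel_arg z w) \<noteq> 0)"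
    by (simp add: lu_qi_keng_domain_def D_cdomain bergman_kernel_D)
  also have "\<dots> \<longleftrightarrow> (\<forall>t. cmod t < 1 \<longrightarrow> kernel_series n m t \<noteq> 0)"
    using kernel_arg_surj kernel_arg_less_1 by metis
  finally show ?thesis .
qed

end

section \<open>The threshold dimension\<close>

theorem theoremA:
  fixes n :: nat
  assumes "n \<ge> 1"
  shows "\<exists>!m0::nat. m0 \<ge> 1 \<and>
    (\<forall>\<mu>::real. \<mu> > 0 \<longrightarrow>
      (\<forall>m::nat. m \<ge> 1 \<longrightarrow> (lu_qi_keng_domain (n + m) (D_dom \<mu> n m) \<longleftrightarrow> m \<ge> m0)))"
proof -
  obtain m0 where m0: "m0 \<ge> 1" "\<And>m. m \<ge> 1 \<Longrightarrow> (\<forall>t. cmod t < 1 \<longrightarrow> kernel_series n m t \<noteq> 0) \<longleftrightarrow> m0 \<le> m"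
    using kernel_series_threshold[of n] by blast
  have lqk: "lu_qi_keng_domain (n + m) (D_dom \<mu> n m) \<longleftrightarrow> m0 \<le> m" if "\<mu> > 0" "m \<ge> 1" for \<mu> m
  proof -
    interpret fock_bargmann_hartogs n m \<mu> by unfold_locales (use that in auto)
    show ?thesis using lu_qi_keng_iff m0(2)[OF that(2)] by (simp add: D_def)
  qed
  show ?thesis
  proof (intro ex1I conjI allI impI)
    fix m1
    assume m1: "m1 \<ge> 1 \<and> (\<forall>\<mu>::real. \<mu> > 0 \<longrightarrow>
      (\<forall>m::nat. m \<ge> 1 \<longrightarrow> (lu_qi_keng_domain (n + m) (D_dom \<mu> n m) \<longleftrightarrow> m \<ge> m1)))"
    then have "m1 \<le> m \<longleftrightarrow> m0 \<le> m" if "m \<ge> 1" for m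
      using lqk[of 1 m] that by auto
    then show "m1 = m0" using m1 m0(1) by (meson dual_order.antisym order_refl)
  qed (use m0(1) lqk in auto)
qed

end
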